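(* Let $\bar\theta:[0,\infty)\to[0,\infty)^2$ and $\bar c:[0,\infty)\to[0,\infty)$ be measurable and locally integrable, and let $C(s,t)$, $\Xi(s,t)$ and $(D_y)_{y\in[0,\infty)^2}$ be as defined in the context. Let $x\in E$ and define the process $X^{\bar c,\bar\theta}$ by $$X^{\bar c,\bar\theta}_t=C(0,t)\,D_{x+\Xi(0,t)},\qquad t\ge0.$$ Then $X^{\bar c,\bar\theta}$ is a time-inhomogeneous Markov process on $E$ with càdlàg paths and with transition probabilities $$p_{s,t}(z,\cdot)=Q_{C(s,t)z+C(0,t)\Xi(s,t)}\qquad\text{for }0\le s<t,\ z\in E.$$ In particular, for $\theta\in[0,\infty)^2$ and $c>0$, taking $\bar c\equiv c$ and $\bar\theta\equiv c\,\theta$, the process $$X^{c,\theta}_t=e^{-ct}D_{x+(e^{ct}-1)\theta},\qquad t\ge 0,$$ is an infinite rate mutually catalytic branching process with parameters $(c,\theta)$.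
   Context: Let $E:=[0,\infty)^2\setminus(0,\infty)^2$. For $x\in[0,\infty)^2$, $Q_x$ denotes the law of $W_\tau$, where $W$ is a standard planar Brownian motion started at $x$ and $\tau=\inf\{t>0: W_t\notin(0,\infty)^2\}$ (so $Q_x$ is a probability measure on $E$, and $Q_x=\delta_x$ if $x\in E$). Let $B$ be a standard planar Brownian motion with $B_0=0$. For $z\in\mathbb{R}^2$ write $[z,\infty)=[z_1,\infty)\times[z_2,\infty)$. For $y\in[0,\infty)^2$ let $$\tau_y:=\inf\{t>0: B_t\notin[-y,\infty)\},\qquad D_y:=B_{\tau_y}+y\in E.$$ For $0\le s\le t$ let $$C(s,t)=\exp\Big(-\int_s^t\bar c(r)\,dr\Big),\qquad \Xi(s,t)=\int_s^t\frac{\bar\theta(r)}{C(0,r)}\,dr.$$ The infinite rate mutually catalytic branching process with parameters $(c,\theta)$ is the Markov process with state space $E$, càdlàg paths and transition kernels $p_t(x,\cdot)=Q_{e^{-ct}x+(1-e^{-ct})\theta}$, $t\ge0$, $x\in E$. *)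

theory Defs
  imports "HOL-Probability.Probability"
begin

section \<open>Planar Brownian motion and exit from quadrants\<close>

text \<open>
  Time is \<^typ>\<open>real\<close>; only the values of a process at times \<open>t \<ge> 0\<close> matter. Continuity of the paths
  and the initial value hold for every \<open>\<omega>\<close>, not only almost surely, so that exit times are
  measurable without assuming that \<open>M\<close> is complete.
\<close>

locale planar_brownian = prob_space M
  for M :: "'w measure" and W :: "real \<Rightarrow> 'w \<Rightarrow> real \<times> real" and x :: "real \<times> real" +
  assumes random_variable: "\<And>t. 0 \<le> t \<Longrightarrow> W t \<in> borel_measurable M"
    and start: "\<And>\<omega>. \<omega> \<in> space M \<Longrightarrow> W 0 \<omega> = x"
    and continuous_paths: "\<And>\<omega>. \<omega> \<in> space M \<Longrightarrow> continuous_on {0..} (\<lambda>t. W t \<omega>)"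
    and independent_increments:
      "\<And>(n::nat) t. 0 \<le> t 0 \<Longrightarrow> mono_on {..n} t \<Longrightarrow>
        indep_vars (\<lambda>_. borel) (\<lambda>i \<omega>. W (t (Suc i)) \<omega> - W (t i) \<omega>) {..<n}"
    and gaussian_increments:
      "\<And>s t. 0 \<le> s \<Longrightarrow> s < t \<Longrightarrow>
        distributed M lborel (\<lambda>\<omega>. W t \<omega> - W s \<omega>)
          (\<lambda>y. ennreal (normal_density 0 (sqrt (t - s)) (fst y) *
                         normal_density 0 (sqrt (t - s)) (snd y)))"

definition exit_time :: "(real \<Rightarrow> 'w \<Rightarrow> 'a) \<Rightarrow> 'a set \<Rightarrow> 'w \<Rightarrow> ereal" where
  "exit_time W S \<omega> = (INF t\<in>{t. 0 < t \<and> W t \<omega> \<notin> S}. ereal t)"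

definition quadrant_from :: "real \<times> real \<Rightarrow> (real \<times> real) set" where
  "quadrant_from z = {fst z..} \<times> {snd z..}"

abbreviation quadrant :: "(real \<times> real) set" where
  "quadrant \<equiv> {0..} \<times> {0..}"

abbreviation open_quadrant :: "(real \<times> real) set" where
  "open_quadrant \<equiv> {0<..} \<times> {0<..}"

definition E :: "(real \<times> real) set" where
  "E = quadrant - open_quadrant"

definition E_borel :: "(real \<times> real) measure" where
  "E_borel = restrict_space borel E"

text \<open>
  On the null event of an infinite exit time, the exit positions below get the value \<open>0 \<in> E\<close>.
\<close>

definition quadrant_exit :: "(real \<Rightarrow> 'w \<Rightarrow> real \<times> real) \<Rightarrow> 'w \<Rightarrow> real \<times> real" where
  "quadrant_exit W \<omega> =
    (if exit_time W open_quadrant \<omega> = \<infinity> then 0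
     else W (real_of_ereal (exit_time W open_quadrant \<omega>)) \<omega>)"

text \<open>
  The law \<open>Q\<^sub>x\<close>. It does not depend on the Brownian motion \<open>W\<close>; fixing the type
  \<^typ>\<open>real \<Rightarrow> real \<times> real\<close> of the sample points is no restriction, because every Brownian motion
  can be transported to its path space. The equation \<open>Q\<^sub>x = \<delta>\<^sub>x\<close> for \<open>x \<in> E\<close> is a consequence.
\<close>

definition Q :: "real \<times> real \<Rightarrow> (real \<times> real) measure" where
  "Q x = (THE \<mu>. \<exists>(P :: (real \<Rightarrow> real \<times> real) measure) W.
            planar_brownian P W x \<and> \<mu> = distr P E_borel (quadrant_exit W))"

definition D :: "(real \<Rightarrow> 'w \<Rightarrow> real \<times> real) \<Rightarrow> real \<times> real \<Rightarrow> 'w \<Rightarrow> real \<times> real" where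
  "D B y \<omega> =
    (if exit_time B (quadrant_from (- y)) \<omega> = \<infinity> then 0
     else B (real_of_ereal (exit_time B (quadrant_from (- y)) \<omega>)) \<omega> + y)"


section \<open>Markov processes\<close>

definition natural_filtration ::
    "'w measure \<Rightarrow> 'a measure \<Rightarrow> (real \<Rightarrow> 'w \<Rightarrow> 'a) \<Rightarrow> real \<Rightarrow> 'w measure" where
  "natural_filtration M S X s =
    sigma (space M) {X r -` A \<inter> space M | r A. 0 \<le> r \<and> r \<le> s \<and> A \<in> sets S}"

definition transition_function ::
    "'a measure \<Rightarrow> (real \<Rightarrow> real \<Rightarrow> 'a \<Rightarrow> 'a measure) \<Rightarrow> bool" where
  "transition_function S p \<longleftrightarrow>
    (\<forall>s t. 0 \<le> s \<and> s < t \<longrightarrow> p s t \<in> S \<rightarrow>\<^sub>M prob_algebra S) \<and>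
    (\<forall>s t u. 0 \<le> s \<and> s < t \<and> t < u \<longrightarrow> (\<forall>z\<in>space S. p s t z \<bind> p t u = p s u z))"

text \<open>
  The Markov property is taken with respect to the filtration generated by the process itself,
  and nothing is said about the initial distribution.
\<close>

definition markov_process ::
    "'w measure \<Rightarrow> 'a measure \<Rightarrow> (real \<Rightarrow> real \<Rightarrow> 'a \<Rightarrow> 'a measure) \<Rightarrow>
      (real \<Rightarrow> 'w \<Rightarrow> 'a) \<Rightarrow> bool" where
  "markov_process M S p X \<longleftrightarrow>
    prob_space M \<and>
    (\<forall>t\<ge>0. X t \<in> M \<rightarrow>\<^sub>M S) \<and>
    transition_function S p \<and>
    (\<forall>s t. 0 \<le> s \<and> s < t \<longrightarrow> (\<forall>A\<in>sets S.
      AE \<omega> in M. real_cond_exp M (natural_filtration M S X s)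
                   (indicat_real (X t -` A \<inter> space M)) \<omega> = measure (p s t (X s \<omega>)) A))"

definition homogeneous_markov_process ::
    "'w measure \<Rightarrow> 'a measure \<Rightarrow> (real \<Rightarrow> 'a \<Rightarrow> 'a measure) \<Rightarrow> (real \<Rightarrow> 'w \<Rightarrow> 'a) \<Rightarrow> bool" where
  "homogeneous_markov_process M S p X \<longleftrightarrow>
    (\<forall>z\<in>space S. p 0 z = return S z) \<and> markov_process M S (\<lambda>s t. p (t - s)) X"

definition cadlag :: "(real \<Rightarrow> 'a::topological_space) \<Rightarrow> bool" where
  "cadlag f \<longleftrightarrow>
    (\<forall>t\<ge>0. continuous (at_right t) f) \<and> (\<forall>t>0. \<exists>l. (f \<longlongrightarrow> l) (at_left t))"


section \<open>The processes\<close>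

definition locally_integrable :: "(real \<Rightarrow> 'a::{banach, second_countable_topology}) \<Rightarrow> bool" where
  "locally_integrable f \<longleftrightarrow> (\<forall>t\<ge>0. set_integrable lborel {0..t} f)"

definition C :: "(real \<Rightarrow> real) \<Rightarrow> real \<Rightarrow> real \<Rightarrow> real" where
  "C c s t = exp (- (LINT r:{s..t}|lborel. c r))"

definition Xi :: "(real \<Rightarrow> real) \<Rightarrow> (real \<Rightarrow> real \<times> real) \<Rightarrow> real \<Rightarrow> real \<Rightarrow> real \<times> real" where
  "Xi c \<theta> s t = (LINT r:{s..t}|lborel. \<theta> r /\<^sub>R C c 0 r)"

definition X_process ::
    "(real \<Rightarrow> 'w \<Rightarrow> real \<times> real) \<Rightarrow> real \<times> real \<Rightarrow> (real \<Rightarrow> real) \<Rightarrow> (real \<Rightarrow> real \<times> real) \<Rightarrow>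
      real \<Rightarrow> 'w \<Rightarrow> real \<times> real" where
  "X_process B x c \<theta> t \<omega> = C c 0 t *\<^sub>R D B (x + Xi c \<theta> 0 t) \<omega>"

text \<open>Infinite rate mutually catalytic branching process with parameters \<open>(c, \<theta>)\<close>\<close>

definition imub ::
    "'w measure \<Rightarrow> real \<Rightarrow> real \<times> real \<Rightarrow> (real \<Rightarrow> 'w \<Rightarrow> real \<times> real) \<Rightarrow> bool" where
  "imub M c \<theta> X \<longleftrightarrow>
    homogeneous_markov_process M E_borel
      (\<lambda>t z. Q (exp (- c * t) *\<^sub>R z + (1 - exp (- c * t)) *\<^sub>R \<theta>)) X \<and>
    (AE \<omega> in M. cadlag (\<lambda>t. X t \<omega>))"

end

theory Submission
  imports Defs
begin

text \<open>
  A Brownian motion \<open>B\<close> started at \<open>0\<close> carries all exit positions \<open>D\<^sub>y\<close> at once, and they can be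
  read off one after the other. The quadrants \<open>[-y, \<infinity>)\<close> grow with \<open>y\<close>; hence, for \<open>v\<close> in the
  quadrant, \<open>B\<close> leaves \<open>[-(y + v), \<infinity>)\<close> not before its exit time \<open>\<tau>\<close> from \<open>[-y, \<infinity>)\<close>, and it does so
  where the increments after \<open>\<tau>\<close>, started at \<open>D\<^sub>y + v\<close>, leave the closed quadrant
  (\<open>D_after_exit\<close>). By the strong Markov property these increments form a Brownian motion that is
  independent of the past of \<open>\<tau>\<close> (\<open>strong_markov\<close>). So, given this past, \<open>D\<close> at \<open>y + v\<close> has
  the law \<open>Q\<close> at \<open>D\<^sub>y + v\<close> (\<open>strong_markov_D\<close>).

  Now let \<open>y\<^sub>t\<close> be a curve that grows in both coordinates, such as \<open>x + \<Xi>(0, t)\<close>, and let \<open>\<alpha>\<^sub>t > 0\<close>,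
  such as \<open>C(0, t)\<close>. The positions \<open>D\<close> at \<open>y\<^sub>r\<close> with \<open>r \<le> s\<close> belong to the past of the exit from
  \<open>[-y\<^sub>s, \<infinity>)\<close>, and the image of \<open>Q\<^sub>z\<close> under multiplication by \<open>a > 0\<close> is \<open>Q\<close> at \<open>a z\<close>. Therefore
  \<open>X\<^sub>t = \<alpha>\<^sub>t D\<close> (at \<open>y\<^sub>t\<close>) is Markov, and its kernel from \<open>s\<close> to \<open>t\<close> maps \<open>z\<close> to \<open>Q\<close> at
  \<open>(\<alpha>\<^sub>t / \<alpha>\<^sub>s) z + \<alpha>\<^sub>t (y\<^sub>t - y\<^sub>s)\<close> (\<open>markov_process_D\<close>). Taking expectations in the same identity
  gives the Chapman-Kolmogorov equations. The paths are cadlag because the exit times grow and are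
  right-continuous along the curve while the Brownian path is continuous (\<open>cadlag_D\<close>). Both parts
  of the theorem are instances.

  One gap has to be closed: \<open>Q\<^sub>y\<close> is defined by the exit from the open quadrant, \<open>D\<^sub>y\<close> by the
  exit from the closed one. The two exits of \<open>y + B\<close> differ only if a coordinate of \<open>B\<close> touches
  the level \<open>-a\<close>, where \<open>a\<close> is the same coordinate of \<open>y\<close>, without going below it for a while.
  This has probability \<open>0\<close>, by scaling: the probability that a coordinate never becomes
  negative is the same as that it stays above \<open>-a\<close> forever, for every \<open>a\<close>, and the Markov property
  at time \<open>1\<close> forces it to vanish; and the minima over different intervals are multiples of each
  other in law, so that for all but countably many intervals \<open>-a\<close> is not an atom of the law of the
  minimum (\<open>AE_immediately_negative\<close>, \<open>AE_no_touch\<close>, \<open>Q_eq_distr_D\<close>).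

  Laws of paths are laws on \<open>rat \<Rightarrow> real \<times> real\<close>, the space of paths restricted to rational times.
  Its index type is countable, so it is a metric space whose Borel sets are generated by the
  coordinates. Exit positions are measurable functions of the restricted path, finitely many
  rational times lie on a common grid of independent Gaussian increments, and convergence at every
  rational time is convergence in a metric space; the last point is what the strong Markov property
  needs, which is reached from dyadic times in the limit.
\<close>

section \<open>Exit times and exit positions of a single path\<close>

lemma exit_time_less_iff:
  "exit_time W S \<omega> < c \<longleftrightarrow> (\<exists>t>0. ereal t < c \<and> W t \<omega> \<notin> S)"
  unfolding exit_time_def INF_less_iff by auto

lemma exit_time_nonneg: "0 \<le> exit_time W S \<omega>"
  by (auto simp: exit_time_def intro!: INF_greatest)

lemma exit_time_le: "0 < t \<Longrightarrow> W t \<omega> \<notin> S \<Longrightarrow> exit_time W S \<omega> \<le> ereal t"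
  by (auto simp: exit_time_def intro!: INF_lower)

lemma inside_before_exit: "0 < t \<Longrightarrow> ereal t < exit_time W S \<omega> \<Longrightarrow> W t \<omega> \<in> S"
  using exit_time_le[of t W \<omega> S] by force

lemma exit_time_cong:
  assumes "\<And>t. 0 < t \<Longrightarrow> V t \<eta> \<in> T \<longleftrightarrow> W t \<omega> \<in> S"
  shows "exit_time V T \<eta> = exit_time W S \<omega>"
proof -
  have "{t. 0 < t \<and> V t \<eta> \<notin> T} = {t. 0 < t \<and> W t \<omega> \<notin> S}"
    using assms by auto
  then show ?thesis unfolding exit_time_def by simp
qed

lemma exit_time_real_cases:
  obtains (inf) "exit_time W S \<omega> = \<infinity>" | (fin) r where "exit_time W S \<omega> = ereal r" "0 \<le> r"
  using exit_time_nonneg[of W S \<omega>] by (cases "exit_time W S \<omega>") auto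

lemma outside_after_exit:
  assumes "exit_time W S \<omega> = ereal r" "0 < e"
  obtains t where "0 < t" "r \<le> t" "t < r + e" "W t \<omega> \<notin> S"
proof -
  have "exit_time W S \<omega> < ereal (r + e)" using assms by simp
  then obtain t where "t > 0" "ereal t < ereal (r + e)" "W t \<omega> \<notin> S"
    unfolding exit_time_less_iff by blast
  moreover have "ereal r \<le> ereal t" using exit_time_le[of t W \<omega> S] calculation assms by simp
  ultimately show thesis using that by simp
qed

lemma in_quadrant_from_iff: "w \<in> quadrant_from (- y) \<longleftrightarrow> w + y \<in> quadrant"
  by (cases w; cases y) (auto simp: quadrant_from_def)

lemma mem_quadrant: "w \<in> quadrant \<longleftrightarrow> 0 \<le> fst w \<and> 0 \<le> snd w"
  by (cases w) auto

lemma mem_open_quadrant: "w \<in> open_quadrant \<longleftrightarrow> 0 < fst w \<and> 0 < snd w"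
  by (cases w) auto

lemma closed_quadrant: "closed quadrant"
  by (intro closed_Times) auto

lemma open_open_quadrant: "open open_quadrant"
  by (intro open_Times) auto

lemma E_subset_quadrant: "z \<in> E \<Longrightarrow> z \<in> quadrant"
  by (simp add: E_def)

lemma D_eq:
  "exit_time W (quadrant_from (- y)) \<omega> = ereal r \<Longrightarrow> D W y \<omega> = W r \<omega> + y"
  by (simp add: D_def)

lemma D_eq_0: "exit_time W (quadrant_from (- y)) \<omega> = \<infinity> \<Longrightarrow> D W y \<omega> = 0"
  by (simp add: D_def)

lemma zero_in_E: "0 \<in> E"
  by (simp add: E_def mem_quadrant mem_open_quadrant)

lemma scale_quadrant: "a > 0 \<Longrightarrow> a *\<^sub>R w \<in> quadrant \<longleftrightarrow> w \<in> quadrant"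
  by (simp add: mem_quadrant zero_le_mult_iff)

lemma scale_open_quadrant: "a > 0 \<Longrightarrow> a *\<^sub>R w \<in> open_quadrant \<longleftrightarrow> w \<in> open_quadrant"
  by (simp add: mem_open_quadrant zero_less_mult_iff)

lemma scale_E: "a > 0 \<Longrightarrow> a *\<^sub>R w \<in> E \<longleftrightarrow> w \<in> E"
  unfolding E_def Diff_iff by (simp add: scale_quadrant scale_open_quadrant)

lemma add_quadrant: "v \<in> quadrant \<Longrightarrow> w \<in> quadrant \<Longrightarrow> v + w \<in> quadrant"
  by (simp add: mem_quadrant)

lemma tendsto_path:
  fixes w :: "real \<Rightarrow> 'a::topological_space"
  assumes "continuous_on {0..} w" "(f \<longlongrightarrow> s) F" "0 \<le> s" "\<forall>\<^sub>F n in F. 0 \<le> f n"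
  shows "((\<lambda>n. w (f n)) \<longlongrightarrow> w s) F"
  using continuous_on_tendsto_compose[OF assms(1,2)] assms(3,4) by simp

text \<open>
  Until the exit the path stays in the closed set \<open>quadrant\<close>, so the exit position lies there, too.
  It cannot lie in the open quadrant, because then the path would remain in \<open>S\<close> a little longer.
  The open quadrant for \<open>S\<close> gives the positions that define \<open>Q\<close>, the closed one those in \<open>D\<close>.
\<close>

lemma exit_position_in_E:
  assumes cont: "continuous_on {0..} (\<lambda>t. W t \<omega>)" and W0: "W 0 \<omega> \<in> quadrant"
    and S: "open_quadrant \<subseteq> S" "S \<subseteq> quadrant" and r: "exit_time W S \<omega> = ereal r"
  shows "W r \<omega> \<in> E"
proof -
  have r0: "0 \<le> r" using exit_time_nonneg[of W S \<omega>] r by simp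
  have "W r \<omega> \<in> quadrant"
  proof (cases "r = 0")
    case True then show ?thesis using W0 by simp
  next
    case False
    have lim: "((\<lambda>t. W t \<omega>) \<longlongrightarrow> W r \<omega>) (at_left r)"
      using r0 False
      by (intro tendsto_path[of "\<lambda>t. W t \<omega>" "\<lambda>t. t" r, OF cont])
         (auto intro!: eventually_at_leftI[of 0])
    have "\<forall>\<^sub>F t in at_left r. W t \<omega> \<in> quadrant"
    proof (rule eventually_at_leftI[of 0])
      fix t assume "t \<in> {0<..<r}"
      then show "W t \<omega> \<in> quadrant" using r by (intro subsetD[OF S(2)] inside_before_exit) auto
    qed (use r0 False in simp)
    then show ?thesis
      using Lim_in_closed_set[OF closed_quadrant _ _ lim] by simp
  qed
  moreover have "W r \<omega> \<notin> open_quadrant"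
  proof
    assume in_open: "W r \<omega> \<in> open_quadrant"
    have "((\<lambda>t. W t \<omega>) \<longlongrightarrow> W r \<omega>) (at r within {0..})"
      using cont r0 by (auto simp: continuous_on_def)
    from topological_tendstoD[OF this open_open_quadrant in_open]
    obtain e where e: "e > 0" "\<And>t. t \<ge> 0 \<Longrightarrow> t \<noteq> r \<Longrightarrow> dist t r < e \<Longrightarrow> W t \<omega> \<in> open_quadrant"
      unfolding eventually_at by (metis atLeast_iff)
    obtain t where t: "0 < t" "r \<le> t" "t < r + e" "W t \<omega> \<notin> S"
      using outside_after_exit[OF r e(1)] by blast
    have "W t \<omega> \<in> open_quadrant"
      using e(2)[of t] t in_open by (cases "t = r") (auto simp: dist_real_def)
    from t(4) subsetD[OF S(1) this] show False by (rule notE)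
  qed
  ultimately show ?thesis unfolding E_def by (rule DiffI)
qed

lemma quadrant_exit_in_E:
  assumes "continuous_on {0..} (\<lambda>t. W t \<omega>)" "W 0 \<omega> \<in> quadrant"
  shows "quadrant_exit W \<omega> \<in> E"
proof (cases rule: exit_time_real_cases[of W open_quadrant \<omega>])
  case inf then show ?thesis by (simp add: quadrant_exit_def zero_in_E)
next
  case (fin r)
  have sub: "open_quadrant \<subseteq> quadrant" by auto
  have "W r \<omega> \<in> E" by (rule exit_position_in_E[of W \<omega>, OF assms order_refl sub fin(1)])
  then show ?thesis using fin by (simp add: quadrant_exit_def)
qed

lemma D_in_E:
  assumes cont: "continuous_on {0..} (\<lambda>t. W t \<omega>)" and W0: "W 0 \<omega> = 0" and y: "y \<in> quadrant"
  shows "D W y \<omega> \<in> E"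
proof (cases rule: exit_time_real_cases[of W "quadrant_from (- y)" \<omega>])
  case inf then show ?thesis by (simp add: D_eq_0 zero_in_E)
next
  case (fin r)
  let ?V = "\<lambda>t \<omega>. W t \<omega> + y"
  have "exit_time ?V quadrant \<omega> = exit_time W (quadrant_from (- y)) \<omega>"
    by (rule exit_time_cong) (simp only: in_quadrant_from_iff)
  then have exit: "exit_time ?V quadrant \<omega> = ereal r" using fin(1) by (simp only:)
  have V0: "?V 0 \<omega> \<in> quadrant" using W0 y by simp
  have sub: "open_quadrant \<subseteq> quadrant" by auto
  have "?V r \<omega> \<in> E"
    by (rule exit_position_in_E[of ?V \<omega>, OF continuous_on_add[OF cont continuous_on_const] V0 sub order_refl exit])
  then show ?thesis by (simp only: D_eq[OF fin(1)])
qed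

lemma exit_time_mono:
  assumes "v \<in> quadrant"
  shows "exit_time W (quadrant_from (- y)) \<omega> \<le> exit_time W (quadrant_from (- (y + v))) \<omega>"
proof -
  have "W t \<omega> \<notin> quadrant_from (- (y + v)) \<Longrightarrow> W t \<omega> \<notin> quadrant_from (- y)" for t
    using add_quadrant[OF _ assms, of "W t \<omega> + y"] unfolding in_quadrant_from_iff add.assoc by metis
  then show ?thesis
    unfolding exit_time_def by (intro INF_superset_mono) auto
qed

text \<open>
  The path shifted by \<open>y\<close> is in the quadrant up to and including the time \<open>r\<close>, hence so is the path
  shifted by \<open>y + v\<close>. All exits of the latter therefore come after \<open>r\<close>, where it consists of the
  increments after \<open>r\<close> started at \<open>D W y + v\<close>.
\<close>

lemma D_after_exit:
  fixes W :: "real \<Rightarrow> 'w \<Rightarrow> real \<times> real"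
  assumes cont: "continuous_on {0..} (\<lambda>t. W t \<omega>)" and W0: "W 0 \<omega> = 0"
    and y: "y \<in> quadrant" and v: "v \<in> quadrant"
    and r: "exit_time W (quadrant_from (- y)) \<omega> = ereal r"
  shows "D W (y + v) \<omega> = D (\<lambda>t \<omega>. W (r + t) \<omega> - W r \<omega>) (D W y \<omega> + v) \<omega>"
proof -
  define V where "V = (\<lambda>t \<omega>. W (r + t) \<omega> - W r \<omega>)"
  have r0: "0 \<le> r" using exit_time_nonneg[of W "quadrant_from (- y)" \<omega>] r by simp
  have Dy: "D W y \<omega> = W r \<omega> + y" by (rule D_eq[OF r])
  have DE: "W r \<omega> + y \<in> quadrant" using D_in_E[of W \<omega> y, OF cont W0 y] Dy E_subset_quadrant by metis
  have inside: "W t \<omega> + y \<in> quadrant" if "0 < t" "t \<le> r" for t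
    using inside_before_exit[of t W "quadrant_from (-y)" \<omega>] that DE r
    by (cases "t = r") (auto simp: in_quadrant_from_iff)
  have eq: "V t \<omega> + (D W y \<omega> + v) = W (r + t) \<omega> + (y + v)" for t
    unfolding Dy V_def by simp
  have exits: "{t. 0 < t \<and> W t \<omega> \<notin> quadrant_from (- (y + v))} =
     (\<lambda>t. r + t) ` {t. 0 < t \<and> V t \<omega> \<notin> quadrant_from (- (D W y \<omega> + v))}" (is "?L = ?R")
  proof
    show "?L \<subseteq> ?R"
    proof
      fix t assume "t \<in> ?L"
      then have t: "0 < t" "W t \<omega> + (y + v) \<notin> quadrant" by (auto simp only: mem_Collect_eq in_quadrant_from_iff)
      have "\<not> t \<le> r"
      proof
        assume "t \<le> r"
        then have "W t \<omega> + y + v \<in> quadrant" by (intro add_quadrant inside t(1) v)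
        then show False using t(2) by (simp only: add.assoc)
      qed
      then show "t \<in> ?R" using t eq[of "t - r"]
        by (intro image_eqI[of _ _ "t - r"]) (auto simp only: mem_Collect_eq in_quadrant_from_iff, auto)
    qed
    show "?R \<subseteq> ?L"
    proof
      fix t assume "t \<in> ?R"
      then obtain s where s: "t = r + s" "0 < s" "V s \<omega> + (D W y \<omega> + v) \<notin> quadrant"
        unfolding in_quadrant_from_iff by (elim imageE) simp
      then show "t \<in> ?L" unfolding mem_Collect_eq in_quadrant_from_iff eq s(1) using r0 by simp
    qed
  qed
  have et: "exit_time W (quadrant_from (- (y + v))) \<omega> = ereal r + exit_time V (quadrant_from (- (D W y \<omega> + v))) \<omega>"
    (is "?l = ereal r + ?x")
  proof (rule antisym)
    have "exit_time W (quadrant_from (- (y + v))) \<omega> =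
       (INF t\<in>{t. 0 < t \<and> V t \<omega> \<notin> quadrant_from (- (D W y \<omega> + v))}. ereal r + ereal t)"
      unfolding exit_time_def exits by (simp add: image_image)
    moreover have "\<dots> \<ge> ereal r + ?x"
      unfolding exit_time_def by (intro INF_greatest add_left_mono INF_lower) auto
    ultimately show "?l \<ge> ereal r + ?x" by simp
    show "?l \<le> ereal r + ?x"
    proof (cases rule: exit_time_real_cases[of V "quadrant_from (- (D W y \<omega> + v))" \<omega>])
      case inf then show ?thesis by simp
    next
      case (fin s)
      show ?thesis
      proof (rule ereal_le_epsilon2)
        fix e :: real assume "e > 0"
        from outside_after_exit[OF fin(1) this]
        obtain t where t: "0 < t" "s \<le> t" "t < s + e" "V t \<omega> \<notin> quadrant_from (- (D W y \<omega> + v))" by blast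
        then have "r + t \<in> ?L" unfolding exits by blast
        then have "?l \<le> ereal (r + t)" by (intro exit_time_le) auto
        then show "?l \<le> ereal r + ?x + ereal e" unfolding fin(1) using t
          by (auto intro: order_trans)
      qed
    qed
  qed
  show ?thesis
  proof (cases rule: exit_time_real_cases[of V "quadrant_from (- (D W y \<omega> + v))" \<omega>])
    case inf then show ?thesis using et by (simp add: D_eq_0 flip: V_def)
  next
    case (fin s)
    then show ?thesis using et D_eq[OF fin(1)] D_eq[of W "y + v" \<omega> "r + s"] eq[of s]
      by (simp flip: V_def)
  qed
qed

text \<open>
  A path stopped at \<open>u\<close> shows every exit strictly before \<open>u\<close>. This is how the past of an exit time
  is expressed below. For exits at \<open>u\<close> it fails, as an exit time is an infimum that may be
  approached from the right only.
\<close>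

lemma stopped_exit_time:
  assumes "0 < u"
  shows "exit_time (\<lambda>t. W (min u t)) S \<omega> < ereal u \<longleftrightarrow> exit_time W S \<omega> < ereal u"
    and "exit_time W S \<omega> < ereal u \<Longrightarrow> exit_time (\<lambda>t. W (min u t)) S \<omega> = exit_time W S \<omega>"
proof -
  show *: "exit_time (\<lambda>t. W (min u t)) S \<omega> < ereal u \<longleftrightarrow> exit_time W S \<omega> < ereal u"
    unfolding exit_time_less_iff by (intro iff_exI) (auto simp: min_def)
  assume lt: "exit_time W S \<omega> < ereal u"
  show "exit_time (\<lambda>t. W (min u t)) S \<omega> = exit_time W S \<omega>"
  proof (rule antisym; rule ccontr; simp only: not_le)
    assume "exit_time W S \<omega> < exit_time (\<lambda>t. W (min u t)) S \<omega>"
    then obtain t where "0 < t" "ereal t < exit_time (\<lambda>t. W (min u t)) S \<omega>" "W t \<omega> \<notin> S" 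
      unfolding exit_time_less_iff by blast
    moreover from this have "ereal t < ereal u" using lt * by (meson order_less_trans)
    ultimately show False using exit_time_le[of t "\<lambda>t. W (min u t)" \<omega> S] by simp
  next
    assume a: "exit_time (\<lambda>t. W (min u t)) S \<omega> < exit_time W S \<omega>"
    then obtain t where t: "0 < t" "ereal t < exit_time W S \<omega>" "W (min u t) \<omega> \<notin> S" 
      unfolding exit_time_less_iff by blast
    moreover from this have "ereal t < ereal u" using lt by (meson order_less_trans)
    ultimately show False using exit_time_le[of t W \<omega> S] by simp
  qed
qed

lemma stopped_D:
  assumes "0 < u" "exit_time W (quadrant_from (- y)) \<omega> < ereal u"
  shows "D (\<lambda>t. W (min u t)) y \<omega> = D W y \<omega>"
  using stopped_exit_time(2)[OF assms] assms(2)
  by (cases rule: exit_time_real_cases[of W "quadrant_from (- y)" \<omega>]) (auto simp: D_def)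

lemma exit_time_scale_le:
  assumes "0 < k" "\<And>t. 0 < t \<Longrightarrow> V t \<eta> \<in> T \<longleftrightarrow> W (t / k) \<omega> \<in> S"
  shows "ereal k * exit_time W S \<omega> \<le> exit_time V T \<eta>"
  unfolding exit_time_def[of V]
proof (rule INF_greatest)
  fix t assume "t \<in> {t. 0 < t \<and> V t \<eta> \<notin> T}"
  then have "exit_time W S \<omega> \<le> ereal (t / k)" using assms by (intro exit_time_le) auto
  then have "ereal k * exit_time W S \<omega> \<le> ereal k * ereal (t / k)"
    using assms(1) by (intro ereal_mult_left_mono) auto
  then show "ereal k * exit_time W S \<omega> \<le> ereal t" using assms(1) by simp
qed

lemma exit_time_scale:
  assumes "0 < k" "\<And>t. 0 < t \<Longrightarrow> V t \<eta> \<in> T \<longleftrightarrow> W (t / k) \<omega> \<in> S"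
  shows "exit_time V T \<eta> = ereal k * exit_time W S \<omega>"
proof (rule antisym)
  have "ereal (1 / k) * exit_time V T \<eta> \<le> exit_time W S \<omega>"
    using assms by (intro exit_time_scale_le) (auto simp: mult.commute)
  then have "ereal k * (ereal (1 / k) * exit_time V T \<eta>) \<le> ereal k * exit_time W S \<omega>"
    using assms(1) by (intro ereal_mult_left_mono) auto
  then show "exit_time V T \<eta> \<le> ereal k * exit_time W S \<omega>"
    using assms(1) by (simp flip: mult.assoc add: one_ereal_def[symmetric])
qed (use assms in \<open>rule exit_time_scale_le\<close>)

lemma D_scale:
  assumes a: "0 < a"
  shows "D (\<lambda>t \<omega>. a *\<^sub>R W (t / a\<^sup>2) \<omega>) (a *\<^sub>R y) \<omega> = a *\<^sub>R D W y \<omega>"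
proof -
  have *: "exit_time (\<lambda>t \<omega>. a *\<^sub>R W (t / a\<^sup>2) \<omega>) (quadrant_from (- (a *\<^sub>R y))) \<omega>
     = ereal (a\<^sup>2) * exit_time W (quadrant_from (- y)) \<omega>"
    using a by (intro exit_time_scale) 
     (auto simp only: in_quadrant_from_iff scaleR_add_right[symmetric] scale_quadrant, auto)
  show ?thesis
    using a * by (cases rule: exit_time_real_cases[of W "quadrant_from (- y)" \<omega>])
      (auto simp: D_def scaleR_add_right)
qed

section \<open>Paths at rational times\<close>

text \<open>
  Negative rationals are sent to time \<open>0\<close>, so that the whole countable type \<open>rat\<close> serves as the
  index set and \<open>rat \<Rightarrow> real \<times> real\<close> as the path space.
\<close>

definition rat_path :: "(real \<Rightarrow> 'w \<Rightarrow> real \<times> real) \<Rightarrow> 'w \<Rightarrow> rat \<Rightarrow> real \<times> real" where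
  "rat_path W \<omega> q = W (max 0 (of_rat q)) \<omega>"

text \<open>
  The first multiple of \<open>1 / 2 ^ n\<close> strictly after \<open>s\<close>. As the inequality is strict, the event
  that this approximation of a random time equals \<open>r\<close> depends on events of the form \<open>s < u\<close> with
  \<open>u \<le> r\<close>.
\<close>

definition dyadic_after :: "nat \<Rightarrow> real \<Rightarrow> rat" where
  "dyadic_after n s = of_nat (nat \<lfloor>2 ^ n * s\<rfloor> + 1) / 2 ^ n"

lemma of_rat_dyadic_after:
  "real_of_rat (dyadic_after n s) = real (nat \<lfloor>2 ^ n * s\<rfloor> + 1) / 2 ^ n"
  unfolding dyadic_after_def of_rat_divide of_rat_power of_rat_of_nat_eq by simp

lemma dyadic_after_bounds:
  assumes "0 \<le> s"
  shows "s < real_of_rat (dyadic_after n s)" "real_of_rat (dyadic_after n s) \<le> s + 1 / 2 ^ n"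
proof -
  have "0 \<le> \<lfloor>2 ^ n * s\<rfloor>" using assms by simp
  then have *: "real (nat \<lfloor>2 ^ n * s\<rfloor> + 1) = of_int \<lfloor>2 ^ n * s\<rfloor> + 1" by simp
  have "2 ^ n * s < of_int \<lfloor>2 ^ n * s\<rfloor> + 1" "of_int \<lfloor>2 ^ n * s\<rfloor> \<le> 2 ^ n * s" by linarith+
  then show "s < real_of_rat (dyadic_after n s)" "real_of_rat (dyadic_after n s) \<le> s + 1 / 2 ^ n"
    unfolding of_rat_dyadic_after * by (simp_all add: field_simps)
qed

lemma dyadic_after_tendsto:
  assumes "0 \<le> s"
  shows "(\<lambda>n. real_of_rat (dyadic_after n s)) \<longlonglongrightarrow> s"
proof (rule tendsto_sandwich[of "\<lambda>_. s" _ _ "\<lambda>n. s + 1 / 2 ^ n"])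
  have "(\<lambda>n. s + 1 / 2 ^ n) \<longlonglongrightarrow> s + 0"
    by (intro tendsto_add tendsto_const) (use LIMSEQ_inverse_realpow_zero[of 2] in \<open>simp add: inverse_eq_divide\<close>)
  then show "(\<lambda>n. s + 1 / 2 ^ n) \<longlonglongrightarrow> s" by simp
qed (use dyadic_after_bounds[OF assms] in \<open>auto intro!: always_eventually less_imp_le\<close>)

definition value_at :: "(rat \<Rightarrow> real \<times> real) \<Rightarrow> real \<Rightarrow> real \<times> real" where
  "value_at p s = lim (\<lambda>n. p (dyadic_after n s))"

lemma path_dyadic_after_tendsto:
  fixes W :: "real \<Rightarrow> 'w \<Rightarrow> real \<times> real"
  assumes "continuous_on {0..} (\<lambda>t. W t \<omega>)" "0 \<le> s"
  shows "(\<lambda>n. rat_path W \<omega> (dyadic_after n s)) \<longlonglongrightarrow> W s \<omega>"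
proof -
  have "max 0 (real_of_rat (dyadic_after n s)) = real_of_rat (dyadic_after n s)" for n
    using dyadic_after_bounds(1)[OF assms(2), of n] assms(2) by linarith
  then show ?thesis
    unfolding rat_path_def
    using tendsto_path[of "\<lambda>t. W t \<omega>", OF assms(1) dyadic_after_tendsto[OF assms(2)] assms(2)]
    by (simp add: of_rat_dyadic_after)
qed

lemma value_at_path:
  assumes "continuous_on {0..} (\<lambda>t. W t \<omega>)" "0 \<le> s"
  shows "value_at (rat_path W \<omega>) s = W s \<omega>"
  unfolding value_at_def by (rule limI) (rule path_dyadic_after_tendsto[of W \<omega>, OF assms])

lemma measurable_value_at [measurable (raw)]:
  assumes [measurable]: "p \<in> borel_measurable N" "s \<in> borel_measurable N"
  shows "(\<lambda>x. value_at (p x) (s x)) \<in> borel_measurable N"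
proof -
  have [measurable]: "(\<lambda>x. p x (dyadic_after n (s x))) \<in> borel_measurable N" for n
    unfolding dyadic_after_def
    by (rule measurable_compose_countable[where g="\<lambda>x. nat \<lfloor>2 ^ n * s x\<rfloor>"
          and f="\<lambda>k x. p x (of_nat (k + 1) / 2 ^ n)"]) (measurable, rule measurable_product_then_coordinatewise, measurable)
  show ?thesis unfolding value_at_def by measurable
qed

definition rat_exit :: "real \<times> real \<Rightarrow> (rat \<Rightarrow> real \<times> real) \<Rightarrow> ereal" where
  "rat_exit y p = (INF q\<in>{0<..}. if p q + y \<in> quadrant then \<infinity> else ereal (of_rat q))"

text \<open>
  The position \<open>D\<close> as a function on the whole path space. Being defined through countably many
  coordinates, it is jointly measurable in the level and the path.
\<close>

definition D_of_path :: "real \<times> real \<Rightarrow> (rat \<Rightarrow> real \<times> real) \<Rightarrow> real \<times> real" where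
  "D_of_path y p =
    (if rat_exit y p = \<infinity> then 0 else value_at p (real_of_ereal (rat_exit y p)) + y)"

lemma measurable_rat_exit [measurable (raw)]:
  assumes [measurable]: "y \<in> borel_measurable N" "p \<in> borel_measurable N"
  shows "(\<lambda>x. rat_exit (y x) (p x)) \<in> borel_measurable N"
proof -
  have [measurable]: "(\<lambda>x. p x q) \<in> borel_measurable N" for q
    by (rule measurable_product_then_coordinatewise) measurable
  have [measurable]: "quadrant \<in> sets borel" using closed_quadrant by simp
  show ?thesis unfolding rat_exit_def by measurable
qed

lemma measurable_D_of_path [measurable (raw)]:
  assumes [measurable]: "y \<in> borel_measurable N" "p \<in> borel_measurable N"
  shows "(\<lambda>x. D_of_path (y x) (p x)) \<in> borel_measurable N"
  unfolding D_of_path_def by measurable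

text \<open>
  The complement of the closed quadrant is open, so a continuous path that is outside at some time
  is outside at rational times just after it.
\<close>

lemma exit_time_eq_rat_exit:
  assumes cont: "continuous_on {0..} (\<lambda>t. W t \<omega>)"
  shows "exit_time W (quadrant_from (- y)) \<omega> = rat_exit y (rat_path W \<omega>)" (is "?L = ?R")
proof (rule antisym)
  show "?L \<le> ?R"
    unfolding rat_exit_def
    by (intro INF_greatest)
       (auto simp: rat_path_def in_quadrant_from_iff max_def zero_less_of_rat_iff less_imp_le intro!: exit_time_le split: if_splits)
  show "?R \<le> ?L"
    unfolding exit_time_def
  proof (rule INF_greatest)
    fix t assume "t \<in> {t. 0 < t \<and> W t \<omega> \<notin> quadrant_from (- y)}"
    then have t: "0 < t" "W t \<omega> + y \<in> - quadrant" by (simp_all add: in_quadrant_from_iff)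
    show "?R \<le> ereal t"
    proof (rule tendsto_lowerbound)
      show "((\<lambda>n. ereal (of_rat (dyadic_after n t))) \<longlongrightarrow> ereal t) sequentially"
        using dyadic_after_tendsto[of t] t by simp
      have "((\<lambda>n. rat_path W \<omega> (dyadic_after n t) + y) \<longlongrightarrow> W t \<omega> + y) sequentially"
        using t by (intro tendsto_add tendsto_const path_dyadic_after_tendsto[of W \<omega>, OF cont]) simp
      from topological_tendstoD[OF this _ t(2)]
      have "\<forall>\<^sub>F n in sequentially. rat_path W \<omega> (dyadic_after n t) + y \<notin> quadrant"
        unfolding Compl_iff using closed_quadrant[unfolded closed_def] by blast
      then show "\<forall>\<^sub>F n in sequentially. ?R \<le> ereal (of_rat (dyadic_after n t))"
      proof eventually_elim
        case (elim n)
        have "0 < dyadic_after n t"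
          using dyadic_after_bounds(1)[of t n] t(1) zero_less_of_rat_iff[where 'a=real] by (metis less_imp_le less_trans)
        then show ?case unfolding rat_exit_def
          by (intro INF_lower2[of "dyadic_after n t"]) (use elim in auto)
      qed
    qed simp
  qed
qed

lemma D_eq_D_of_path:
  assumes "continuous_on {0..} (\<lambda>t. W t \<omega>)"
  shows "D W y \<omega> = D_of_path y (rat_path W \<omega>)"
  using exit_time_eq_rat_exit[of W \<omega> y, OF assms] exit_time_nonneg[of W "quadrant_from (-y)" \<omega>]
  by (auto simp: D_def D_of_path_def value_at_path[of W \<omega>, OF assms] real_of_ereal_pos)

lemma measurable_path:
  assumes "\<And>t. 0 \<le> t \<Longrightarrow> W t \<in> borel_measurable N"
  shows "rat_path W \<in> borel_measurable N"
  unfolding rat_path_def[abs_def] by (intro measurable_coordinatewise_then_product assms) simp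

lemma measurable_at_random_time:
  fixes W :: "real \<Rightarrow> 'w \<Rightarrow> real \<times> real"
  assumes "\<And>t. 0 \<le> t \<Longrightarrow> W t \<in> borel_measurable N"
    and "\<And>\<omega>. \<omega> \<in> space N \<Longrightarrow> continuous_on {0..} (\<lambda>t. W t \<omega>)"
    and [measurable]: "s \<in> borel_measurable N" and "\<And>\<omega>. \<omega> \<in> space N \<Longrightarrow> 0 \<le> s \<omega>"
  shows "(\<lambda>\<omega>. W (s \<omega>) \<omega>) \<in> borel_measurable N"
proof -
  note measurable_path[of W, OF assms(1), measurable]
  have "(\<lambda>\<omega>. value_at (rat_path W \<omega>) (s \<omega>)) \<in> borel_measurable N" by measurable
  then show ?thesis
    by (rule measurable_cong[THEN iffD1, rotated]) (use assms(2,4) value_at_path[of W] in auto)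
qed

definition depth :: "real \<times> real \<Rightarrow> real" where
  "depth z = min (fst z) (snd z)"

lemma continuous_depth: "continuous_on UNIV depth"
  unfolding depth_def[abs_def] by (intro continuous_intros)

text \<open>
  The complement of the open quadrant is closed, and rational times may miss a visit to it. On a
  compact time interval, however, a continuous function that takes values below every \<open>1 / (k + 1)\<close>
  has a minimum that is at most \<open>0\<close>.
\<close>

lemma open_exit_time_less_iff:
  assumes cont: "continuous_on {0..} (\<lambda>t. W t \<omega>)"
  shows "exit_time W open_quadrant \<omega> < c \<longleftrightarrow>
    (\<exists>a b :: rat. 0 < a \<and> ereal (of_rat b) < c \<and>
      (\<forall>k::nat. \<exists>q\<in>{a..b}. depth (rat_path W \<omega> q) < 1 / Suc k))" (is "_ \<longleftrightarrow> ?rat")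
proof
  define m where "m t = depth (W t \<omega>)" for t
  have mcont: "continuous_on {0..} m"
    unfolding m_def by (rule continuous_on_compose2[OF continuous_depth cont]) simp
  have in_iff: "W t \<omega> \<in> open_quadrant \<longleftrightarrow> 0 < m t" for t by (simp add: m_def depth_def mem_open_quadrant)
  { assume "exit_time W open_quadrant \<omega> < c"
    then obtain t where t: "0 < t" "ereal t < c" "m t \<le> 0" unfolding exit_time_less_iff in_iff not_less by blast
    obtain a :: rat where a: "0 < real_of_rat a" "real_of_rat a < t" using of_rat_dense[OF t(1)] by auto
    obtain d where d: "ereal t < d" "d < c" using t(2) dense by blast
    obtain b0 where b0: "t < b0" "ereal b0 < c" using d by (cases d) auto
    obtain b :: rat where b: "t < real_of_rat b" "real_of_rat b < b0" using of_rat_dense[OF b0(1)] by auto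
    have bc: "ereal (of_rat b) < c" using b(2) b0(2) less_trans by (metis less_ereal.simps(1))
    have "\<exists>q\<in>{a..b}. depth (rat_path W \<omega> q) < 1 / Suc k" for k :: nat
    proof -
      have "(m \<longlongrightarrow> m t) (at t within {0..})" using mcont t(1) by (auto simp: continuous_on_def)
      moreover have "m t < 1 / Suc k" using t(3) by (simp add: order_le_less_trans)
      ultimately have "\<forall>\<^sub>F x in at t within {0..}. m x < 1 / Suc k" by (rule order_tendstoD(2))
      then obtain e where e: "e > 0" "\<And>x. x \<ge> 0 \<Longrightarrow> x \<noteq> t \<Longrightarrow> dist x t < e \<Longrightarrow> m x < 1 / Suc k"
        unfolding eventually_at by (metis atLeast_iff)
      have "t < min (real_of_rat b) (t + e)" using b e by simp
      then obtain q :: rat where q: "t < real_of_rat q" "real_of_rat q < min (real_of_rat b) (t + e)"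
        using of_rat_dense by blast
      have "0 \<le> q" using q(1) t(1) zero_le_of_rat_iff[of q, where 'a=real] by linarith
      then have "m (real_of_rat q) < 1 / Suc k" using q by (intro e(2)) (auto simp: dist_real_def)
      moreover have "q \<in> {a..b}" using q a(2) of_rat_less[of a q, where 'a=real] of_rat_less[of q b, where 'a=real] by simp
      moreover have "max 0 (real_of_rat q) = real_of_rat q" using q t(1) by simp
      ultimately show ?thesis unfolding m_def rat_path_def by (intro bexI[of _ q]) auto
    qed
    then show ?rat
      using a(1) bc by auto }
  { assume ?rat
    then obtain a b :: rat where ab: "0 < a" "ereal (of_rat b) < c"
      and q: "\<And>k::nat. \<exists>q\<in>{a..b}. depth (rat_path W \<omega> q) < 1 / Suc k" by blast
    have q': "\<exists>t\<in>{real_of_rat a..real_of_rat b}. m t < 1 / Suc k" for k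
    proof -
      obtain q where "q \<in> {a..b}" "depth (rat_path W \<omega> q) < 1 / Suc k" using q by blast
      moreover from this have "max 0 (real_of_rat q) = real_of_rat q" using ab(1) by (simp add: max_def)
      ultimately show ?thesis by (intro bexI[of _ "real_of_rat q"]) (auto simp: m_def rat_path_def of_rat_less_eq)
    qed
    have "{real_of_rat a..real_of_rat b} \<noteq> {}" using q'[of 0] by auto
    moreover have "continuous_on {real_of_rat a..real_of_rat b} m"
      by (rule continuous_on_subset[OF mcont]) (use ab(1) in \<open>auto intro: order_trans[of 0 "real_of_rat a"]\<close>)
    ultimately obtain t where t: "t \<in> {real_of_rat a..real_of_rat b}" "\<And>s. s \<in> {real_of_rat a..real_of_rat b} \<Longrightarrow> m t \<le> m s"
      using continuous_attains_inf[of "{real_of_rat a..real_of_rat b}" m] by auto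
    have "m t < 1 / Suc k" for k using q'[of k] t(2) by (meson order_le_less_trans)
    then have "m t \<le> 0" using nat_approx_posE by (metis not_less order_less_asym)
    moreover have "0 < t" using ab(1) t(1) by (auto intro: less_le_trans[of 0 "real_of_rat a"])
    moreover have "ereal t < c" using ab(2) t(1) by (auto intro: le_less_trans[of "ereal t" "ereal (of_rat b)"])
    ultimately show "exit_time W open_quadrant \<omega> < c"
      unfolding exit_time_less_iff in_iff not_less by blast }
qed

lemma measurable_quadrant_exit:
  assumes W: "\<And>t. 0 \<le> t \<Longrightarrow> W t \<in> borel_measurable N"
    and cont: "\<And>\<omega>. \<omega> \<in> space N \<Longrightarrow> continuous_on {0..} (\<lambda>t. W t \<omega>)"
  shows "quadrant_exit W \<in> borel_measurable N"
proof -
  note measurable_path[of W, OF W, measurable]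
  have [measurable]: "(\<lambda>\<omega>. rat_path W \<omega> q) \<in> borel_measurable N" for q
    by (rule measurable_product_then_coordinatewise) measurable
  have [measurable]: "exit_time W open_quadrant \<in> borel_measurable N"
  proof (rule borel_measurableI_less)
    fix c :: ereal
    define below where "below q k = {\<omega> \<in> space N. depth (rat_path W \<omega> q) < 1 / Suc k}"
      for q and k :: nat
    have "depth \<in> borel_measurable borel"
      by (rule borel_measurable_continuous_onI[OF continuous_depth])
    from measurable_compose[OF _ this, of "\<lambda>\<omega>. rat_path W \<omega> _" N]
    have "(\<lambda>\<omega>. depth (rat_path W \<omega> q)) \<in> borel_measurable N" for q
      by measurable
    then have [measurable]: "below q k \<in> sets N" for q k
      unfolding below_def by (rule borel_measurable_less) simp
    have "{\<omega> \<in> space N. exit_time W open_quadrant \<omega> < c} =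
       (\<Union>a\<in>{0<..}. \<Union>b\<in>{b. ereal (of_rat b) < c}. \<Inter>k. \<Union>q\<in>{a..b}. below q k)" (is "?L = ?R")
    proof (rule set_eqI)
      fix \<omega>
      show "\<omega> \<in> ?L \<longleftrightarrow> \<omega> \<in> ?R"
      proof (cases "\<omega> \<in> space N")
        case True
        then show ?thesis
          by (simp only: mem_Collect_eq open_exit_time_less_iff[of W \<omega>, OF cont[OF True]]
                below_def UN_iff INT_iff Bex_def greaterThan_iff) blast
      qed (simp add: below_def)
    qed
    also have "\<dots> \<in> sets N"
      by (intro sets.countable_UN' sets.countable_INT') (auto simp: image_subset_iff)
    finally show "{\<omega> \<in> space N. exit_time W open_quadrant \<omega> < c} \<in> sets N" .
  qed
  have [measurable]: "(\<lambda>\<omega>. W (real_of_ereal (exit_time W open_quadrant \<omega>)) \<omega>) \<in> borel_measurable N"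
    by (rule measurable_at_random_time[of W]) (auto intro: W cont real_of_ereal_pos exit_time_nonneg)
  show ?thesis unfolding quadrant_exit_def[abs_def] by measurable
qed

section \<open>The law of a Brownian path and the Markov property at fixed times\<close>

text \<open>
  The first \<open>n\<close> increments on the grid of width \<open>1 / N\<close> started at \<open>u\<close>. Uniform grids suffice, as
  finitely many rationals have a common denominator.
\<close>

definition increments :: "(real \<Rightarrow> 'w \<Rightarrow> real \<times> real) \<Rightarrow> real \<Rightarrow> nat \<Rightarrow> nat \<Rightarrow> 'w \<Rightarrow> nat \<Rightarrow> real \<times> real" where
  "increments W u N n \<omega> = (\<lambda>i\<in>{..<n}. W (u + real (Suc i) / real N) \<omega> - W (u + real i / real N) \<omega>)"

abbreviation gauss :: "real \<Rightarrow> (real \<times> real) measure" where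
  "gauss v \<equiv> density lborel (\<lambda>y. ennreal (normal_density 0 (sqrt v) (fst y) * normal_density 0 (sqrt v) (snd y)))"

context planar_brownian begin

lemma indep_grid_increments:
  assumes "0 \<le> u"
  shows "indep_vars (\<lambda>_. borel) (\<lambda>i \<omega>. W (u + real (Suc i) / real N) \<omega> - W (u + real i / real N) \<omega>) {..<n}"
  using independent_increments[of "\<lambda>i. u + real i / real N" n] assms
  by (simp add: mono_on_def divide_right_mono)

lemma measurable_increment:
  "0 \<le> s \<Longrightarrow> 0 \<le> t \<Longrightarrow> (\<lambda>\<omega>. W t \<omega> - W s \<omega>) \<in> borel_measurable M"
  by (intro borel_measurable_diff random_variable)

lemma distr_increment:
  assumes "0 \<le> s" "s < t"
  shows "distr M borel (\<lambda>\<omega>. W t \<omega> - W s \<omega>) = gauss (t - s)"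
  using gaussian_increments[OF assms] distr_cong[OF refl sets_lborel[symmetric] refl, of M "\<lambda>\<omega>. W t \<omega> - W s \<omega>"]
  unfolding distributed_def by simp

lemma distr_increments:
  assumes "0 \<le> u" "0 < N" "0 < n"
  shows "distr M (PiM {..<n} (\<lambda>_. borel)) (increments W u N n) = PiM {..<n} (\<lambda>_. gauss (1 / real N))"
proof -
  have "distr M (PiM {..<n} (\<lambda>_. borel)) (increments W u N n) =
    (\<Pi>\<^sub>M i\<in>{..<n}. distr M borel (\<lambda>\<omega>. W (u + real (Suc i) / real N) \<omega> - W (u + real i / real N) \<omega>))"
    unfolding increments_def
    using assms indep_grid_increments[OF assms(1), of N n]
    by (subst indep_vars_iff_distr_eq_PiM'[symmetric]) (auto intro!: measurable_increment)
  also have "\<dots> = PiM {..<n} (\<lambda>_. gauss (1 / real N))"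
  proof (rule PiM_cong[OF refl])
    fix i assume "i \<in> {..<n}"
    have "distr M borel (\<lambda>\<omega>. W (u + real (Suc i) / real N) \<omega> - W (u + real i / real N) \<omega>)
      = gauss ((u + real (Suc i) / real N) - (u + real i / real N))"
      using assms by (intro distr_increment) (auto simp: divide_strict_right_mono)
    also have "(u + real (Suc i) / real N) - (u + real i / real N) = 1 / real N"
      by (simp add: add_divide_distrib)
    finally show "distr M borel (\<lambda>\<omega>. W (u + real (Suc i) / real N) \<omega> - W (u + real i / real N) \<omega>) = gauss (1 / real N)" .
  qed
  finally show ?thesis .
qed

lemma sum_increments:
  assumes "k \<le> n" "j \<le> k"
  shows "(\<Sum>i\<in>{j..<k}. increments W u N n \<omega> i) = W (u + real k / real N) \<omega> - W (u + real j / real N) \<omega>"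
proof -
  have "(\<Sum>i\<in>{j..<k}. increments W u N n \<omega> i) =
    (\<Sum>i\<in>{j..<k}. W (u + real (Suc i) / real N) \<omega> - W (u + real i / real N) \<omega>)"
    using assms by (intro sum.cong) (auto simp: increments_def)
  also have "\<dots> = W (u + real k / real N) \<omega> - W (u + real j / real N) \<omega>"
    using sum_Suc_diff'[OF assms(2), of "\<lambda>i. W (u + real i / real N) \<omega>"] by simp
  finally show ?thesis .
qed

end

lemma common_denominator:
  assumes "finite (J :: rat set)"
  obtains N :: nat where "0 < N" "\<And>q. q \<in> J \<Longrightarrow> \<exists>k::nat. max 0 (real_of_rat q) = real k / real N"
proof -
  have "\<exists>N::nat. 0 < N \<and> (\<forall>q\<in>J. \<exists>k::nat. max 0 (real_of_rat q) = real k / real N)"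
    using assms
  proof induction
    case (insert q J)
    then obtain N :: nat where N: "0 < N" "\<And>q. q \<in> J \<Longrightarrow> \<exists>k::nat. max 0 (real_of_rat q) = real k / real N" by blast
    obtain a b where q: "q = Fract a b" "b > 0" by (cases q) auto
    have "max 0 (real_of_rat q) = real (nat a) / real (nat b)"
      using q by (cases "0 \<le> a") (auto simp: of_rat_rat max_def zero_le_divide_iff divide_less_0_iff)
    then have "max 0 (real_of_rat q) = real (nat a * N) / real (nat b * N)"
      using N(1) by simp
    moreover have "\<exists>k::nat. max 0 (real_of_rat r) = real k / real (nat b * N)" if "r \<in> J" for r
    proof -
      obtain k :: nat where "max 0 (real_of_rat r) = real k / real N" using N(2)[OF \<open>r \<in> J\<close>] by blast
      then have "max 0 (real_of_rat r) = real (nat b * k) / real (nat b * N)" using q(2) by simp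
      then show ?thesis by blast
    qed
    ultimately have "\<forall>r\<in>insert q J. \<exists>k::nat. max 0 (real_of_rat r) = real k / real (nat b * N)"
      by blast
    moreover have "0 < nat b * N" using q(2) N(1) by simp
    ultimately show ?case by blast
  qed (auto intro: exI[of _ 1])
  then show thesis using that by blast
qed

definition future :: "(real \<Rightarrow> 'w \<Rightarrow> real \<times> real) \<Rightarrow> real \<Rightarrow> real \<Rightarrow> 'w \<Rightarrow> real \<times> real" where
  "future W u t \<omega> = W (u + t) \<omega> - W u \<omega>"

context planar_brownian begin

lemma measurable_future_path:
  "0 \<le> u \<Longrightarrow> rat_path (future W u) \<in> borel_measurable M"
  by (rule measurable_path) (auto simp: future_def[abs_def] intro!: measurable_increment)

lemma measurable_stopped_path:
  "0 \<le> u \<Longrightarrow> rat_path (\<lambda>t. W (min u t)) \<in> borel_measurable M"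
  by (rule measurable_path) (auto intro!: random_variable)

end

text \<open>
  On a grid that contains the finitely many times of a cylinder set, the path is a sum of
  independent increments whose law depends on the width of the grid only. Hence the law of the
  future is the same for all Brownian motions and all times.
\<close>

lemma distr_future_path_unique:
  assumes "planar_brownian M W x" "planar_brownian M' W' x'" and u: "0 \<le> u" "0 \<le> u'"
  shows "distr M borel (rat_path (future W u)) = distr M' borel (rat_path (future W' u'))"
proof (rule measure_eqI_PiM_infinite)
  interpret B: planar_brownian M W x by fact
  interpret B': planar_brownian M' W' x' by fact
  note B.measurable_future_path[OF u(1), measurable] B'.measurable_future_path[OF u(2), measurable]
  show "finite_measure (distr M borel (rat_path (future W u)))"
    by (rule B.finite_measure_distr) measurable
  fix A :: "rat \<Rightarrow> (real \<times> real) set" and J :: "rat set"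
  assume J: "finite J" "J \<subseteq> UNIV" and A: "\<And>i. i \<in> J \<Longrightarrow> A i \<in> sets borel"
  obtain N :: nat where N: "0 < N" "\<And>q. q \<in> J \<Longrightarrow> \<exists>k::nat. max 0 (real_of_rat q) = real k / real N"
    using common_denominator[OF J(1)] by blast
  obtain k :: "rat \<Rightarrow> nat" where k: "\<And>q. q \<in> J \<Longrightarrow> max 0 (real_of_rat q) = real (k q) / real N"
    using N(2) by metis
  define n where "n = Suc (Max (k ` J))"
  have kn: "k q \<le> n" if "q \<in> J" for q
    unfolding n_def using J(1) that by (intro le_SucI Max_ge) auto
  define cyl where "cyl = {d\<in>space (PiM {..<n} (\<lambda>_. borel :: (real \<times> real) measure)). \<forall>q\<in>J. (\<Sum>i<k q. d i) \<in> A q}"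
  have cyl: "cyl \<in> sets (PiM {..<n} (\<lambda>_. borel))"
  proof -
    have [measurable]: "(\<lambda>d. \<Sum>i<k q. d i) \<in> borel_measurable (PiM {..<n} (\<lambda>_. borel :: (real \<times> real) measure))" if "q \<in> J" for q
      using kn[OF that] by (intro borel_measurable_sum measurable_component_singleton) auto
    show ?thesis unfolding cyl_def using J(1) A by measurable
  qed
  have emb: "prod_emb UNIV (\<lambda>_. borel) J (Pi\<^sub>E J A) = {p. \<forall>q\<in>J. p q \<in> A q}"
    by (auto simp: prod_emb_iff PiE_iff)
  have emb_sets: "{p. \<forall>q\<in>J. p q \<in> A q} \<in> sets borel"
    using sets_PiM_I[of J UNIV A "\<lambda>_. borel"] J A sets_PiM_equal_borel[where 'a=rat and 'b="real \<times> real"] unfolding emb by auto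
  have key: "emeasure (distr M borel (rat_path (future W u))) {p. \<forall>q\<in>J. p q \<in> A q} =
      emeasure (PiM {..<n} (\<lambda>_. gauss (1 / real N))) cyl"
    if "planar_brownian M W x" "0 \<le> u" for M :: "'z measure" and W u x
  proof -
    interpret planar_brownian M W x by fact
    note measurable_future_path[OF \<open>0 \<le> u\<close>, measurable]
    have "n > 0" by (simp add: n_def)
    have inc[measurable]: "increments W u N n \<in> M \<rightarrow>\<^sub>M PiM {..<n} (\<lambda>_. borel)"
      unfolding increments_def using \<open>0 \<le> u\<close> by (intro measurable_restrict measurable_increment) auto
    have coord: "rat_path (future W u) \<omega> q = (\<Sum>i<k q. increments W u N n \<omega> i)" if "q \<in> J" for q \<omega>
      using sum_increments[of "k q" n 0 u N \<omega>] kn[OF that] k[OF that]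
      by (simp add: rat_path_def future_def lessThan_atLeast0)
    have "emeasure (distr M borel (rat_path (future W u))) {p. \<forall>q\<in>J. p q \<in> A q} =
      emeasure M (rat_path (future W u) -` {p. \<forall>q\<in>J. p q \<in> A q} \<inter> space M)"
      using emb_sets by (rule emeasure_distr[rotated]) measurable
    also have "rat_path (future W u) -` {p. \<forall>q\<in>J. p q \<in> A q} \<inter> space M = increments W u N n -` cyl \<inter> space M"
      using measurable_space[OF inc] by (auto simp: cyl_def coord)
    also have "emeasure M \<dots> = emeasure (distr M (PiM {..<n} (\<lambda>_. borel)) (increments W u N n)) cyl"
      using cyl by (rule emeasure_distr[symmetric, rotated]) measurable
    finally show ?thesis unfolding distr_increments[OF \<open>0 \<le> u\<close> N(1) \<open>n > 0\<close>] .
  qed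
  show "emeasure (distr M borel (rat_path (future W u))) (prod_emb UNIV (\<lambda>_. borel) J (Pi\<^sub>E J A))
      = emeasure (distr M' borel (rat_path (future W' u'))) (prod_emb UNIV (\<lambda>_. borel) J (Pi\<^sub>E J A))"
    unfolding emb key[OF assms(1) u(1)] key[OF assms(2) u(2)] ..
qed (simp_all add: sets_PiM_equal_borel)

text \<open>
  Cylinder sets generate the Borel sets of the path space and are closed under intersection. Two
  cylinder sets may be given by the same finite set of times, one with trivial conditions at the
  times of the other.
\<close>

lemma (in prob_space) indep_var_pathI:
  fixes X Y :: "'a \<Rightarrow> rat \<Rightarrow> real \<times> real"
  assumes X[measurable]: "X \<in> borel_measurable M" and Y[measurable]: "Y \<in> borel_measurable M"
    and cyl: "\<And>J A B. finite J \<Longrightarrow> (\<And>i. i \<in> J \<Longrightarrow> A i \<in> sets borel) \<Longrightarrow> (\<And>i. i \<in> J \<Longrightarrow> B i \<in> sets borel) \<Longrightarrow>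
      prob ({\<omega> \<in> space M. \<forall>q\<in>J. X \<omega> q \<in> A q} \<inter> {\<omega> \<in> space M. \<forall>q\<in>J. Y \<omega> q \<in> B q}) =
      prob {\<omega> \<in> space M. \<forall>q\<in>J. X \<omega> q \<in> A q} * prob {\<omega> \<in> space M. \<forall>q\<in>J. Y \<omega> q \<in> B q}"
  shows "indep_var borel X borel Y"
proof -
  let ?G = "prod_algebra (UNIV :: rat set) (\<lambda>_. borel :: (real \<times> real) measure)"
  have gen: "sigma_sets (space M) {Z -` A \<inter> space M | A. A \<in> sets borel} =
      sigma_sets (space M) {Z -` A \<inter> space M | A. A \<in> ?G}" for Z :: "'a \<Rightarrow> rat \<Rightarrow> real \<times> real"
  proof -
    have "sets (borel :: (rat \<Rightarrow> real \<times> real) measure) = sigma_sets UNIV ?G"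
      unfolding sets_PiM_equal_borel[symmetric] sets_PiM by simp
    then have "{Z -` A \<inter> space M | A. A \<in> sets borel} = sigma_sets (space M) {Z -` A \<inter> space M | A. A \<in> ?G}"
      using sigma_sets_vimage_commute[of Z "space M" UNIV ?G] by simp
    then show ?thesis by (simp only:) (rule sigma_sets_sigma_sets_eq, auto)
  qed
  have stable: "Int_stable {Z -` A \<inter> space M | A. A \<in> ?G}" for Z :: "'a \<Rightarrow> rat \<Rightarrow> real \<times> real"
    unfolding Int_stable_def
  proof safe
    fix A B assume "A \<in> ?G" "B \<in> ?G"
    then have "A \<inter> B \<in> ?G" using Int_stable_prod_algebra unfolding Int_stable_def by blast
    then show "\<exists>C. Z -` A \<inter> space M \<inter> (Z -` B \<inter> space M) = Z -` C \<inter> space M \<and> C \<in> ?G"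
      by (intro exI[of _ "A \<inter> B"]) auto
  qed
  have sub: "?G \<subseteq> sets borel"
    unfolding sets_PiM_equal_borel[symmetric, where 'b = "real \<times> real"] sets_PiM by auto
  have "indep_set {X -` A \<inter> space M | A. A \<in> ?G} {Y -` A \<inter> space M | A. A \<in> ?G}"
  proof (rule indep_setI)
    fix a b assume "a \<in> {X -` A \<inter> space M | A. A \<in> ?G}" "b \<in> {Y -` A \<inter> space M | A. A \<in> ?G}"
    then obtain A0 B0 where A0: "A0 \<in> ?G" "a = X -` A0 \<inter> space M" and B0: "B0 \<in> ?G" "b = Y -` B0 \<inter> space M" by blast
    obtain J A where A: "A0 = prod_emb UNIV (\<lambda>_. borel) J (\<Pi>\<^sub>E j\<in>J. A j)" "finite J" "\<And>i. i \<in> J \<Longrightarrow> A i \<in> sets borel"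
      using prod_algebraE[OF A0(1)] by metis
    obtain K B where B: "B0 = prod_emb UNIV (\<lambda>_. borel) K (\<Pi>\<^sub>E j\<in>K. B j)" "finite K" "\<And>i. i \<in> K \<Longrightarrow> B i \<in> sets borel"
      using prod_algebraE[OF B0(1)] by metis
    define A' B' where "A' q = (if q \<in> J then A q else UNIV)" and "B' q = (if q \<in> K then B q else UNIV)" for q
    have "a = {\<omega> \<in> space M. \<forall>q\<in>J \<union> K. X \<omega> q \<in> A' q}" "b = {\<omega> \<in> space M. \<forall>q\<in>J \<union> K. Y \<omega> q \<in> B' q}"
      unfolding A0(2) B0(2) A(1) B(1) by (auto simp: prod_emb_iff PiE_iff A'_def B'_def split: if_splits)
    then show "prob (a \<inter> b) = prob a * prob b"
      using cyl[of "J \<union> K" A' B'] A B by (auto simp: A'_def B'_def)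
  qed (use sub measurable_sets[OF X] measurable_sets[OF Y] in auto)
  then show ?thesis
    unfolding indep_var_eq gen using X Y by (auto intro!: indep_set_sigma_sets stable)
qed

context planar_brownian begin

text \<open>
  On a grid that contains \<open>u\<close>, the stopped path depends on the increments before \<open>u\<close> and the future
  on those after it.
\<close>

lemma indep_stopped_future:
  assumes "0 \<le> u"
  shows "indep_var borel (rat_path (\<lambda>t. W (min (real_of_rat u) t))) borel (rat_path (future W (real_of_rat u)))"
proof (rule indep_var_pathI)
  let ?u = "real_of_rat u"
  show "rat_path (\<lambda>t. W (min ?u t)) \<in> borel_measurable M" "rat_path (future W ?u) \<in> borel_measurable M"
    using assms by (auto intro: measurable_stopped_path measurable_future_path)
  fix J :: "rat set" and A B :: "rat \<Rightarrow> (real \<times> real) set"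
  assume J: "finite J" and A: "\<And>i. i \<in> J \<Longrightarrow> A i \<in> sets borel" and B: "\<And>i. i \<in> J \<Longrightarrow> B i \<in> sets borel"
  let ?PA = "{\<omega> \<in> space M. \<forall>q\<in>J. rat_path (\<lambda>t. W (min ?u t)) \<omega> q \<in> A q}"
    and ?FB = "{\<omega> \<in> space M. \<forall>q\<in>J. rat_path (future W ?u) \<omega> q \<in> B q}"
  obtain N :: nat where N: "0 < N" "\<And>q. q \<in> insert u J \<Longrightarrow> \<exists>k::nat. max 0 (real_of_rat q) = real k / real N"
    using common_denominator[of "insert u J"] J by blast
  obtain k :: "rat \<Rightarrow> nat" where k: "\<And>q. q \<in> insert u J \<Longrightarrow> max 0 (real_of_rat q) = real (k q) / real N"
    using N(2) by metis
  define p where "p = k u"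
  have up: "?u = real p / real N" using k[of u] assms by (simp add: p_def max_def)
  define n where "n = p + Max (k ` insert u J)"
  have kn: "p + k q \<le> n" if "q \<in> J" for q
    unfolding n_def using J that by (intro add_left_mono Max_ge) auto
  define cylA where "cylA = {d\<in>space (PiM {..<p} (\<lambda>_. borel :: (real \<times> real) measure)). \<forall>q\<in>J. x + (\<Sum>i<min p (k q). d i) \<in> A q}"
  define cylB where "cylB = {d\<in>space (PiM {p..<n} (\<lambda>_. borel :: (real \<times> real) measure)). \<forall>q\<in>J. (\<Sum>i\<in>{p..<p + k q}. d i) \<in> B q}"
  have cylA: "cylA \<in> sets (PiM {..<p} (\<lambda>_. borel))"
  proof -
    have [measurable]: "(\<lambda>d. x + (\<Sum>i<min p (k q). d i)) \<in> borel_measurable (PiM {..<p} (\<lambda>_. borel :: (real \<times> real) measure))" for q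
      by (intro borel_measurable_add borel_measurable_sum measurable_component_singleton) auto
    show ?thesis unfolding cylA_def using J A by measurable
  qed
  have cylB: "cylB \<in> sets (PiM {p..<n} (\<lambda>_. borel))"
  proof -
    have [measurable]: "(\<lambda>d. \<Sum>i\<in>{p..<p + k q}. d i) \<in> borel_measurable (PiM {p..<n} (\<lambda>_. borel :: (real \<times> real) measure))" if "q \<in> J" for q
      using kn[OF that] by (intro borel_measurable_sum measurable_component_singleton) auto
    show ?thesis unfolding cylB_def using J B by measurable
  qed
  let ?I = "\<lambda>i \<omega>. W (0 + real (Suc i) / real N) \<omega> - W (0 + real i / real N) \<omega>"
  let ?XA = "\<lambda>\<omega>. restrict (\<lambda>i. ?I i \<omega>) {..<p}" and ?XB = "\<lambda>\<omega>. restrict (\<lambda>i. ?I i \<omega>) {p..<n}"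
  have ind: "indep_var (PiM {..<p} (\<lambda>_. borel)) ?XA (PiM {p..<n} (\<lambda>_. borel)) ?XB"
    by (rule indep_var_restrict[OF indep_grid_increments[of 0 N n]]) (auto simp: n_def)
  have incr: "increments W 0 N n \<omega> i = ?I i \<omega>" if "i < n" for i \<omega> using that by (simp add: increments_def)
  have a: "?PA = ?XA -` cylA \<inter> space M"
  proof -
    have "rat_path (\<lambda>t. W (min ?u t)) \<omega> q = x + (\<Sum>i<min p (k q). ?XA \<omega> i)" if "q \<in> J" "\<omega> \<in> space M" for q \<omega>
    proof -
      have "(\<Sum>i<min p (k q). ?XA \<omega> i) = (\<Sum>i\<in>{0..<min p (k q)}. increments W 0 N n \<omega> i)"
        using incr by (intro sum.cong) (auto simp: n_def)
      also have "\<dots> = W (real (min p (k q)) / real N) \<omega> - x"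
        using sum_increments[of "min p (k q)" n 0 0 N \<omega>] start[OF that(2)] by (simp add: n_def)
      also have "real (min p (k q)) / real N = min ?u (max 0 (real_of_rat q))"
        using k[of q] that(1) N(1) unfolding up by (simp add: min_def divide_le_cancel)
      finally show ?thesis by (simp add: rat_path_def)
    qed
    moreover have "?XA \<omega> \<in> space (PiM {..<p} (\<lambda>_. borel))" for \<omega> by (simp add: space_PiM)
    ultimately show ?thesis by (auto simp: cylA_def)
  qed
  have b: "?FB = ?XB -` cylB \<inter> space M"
  proof -
    have "rat_path (future W ?u) \<omega> q = (\<Sum>i\<in>{p..<p + k q}. ?XB \<omega> i)" if "q \<in> J" for q \<omega>
    proof -
      have "(\<Sum>i\<in>{p..<p + k q}. ?XB \<omega> i) = (\<Sum>i\<in>{p..<p + k q}. increments W 0 N n \<omega> i)"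
        using kn[OF that] by (intro sum.cong) (auto simp: incr)
      also have "\<dots> = W (real (p + k q) / real N) \<omega> - W (real p / real N) \<omega>"
        using sum_increments[of "p + k q" n p 0 N \<omega>] kn[OF that] by simp
      also have "real (p + k q) / real N = ?u + max 0 (real_of_rat q)"
        using k[of q] that unfolding up by (simp add: add_divide_distrib)
      finally show ?thesis unfolding up by (simp add: rat_path_def future_def)
    qed
    moreover have "?XB \<omega> \<in> space (PiM {p..<n} (\<lambda>_. borel))" for \<omega> by (simp add: space_PiM)
    ultimately show ?thesis by (auto simp: cylB_def)
  qed
  have "?PA \<inter> ?FB = (\<lambda>\<omega>. (?XA \<omega>, ?XB \<omega>)) -` (cylA \<times> cylB) \<inter> space M"
    unfolding a b by auto
  then show "prob (?PA \<inter> ?FB) = prob ?PA * prob ?FB"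
    using indep_varD[OF ind cylA cylB] unfolding a b by simp
qed

end

section \<open>The Markov property at random times\<close>

lemma tendsto_fun:
  fixes f :: "'b \<Rightarrow> 'i \<Rightarrow> 'a::topological_space"
  assumes "\<And>i. ((\<lambda>x. f x i) \<longlongrightarrow> l i) F"
  shows "(f \<longlongrightarrow> l) F"
  using limitin_componentwise[of "\<lambda>_::'i. euclidean :: 'a topology" UNIV f l F] assms
  by (simp add: euclidean_product_topology)

text \<open>
  The indicator of an open set \<open>U\<close> is the limit of the continuous functions
  \<open>\<lambda>x. min 1 (n * infdist x (- U))\<close>, and open sets generate the Borel sets.
\<close>

lemma finite_borel_measure_eqI:
  fixes N1 N2 :: "'a::metric_space measure"
  assumes fin: "finite_measure N1" "finite_measure N2"
    and sets: "sets N1 = sets borel" "sets N2 = sets borel"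
    and eq: "\<And>g :: 'a \<Rightarrow> real. continuous_on UNIV g \<Longrightarrow> (\<And>x. 0 \<le> g x \<and> g x \<le> 1) \<Longrightarrow> (\<integral>x. g x \<partial>N1) = (\<integral>x. g x \<partial>N2)"
  shows "N1 = N2"
proof -
  interpret N1: finite_measure N1 by fact
  interpret N2: finite_measure N2 by fact
  have space: "space N1 = UNIV" "space N2 = UNIV" using sets[THEN sets_eq_imp_space_eq] by auto
  have open_eq: "emeasure N1 U = emeasure N2 U" if "open U" for U
  proof (cases "U = UNIV")
    case True
    have "(\<integral>x. (1::real) \<partial>N1) = (\<integral>x. 1 \<partial>N2)" by (rule eq[of "\<lambda>_. 1"]) auto
    then show ?thesis using True space by (simp add: N1.emeasure_eq_measure N2.emeasure_eq_measure)
  next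
    case False
    define g :: "nat \<Rightarrow> 'a \<Rightarrow> real" where "g n x = min 1 (real n * infdist x (- U))" for n x
    have g01: "0 \<le> g n x \<and> g n x \<le> 1" for n x by (auto simp: g_def infdist_nonneg)
    have gcont: "continuous_on UNIV (g n)" for n unfolding g_def by (intro continuous_intros)
    have lim: "(\<lambda>n. g n x) \<longlonglongrightarrow> indicator U x" for x
    proof (cases "x \<in> U")
      case True
      then have pos: "0 < infdist x (- U)"
        using that False by (intro infdist_pos_not_in_closed) auto
      have "\<forall>\<^sub>F n in sequentially. 1 / infdist x (- U) \<le> real n"
        using filterlim_real_sequentially by (simp add: filterlim_at_top)
      then have "\<forall>\<^sub>F n in sequentially. g n x = 1"
        by eventually_elim (use pos in \<open>simp add: g_def field_simps\<close>)
      then show ?thesis using True by (auto intro: tendsto_eventually)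
    next
      case False then show ?thesis by (simp add: g_def)
    qed
    have conv: "(\<lambda>n. \<integral>x. g n x \<partial>N) \<longlonglongrightarrow> measure N U" if N: "finite_measure N" "sets N = sets borel" for N
    proof -
      interpret N: finite_measure N by fact
      have "(\<lambda>n. \<integral>x. g n x \<partial>N) \<longlonglongrightarrow> (\<integral>x. indicator U x \<partial>N)"
      proof (rule integral_dominated_convergence[where w="\<lambda>_. 1"])
        show "g n \<in> borel_measurable N" for n
          using borel_measurable_continuous_onI[OF gcont] measurable_cong_sets[OF N(2) refl] by blast
        show "(indicator U :: _ \<Rightarrow> real) \<in> borel_measurable N"
          using \<open>open U\<close> by (intro borel_measurable_indicator) (simp add: N(2))
      qed (use lim g01 in \<open>auto\<close>)
      then show ?thesis using \<open>open U\<close> N(2) by (simp add: sets_eq_imp_space_eq[OF N(2)])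
    qed
    have "measure N1 U = measure N2 U"
      using LIMSEQ_unique[OF conv[OF fin(1) sets(1)]] conv[OF fin(2) sets(2)] eq[OF gcont g01] by simp
    then show ?thesis by (simp add: N1.emeasure_eq_measure N2.emeasure_eq_measure)
  qed
  show ?thesis
  proof (rule measure_eqI_generator_eq[where E="{U. open U}" and \<Omega>=UNIV and A="\<lambda>_. UNIV"])
    show "Int_stable {U :: 'a set. open U}" by (auto simp: Int_stable_def)
  qed (use open_eq sets in \<open>auto simp: borel_def\<close>)
qed

text \<open>
  The sigma-algebra of the path up to time \<open>u\<close>. By continuity it is generated at rational times.
\<close>

abbreviation stopped_algebra :: "'w measure \<Rightarrow> (real \<Rightarrow> 'w \<Rightarrow> real \<times> real) \<Rightarrow> real \<Rightarrow> 'w set set" where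
  "stopped_algebra M W u \<equiv> sets (vimage_algebra (space M) (rat_path (\<lambda>t. W (min u t))) borel)"

lemma stopped_algebra_iff:
  "X \<in> stopped_algebra M W u \<longleftrightarrow> (\<exists>A\<in>sets borel. X = rat_path (\<lambda>t. W (min u t)) -` A \<inter> space M)"
  by (subst sets_vimage_algebra2) auto

lemma stopped_algebra_mono:
  assumes "0 \<le> u" "real_of_rat u \<le> v"
  shows "stopped_algebra M W (real_of_rat u) \<subseteq> stopped_algebra M W v"
proof
  let ?r = "\<lambda>p :: rat \<Rightarrow> real \<times> real. \<lambda>q. p (min u q)"
  have r: "?r \<in> borel_measurable borel"
    by (intro measurable_coordinatewise_then_product measurable_product_coordinates)
  have eq: "rat_path (\<lambda>t. W (min (real_of_rat u) t)) \<omega> = ?r (rat_path (\<lambda>t. W (min v t)) \<omega>)" for \<omega>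
  proof
    fix q
    have "min (real_of_rat u) (max 0 (real_of_rat q)) = min v (max 0 (real_of_rat (min u q)))"
    proof -
      have rat: "real_of_rat (min u q) = min (real_of_rat u) (real_of_rat q)"
        by (simp add: min_def of_rat_less_eq)
      have *: "min a (max 0 b) = min v (max 0 (min a b))" if "0 \<le> a" "a \<le> v" for a b :: real
        using that by (auto simp: min_def max_def)
      show ?thesis unfolding rat by (rule *) (use assms in auto)
    qed
    then show "rat_path (\<lambda>t. W (min (real_of_rat u) t)) \<omega> q = ?r (rat_path (\<lambda>t. W (min v t)) \<omega>) q"
      by (simp add: rat_path_def)
  qed
  fix X assume "X \<in> stopped_algebra M W (real_of_rat u)"
  then obtain A where A: "A \<in> sets borel" "X = rat_path (\<lambda>t. W (min (real_of_rat u) t)) -` A \<inter> space M"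
    unfolding stopped_algebra_iff by blast
  then have "X = rat_path (\<lambda>t. W (min v t)) -` (?r -` A) \<inter> space M" using eq by auto
  moreover have "?r -` A \<in> sets borel" using measurable_sets[OF r A(1)] by simp
  ultimately show "X \<in> stopped_algebra M W v" unfolding stopped_algebra_iff by blast
qed

context planar_brownian begin

lemma brownian: "planar_brownian M W x"
  by unfold_locales

lemma stopped_algebra_subset: "0 \<le> u \<Longrightarrow> stopped_algebra M W u \<subseteq> events"
  by (auto simp: stopped_algebra_iff intro: measurable_sets[OF measurable_stopped_path])

lemma simple_markov:
  assumes "0 \<le> u" "G \<in> stopped_algebra M W (real_of_rat u)" "A \<in> sets borel"
  shows "emeasure M {\<omega>\<in>G. rat_path (future W (real_of_rat u)) \<omega> \<in> A}
    = emeasure M G * emeasure (distr M borel (rat_path (future W 0))) A"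
proof -
  obtain S where S: "S \<in> sets borel" "G = rat_path (\<lambda>t. W (min (real_of_rat u) t)) -` S \<inter> space M"
    using assms(2) unfolding stopped_algebra_iff by blast
  have [measurable]: "rat_path (future W (real_of_rat u)) \<in> borel_measurable M"
    using assms(1) by (intro measurable_future_path) simp
  have "{\<omega>\<in>G. rat_path (future W (real_of_rat u)) \<omega> \<in> A} =
    (\<lambda>\<omega>. (rat_path (\<lambda>t. W (min (real_of_rat u) t)) \<omega>, rat_path (future W (real_of_rat u)) \<omega>)) -` (S \<times> A) \<inter> space M"
    using S(2) by auto
  then have "prob {\<omega>\<in>G. rat_path (future W (real_of_rat u)) \<omega> \<in> A} =
     prob G * prob (rat_path (future W (real_of_rat u)) -` A \<inter> space M)"
    using indep_varD[OF indep_stopped_future[OF assms(1)] S(1) assms(3)] S(2) by simp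
  also have "prob (rat_path (future W (real_of_rat u)) -` A \<inter> space M) =
    measure (distr M borel (rat_path (future W (real_of_rat u)))) A"
    using assms(3) by (simp add: measure_distr)
  also have "distr M borel (rat_path (future W (real_of_rat u))) = distr M borel (rat_path (future W 0))"
    using assms(1) distr_future_path_unique[OF brownian brownian] by simp
  finally have "prob {\<omega>\<in>G. rat_path (future W (real_of_rat u)) \<omega> \<in> A} =
     prob G * measure (distr M borel (rat_path (future W 0))) A" .
  moreover have "emeasure (distr M borel (rat_path (future W 0))) A = ennreal (measure (distr M borel (rat_path (future W 0))) A)"
    using finite_measure.emeasure_eq_measure[OF finite_measure_distr] measurable_future_path[of 0] by simp
  ultimately show ?thesis
    by (simp add: emeasure_eq_measure ennreal_mult)
qed

text \<open>
  Let \<open>T\<^sub>n\<close> be the first dyadic time of level \<open>n\<close> after \<open>T\<close>. On the event \<open>F\<close> intersected with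
  \<open>T\<^sub>n = r\<close>, which is determined by the path up to \<open>r\<close>, the Markov property at the fixed time \<open>r\<close>
  applies; summation over \<open>r\<close> gives the claim with \<open>T\<^sub>n\<close> in place of \<open>T\<close>, with the same law on the
  right for every \<open>n\<close>. Since the paths are continuous, the future after \<open>T\<^sub>n\<close> converges to the one
  after \<open>T\<close> in the path space, and this law is kept in the limit.
\<close>

lemma strong_markov:
  fixes T :: "'w \<Rightarrow> ereal"
  assumes T[measurable]: "T \<in> borel_measurable M" and T0: "\<And>\<omega>. \<omega> \<in> space M \<Longrightarrow> 0 \<le> T \<omega>"
    and Tfin: "AE \<omega> in M. T \<omega> < \<infinity>"
    and F[measurable]: "F \<in> events"
    and past: "\<And>u::rat. 0 < u \<Longrightarrow> {\<omega>\<in>F. T \<omega> < ereal (real_of_rat u)} \<in> stopped_algebra M W (real_of_rat u)"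
    and A: "A \<in> sets borel"
  shows "emeasure M {\<omega>\<in>F. rat_path (future W (real_of_ereal (T \<omega>))) \<omega> \<in> A}
    = emeasure M F * emeasure (distr M borel (rat_path (future W 0))) A"
proof -
  let ?L = "distr M borel (rat_path (future W 0))"
  interpret L: prob_space ?L by (rule prob_space_distr) (simp add: measurable_future_path)
  define s where "s \<omega> = real_of_ereal (T \<omega>)" for \<omega>
  have s[measurable]: "s \<in> borel_measurable M" unfolding s_def by measurable
  have s0: "0 \<le> s \<omega>" if "\<omega> \<in> space M" for \<omega> using T0[OF that] by (simp add: s_def real_of_ereal_pos)
  define F' where "F' = {\<omega>\<in>F. T \<omega> < \<infinity>}"
  have F'_eq: "F' = F \<inter> {\<omega>\<in>space M. T \<omega> < \<infinity>}"
    using sets.sets_into_space[OF F] by (auto simp: F'_def)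
  have F'[measurable]: "F' \<in> events" unfolding F'_eq by measurable
  have Ts: "T \<omega> = ereal (s \<omega>)" if "\<omega> \<in> F'" for \<omega>
    using that T0[of \<omega>] sets.sets_into_space[OF F] unfolding F'_def s_def by (cases "T \<omega>") auto
  have F'F: "emeasure M F' = emeasure M F"
    by (rule emeasure_eq_AE) (use Tfin in \<open>auto simp: F'_def\<close>)
  define \<phi> where "\<phi> \<omega> = rat_path (future W (s \<omega>)) \<omega>" for \<omega>
  define \<phi>n where "\<phi>n n \<omega> = rat_path (future W (real_of_rat (dyadic_after n (s \<omega>)))) \<omega>" for n \<omega>
  have \<phi>n_meas: "\<phi>n n \<in> borel_measurable M" for n
  proof -
    have [measurable]: "rat_path (future W (real_of_rat (of_nat (k + 1) / 2 ^ n))) \<in> borel_measurable M" for k :: nat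
      by (intro measurable_future_path) simp
    have "(\<lambda>\<omega>. rat_path (future W (real_of_rat (of_nat (nat \<lfloor>2 ^ n * s \<omega>\<rfloor> + 1) / 2 ^ n))) \<omega>) \<in> borel_measurable M"
      by (rule measurable_compose_countable[where g="\<lambda>\<omega>. nat \<lfloor>2 ^ n * s \<omega>\<rfloor>"]) measurable
    then show ?thesis unfolding \<phi>n_def[abs_def] dyadic_after_def .
  qed
  have \<phi>_lim: "(\<lambda>n. \<phi>n n \<omega>) \<longlonglongrightarrow> \<phi> \<omega>" if \<omega>: "\<omega> \<in> space M" for \<omega>
  proof (rule tendsto_fun)
    fix q
    let ?d = "\<lambda>n. real_of_rat (dyadic_after n (s \<omega>))"
    have d: "?d \<longlonglongrightarrow> s \<omega>" by (rule dyadic_after_tendsto[OF s0[OF \<omega>]])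
    have d0: "0 \<le> ?d n" for n
      using less_imp_le[OF dyadic_after_bounds(1)[OF s0[OF \<omega>], of n]] by (rule order_trans[OF s0[OF \<omega>]])
    have "(\<lambda>n. W (?d n + max 0 (real_of_rat q)) \<omega> - W (?d n) \<omega>) \<longlonglongrightarrow>
       W (s \<omega> + max 0 (real_of_rat q)) \<omega> - W (s \<omega>) \<omega>"
      by (intro tendsto_diff tendsto_path[of "\<lambda>t. W t \<omega>", OF continuous_paths[OF \<omega>]] tendsto_add d tendsto_const)
         (use d0 s0[OF \<omega>] in auto)
    then show "(\<lambda>n. \<phi>n n \<omega> q) \<longlonglongrightarrow> \<phi> \<omega> q"
      by (simp add: \<phi>n_def \<phi>_def rat_path_def future_def)
  qed
  have \<phi>_meas: "\<phi> \<in> borel_measurable M"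
    using \<phi>n_meas \<phi>_lim by (rule borel_measurable_LIMSEQ_metric)
  \<comment> \<open>The claim for the dyadic approximation of level \<open>n\<close>; \<open>G j\<close> is the event that it is the
    \<open>(j + 1)\<close>-st multiple of \<open>1 / 2 ^ n\<close>.\<close>
  have step: "emeasure M {\<omega>\<in>F'. \<phi>n n \<omega> \<in> A} = emeasure M F' * emeasure ?L A" if A[measurable]: "A \<in> sets borel" for n A
  proof -
    define r :: "nat \<Rightarrow> rat" where "r j = of_nat j / 2 ^ n" for j
    have rr: "real_of_rat (r j) = real j / 2 ^ n" for j unfolding r_def of_rat_divide of_rat_power of_rat_of_nat_eq by simp
    define G where "G j = {\<omega>\<in>F'. nat \<lfloor>2 ^ n * s \<omega>\<rfloor> = j}" for j
    have G_eq: "G j = {\<omega>\<in>F. T \<omega> < ereal (real_of_rat (r (Suc j)))} - {\<omega>\<in>F. T \<omega> < ereal (real_of_rat (r j))}" for j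
    proof -
      have G_iff: "\<omega> \<in> G j \<longleftrightarrow> s \<omega> < real_of_rat (r (Suc j)) \<and> \<not> s \<omega> < real_of_rat (r j)" if "\<omega> \<in> F'" for \<omega>
      proof -
        have "0 \<le> s \<omega>" using that F'_eq s0 by auto
        then have "nat \<lfloor>2 ^ n * s \<omega>\<rfloor> = j \<longleftrightarrow> \<lfloor>2 ^ n * s \<omega>\<rfloor> = int j" by (simp add: nat_eq_iff)
        also have "\<dots> \<longleftrightarrow> real j \<le> 2 ^ n * s \<omega> \<and> 2 ^ n * s \<omega> < real j + 1" by (simp add: floor_eq_iff)
        also have "real j \<le> 2 ^ n * s \<omega> \<longleftrightarrow> \<not> s \<omega> < real_of_rat (r j)"
          by (simp add: rr not_less pos_divide_le_eq mult.commute)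
        also have "2 ^ n * s \<omega> < real j + 1 \<longleftrightarrow> s \<omega> < real_of_rat (r (Suc j))"
          by (simp add: rr pos_less_divide_eq mult.commute add.commute)
        finally show ?thesis using that unfolding G_def by blast
      qed
      show ?thesis
      proof (rule set_eqI)
        fix \<omega>
        show "\<omega> \<in> G j \<longleftrightarrow>
          \<omega> \<in> {\<omega>\<in>F. T \<omega> < ereal (real_of_rat (r (Suc j)))} - {\<omega>\<in>F. T \<omega> < ereal (real_of_rat (r j))}"
        proof (cases "\<omega> \<in> F'")
          case True
          then have "\<omega> \<in> F" by (simp add: F'_def)
          then show ?thesis using G_iff[OF True] Ts[OF True] by simp
        next
          case False
          then have "\<omega> \<notin> F \<or> T \<omega> = \<infinity>" by (auto simp: F'_def)
          then show ?thesis using False by (auto simp: G_def)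
        qed
      qed
    qed
    have Gpast: "G j \<in> stopped_algebra M W (real_of_rat (r (Suc j)))" for j
    proof -
      have "{\<omega>\<in>F. T \<omega> < ereal (real_of_rat (r j))} \<in> stopped_algebra M W (real_of_rat (r (Suc j)))"
      proof (cases "j = 0")
        case True
        then have "{\<omega>\<in>F. T \<omega> < ereal (real_of_rat (r j))} = {}"
          using T0 sets.sets_into_space[OF F] by (auto simp: rr not_less zero_ereal_def[symmetric])
        then show ?thesis by (simp only: sets.empty_sets)
      next
        case False
        then have "0 < r j" by (simp add: r_def)
        have "real_of_rat (r j) \<le> real_of_rat (r (Suc j))" unfolding rr by (simp add: divide_right_mono)
        from stopped_algebra_mono[OF less_imp_le[OF \<open>0 < r j\<close>] this] past[OF \<open>0 < r j\<close>]
        show ?thesis by (rule subsetD)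
      qed
      moreover have "{\<omega>\<in>F. T \<omega> < ereal (real_of_rat (r (Suc j)))} \<in> stopped_algebra M W (real_of_rat (r (Suc j)))"
        by (rule past) (simp add: r_def)
      ultimately show ?thesis unfolding G_eq by (rule sets.Diff[rotated])
    qed
    have G_meas: "G j \<in> events" for j
      using Gpast stopped_algebra_subset[of "real_of_rat (r (Suc j))"] by (auto simp: r_def)
    have [measurable]: "rat_path (future W (real_of_rat (r (Suc j)))) \<in> borel_measurable M" for j
      by (rule measurable_future_path) (simp add: rr)
    have piece: "{\<omega>\<in>G j. \<phi>n n \<omega> \<in> A} = {\<omega>\<in>G j. rat_path (future W (real_of_rat (r (Suc j)))) \<omega> \<in> A}" for j
      by (auto simp: G_def \<phi>n_def dyadic_after_def r_def)
    have piece_meas: "{\<omega>\<in>G j. \<phi>n n \<omega> \<in> A} \<in> events" for j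
    proof -
      have "{\<omega>\<in>G j. \<phi>n n \<omega> \<in> A} = G j \<inter> (\<phi>n n -` A \<inter> space M)"
        using sets.sets_into_space[OF G_meas[of j]] by auto
      then show ?thesis using G_meas measurable_sets[OF \<phi>n_meas A] by auto
    qed
    have "emeasure M {\<omega>\<in>F'. \<phi>n n \<omega> \<in> A} = emeasure M (\<Union>j. {\<omega>\<in>G j. \<phi>n n \<omega> \<in> A})"
      by (rule arg_cong[where f="emeasure M"]) (auto simp: G_def)
    also have "\<dots> = (\<Sum>j. emeasure M {\<omega>\<in>G j. \<phi>n n \<omega> \<in> A})"
      using piece_meas by (intro suminf_emeasure[symmetric]) (auto simp: disjoint_family_on_def G_def)
    also have "\<dots> = (\<Sum>j. emeasure M (G j) * emeasure ?L A)"
      unfolding piece by (intro arg_cong[where f=suminf] ext simple_markov Gpast A) (simp add: r_def)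
    also have "\<dots> = (\<Sum>j. emeasure M (G j)) * emeasure ?L A" by simp
    also have "(\<Sum>j. emeasure M (G j)) = emeasure M (\<Union>j. G j)"
      using G_meas by (intro suminf_emeasure) (auto simp: disjoint_family_on_def G_def)
    also have "(\<Union>j. G j) = F'" by (auto simp: G_def)
    finally show ?thesis .
  qed
  define \<mu> where "\<mu> = density M (indicator F')"
  have \<mu>_em: "emeasure \<mu> X = emeasure M (F' \<inter> X)" if "X \<in> events" for X
    using that unfolding \<mu>_def by (rule emeasure_restricted[OF F'])
  interpret \<mu>: finite_measure \<mu>
    by (rule finite_measureI) (use \<mu>_em[of "space M"] in \<open>simp add: \<mu>_def\<close>)
  have \<mu>_sets: "sets \<mu> = events" by (simp add: \<mu>_def)
  define \<nu> where "\<nu> = scale_measure (emeasure M F') ?L"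
  have \<phi>n_meas': "\<phi>n n \<in> borel_measurable \<mu>" for n using \<phi>n_meas by (simp add: \<mu>_def)
  have \<phi>_meas': "\<phi> \<in> borel_measurable \<mu>" using \<phi>_meas by (simp add: \<mu>_def)
  have distr_n: "distr \<mu> borel (\<phi>n n) = \<nu>" for n
  proof (rule measure_eqI)
    fix A assume "A \<in> sets (distr \<mu> borel (\<phi>n n))"
    then have A: "A \<in> sets borel" by simp
    have "emeasure (distr \<mu> borel (\<phi>n n)) A = emeasure \<mu> (\<phi>n n -` A \<inter> space M)"
      using A \<phi>n_meas' by (simp add: emeasure_distr \<mu>_def)
    also have "\<dots> = emeasure M (F' \<inter> (\<phi>n n -` A \<inter> space M))"
      by (rule \<mu>_em) (rule measurable_sets[OF \<phi>n_meas A])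
    also have "F' \<inter> (\<phi>n n -` A \<inter> space M) = {\<omega>\<in>F'. \<phi>n n \<omega> \<in> A}"
      using sets.sets_into_space[OF F'] by auto
    finally show "emeasure (distr \<mu> borel (\<phi>n n)) A = emeasure \<nu> A"
      using step[OF A] by (simp add: \<nu>_def)
  qed (simp add: \<nu>_def)
  \<comment> \<open>The integrals of a bounded continuous function with respect to the laws of the
    approximations are all equal, and they converge.\<close>
  have "distr \<mu> borel \<phi> = \<nu>"
  proof (rule finite_borel_measure_eqI)
    show "finite_measure (distr \<mu> borel \<phi>)" by (rule \<mu>.finite_measure_distr[OF \<phi>_meas'])
    show "finite_measure \<nu>" unfolding distr_n[of 0, symmetric] by (rule \<mu>.finite_measure_distr[OF \<phi>n_meas'])
    fix g :: "(rat \<Rightarrow> real \<times> real) \<Rightarrow> real"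
    assume g: "continuous_on UNIV g" "\<And>x. 0 \<le> g x \<and> g x \<le> 1"
    have g_meas: "g \<in> borel_measurable borel" by (rule borel_measurable_continuous_onI[OF g(1)])
    have "(\<lambda>n. \<integral>\<omega>. g (\<phi>n n \<omega>) \<partial>\<mu>) \<longlonglongrightarrow> (\<integral>\<omega>. g (\<phi> \<omega>) \<partial>\<mu>)"
    proof (rule integral_dominated_convergence[where w="\<lambda>_. 1"])
      show "(\<lambda>\<omega>. g (\<phi> \<omega>)) \<in> borel_measurable \<mu>" "(\<lambda>\<omega>. g (\<phi>n n \<omega>)) \<in> borel_measurable \<mu>" for n
        using measurable_compose[OF \<phi>_meas' g_meas] measurable_compose[OF \<phi>n_meas' g_meas] by auto
      show "AE \<omega> in \<mu>. (\<lambda>n. g (\<phi>n n \<omega>)) \<longlonglongrightarrow> g (\<phi> \<omega>)"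
        by (rule AE_I2) (auto simp: \<mu>_def intro!: continuous_on_tendsto_compose[OF g(1) \<phi>_lim])
    qed (use g(2) in auto)
    moreover have "(\<integral>\<omega>. g (\<phi>n n \<omega>) \<partial>\<mu>) = (\<integral>p. g p \<partial>\<nu>)" for n
      unfolding distr_n[of n, symmetric] by (rule integral_distr[symmetric, OF \<phi>n_meas' g_meas])
    ultimately show "(\<integral>p. g p \<partial>distr \<mu> borel \<phi>) = (\<integral>p. g p \<partial>\<nu>)"
      using integral_distr[OF \<phi>_meas' g_meas] by (simp add: LIMSEQ_const_iff)
  qed (simp_all add: \<nu>_def)
  then have "emeasure (distr \<mu> borel \<phi>) A = emeasure M F' * emeasure ?L A" by (simp add: \<nu>_def)
  moreover have "emeasure (distr \<mu> borel \<phi>) A = emeasure M (F' \<inter> (\<phi> -` A \<inter> space M))"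
    using \<mu>_em[OF measurable_sets[OF \<phi>_meas A]] A \<phi>_meas' by (simp add: emeasure_distr \<mu>_def)
  moreover have "emeasure M {\<omega>\<in>F. \<phi> \<omega> \<in> A} = emeasure M (F' \<inter> (\<phi> -` A \<inter> space M))"
  proof (rule emeasure_eq_AE)
    have "{\<omega>\<in>F. \<phi> \<omega> \<in> A} = F \<inter> (\<phi> -` A \<inter> space M)" using sets.sets_into_space[OF F] by auto
    then show "{\<omega>\<in>F. \<phi> \<omega> \<in> A} \<in> events" using measurable_sets[OF \<phi>_meas A] by auto
    show "F' \<inter> (\<phi> -` A \<inter> space M) \<in> events" using measurable_sets[OF \<phi>_meas A] by auto
  qed (use Tfin in \<open>auto simp: F'_def\<close>)
  ultimately show ?thesis unfolding F'F by (simp add: \<phi>_def s_def)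
qed

end

section \<open>Symmetries of planar Brownian motion\<close>

lemma measurable_normal_product:
  "(\<lambda>y :: real \<times> real. ennreal (normal_density 0 \<sigma> (fst y) * normal_density 0 \<sigma> (snd y))) \<in> borel_measurable borel"
  by (intro measurable_compose[OF _ measurable_ennreal] borel_measurable_times
      measurable_compose[OF _ borel_measurable_normal_density] borel_measurable_continuous_onI continuous_intros)

lemma distr_gauss_scale:
  assumes a: "0 < a" and v: "0 < v"
  shows "distr (gauss v) borel (\<lambda>y. a *\<^sub>R y) = gauss (a\<^sup>2 * v)"
proof (rule measure_eqI)
  let ?f = "\<lambda>v (y :: real \<times> real). ennreal (normal_density 0 (sqrt v) (fst y) * normal_density 0 (sqrt v) (snd y))"
  note f_meas[measurable] = measurable_normal_product[of "sqrt _"]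
  have f_meas': "?f w \<in> borel_measurable lborel" for w
    using f_meas unfolding measurable_cong_sets[OF sets_lborel refl] .
  have density: "normal_density 0 (sqrt (a\<^sup>2 * v)) (a * z) = normal_density 0 (sqrt v) z / a" for z
    using a v by (simp add: normal_density_def real_sqrt_mult power_mult_distrib field_simps)
  have f: "?f v y = ennreal (\<bar>a\<bar> ^ DIM(real \<times> real)) * ?f (a\<^sup>2 * v) (a *\<^sub>R y)" for y
  proof -
    have "?f v y = ennreal (a\<^sup>2 * (normal_density 0 (sqrt (a\<^sup>2 * v)) (a * fst y) * normal_density 0 (sqrt (a\<^sup>2 * v)) (a * snd y)))"
      unfolding density using a by (simp add: power2_eq_square)
    also have "\<dots> = ennreal (\<bar>a\<bar> ^ DIM(real \<times> real)) * ?f (a\<^sup>2 * v) (a *\<^sub>R y)"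
      using a by (subst ennreal_mult) (simp_all add: power2_eq_square eval_nat_numeral)
    finally show ?thesis .
  qed
  fix A assume "A \<in> sets (distr (gauss v) borel (\<lambda>y. a *\<^sub>R y))"
  then have A[measurable]: "A \<in> sets borel" by simp
  have sc[measurable]: "(\<lambda>y :: real \<times> real. a *\<^sub>R y) \<in> borel_measurable borel" by measurable
  have "emeasure (distr (gauss v) borel (\<lambda>y. a *\<^sub>R y)) A = (\<integral>\<^sup>+y. ?f v y * indicator A (a *\<^sub>R y) \<partial>lborel)"
  proof -
    have "emeasure (distr (gauss v) borel (\<lambda>y. a *\<^sub>R y)) A = emeasure (gauss v) ((\<lambda>y. a *\<^sub>R y) -` A)"
      by (subst emeasure_distr) auto
    also have "\<dots> = (\<integral>\<^sup>+y. ?f v y * indicator ((\<lambda>y. a *\<^sub>R y) -` A) y \<partial>lborel)"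
      using measurable_sets[OF sc A] f_meas'[of v] by (intro emeasure_density) (simp_all only: space_borel Int_UNIV_right sets_lborel)
    finally show ?thesis by (simp add: indicator_vimage comp_def)
  qed
  also have "\<dots> = (\<integral>\<^sup>+y. ennreal (\<bar>a\<bar> ^ DIM(real \<times> real)) * (?f (a\<^sup>2 * v) (a *\<^sub>R y) * indicator A (a *\<^sub>R y)) \<partial>lborel)"
    unfolding f by (simp add: mult.assoc)
  also have "\<dots> = (\<integral>\<^sup>+y. ?f (a\<^sup>2 * v) y * indicator A y \<partial>density (distr lborel borel (\<lambda>x. 0 + a *\<^sub>R x)) (\<lambda>_. ennreal (\<bar>a\<bar> ^ DIM(real \<times> real))))"
    by (subst nn_integral_density) (auto simp: nn_integral_distr intro!: nn_integral_cong)
  also have "\<dots> = (\<integral>\<^sup>+y. ?f (a\<^sup>2 * v) y * indicator A y \<partial>lborel)"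
    using lborel_affine[of a "0 :: real \<times> real"] a by simp
  also have "\<dots> = emeasure (gauss (a\<^sup>2 * v)) A"
    using A by (intro emeasure_density[symmetric] f_meas') simp
  finally show "emeasure (distr (gauss v) borel (\<lambda>y. a *\<^sub>R y)) A = emeasure (gauss (a\<^sup>2 * v)) A" .
qed simp

lemma distributed_gaussI:
  assumes "X \<in> borel_measurable M" "distr M borel X = gauss v"
  shows "distributed M lborel X (\<lambda>y. ennreal (normal_density 0 (sqrt v) (fst y) * normal_density 0 (sqrt v) (snd y)))"
  using assms distr_cong[OF refl sets_lborel[symmetric] refl, of M X] measurable_normal_product
  unfolding distributed_def by simp

context planar_brownian begin

lemma translate_brownian: "planar_brownian M (\<lambda>t \<omega>. W t \<omega> + y) (x + y)"
proof (intro planar_brownian.intro planar_brownian_axioms.intro prob_space_axioms)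
  show "(\<lambda>\<omega>. W t \<omega> + y) \<in> borel_measurable M" if "0 \<le> t" for t
    using random_variable[OF that] by measurable
  show "W 0 \<omega> + y = x + y" if "\<omega> \<in> space M" for \<omega> using start[OF that] by simp
  show "continuous_on {0..} (\<lambda>t. W t \<omega> + y)" if "\<omega> \<in> space M" for \<omega>
    using continuous_paths[OF that] by (intro continuous_intros)
qed (simp_all add: independent_increments gaussian_increments)

lemma scale_brownian:
  assumes a: "0 < a" and x: "x = 0"
  shows "planar_brownian M (\<lambda>t \<omega>. a *\<^sub>R W (t / a\<^sup>2) \<omega>) 0"
proof (intro planar_brownian.intro planar_brownian_axioms.intro prob_space_axioms)
  show "(\<lambda>\<omega>. a *\<^sub>R W (t / a\<^sup>2) \<omega>) \<in> borel_measurable M" if "0 \<le> t" for t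
    using random_variable[of "t / a\<^sup>2"] that by (intro borel_measurable_scaleR) auto
  show "a *\<^sub>R W (0 / a\<^sup>2) \<omega> = 0" if "\<omega> \<in> space M" for \<omega> using start[OF that] x by simp
  show "continuous_on {0..} (\<lambda>t. a *\<^sub>R W (t / a\<^sup>2) \<omega>)" if "\<omega> \<in> space M" for \<omega>
    using a by (intro continuous_intros continuous_on_compose2[OF continuous_paths[OF that]]) auto
  show "indep_vars (\<lambda>_. borel) (\<lambda>i \<omega>. a *\<^sub>R W (t (Suc i) / a\<^sup>2) \<omega> - a *\<^sub>R W (t i / a\<^sup>2) \<omega>) {..<n}"
    if t: "0 \<le> t 0" "mono_on {..n} t" for n and t :: "nat \<Rightarrow> real"
  proof -
    have "indep_vars (\<lambda>_. borel) (\<lambda>i \<omega>. W (t (Suc i) / a\<^sup>2) \<omega> - W (t i / a\<^sup>2) \<omega>) {..<n}"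
      using t a by (intro independent_increments) (auto simp: mono_on_def divide_right_mono)
    from indep_vars_compose2[OF this, of "\<lambda>_ z. a *\<^sub>R z" "\<lambda>_. borel"]
    show ?thesis by (simp add: scaleR_diff_right)
  qed
  show "distributed M lborel (\<lambda>\<omega>. a *\<^sub>R W (t / a\<^sup>2) \<omega> - a *\<^sub>R W (s / a\<^sup>2) \<omega>)
    (\<lambda>y. ennreal (normal_density 0 (sqrt (t - s)) (fst y) * normal_density 0 (sqrt (t - s)) (snd y)))"
    if st: "0 \<le> s" "s < t" for s t
  proof (rule distributed_gaussI)
    have meas[measurable]: "(\<lambda>\<omega>. W (t / a\<^sup>2) \<omega> - W (s / a\<^sup>2) \<omega>) \<in> borel_measurable M"
      using st by (intro measurable_increment) auto
    show "(\<lambda>\<omega>. a *\<^sub>R W (t / a\<^sup>2) \<omega> - a *\<^sub>R W (s / a\<^sup>2) \<omega>) \<in> borel_measurable M"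
      unfolding scaleR_diff_right[symmetric] by measurable
    have "distr M borel (\<lambda>\<omega>. a *\<^sub>R W (t / a\<^sup>2) \<omega> - a *\<^sub>R W (s / a\<^sup>2) \<omega>) =
      distr (distr M borel (\<lambda>\<omega>. W (t / a\<^sup>2) \<omega> - W (s / a\<^sup>2) \<omega>)) borel (\<lambda>y. a *\<^sub>R y)"
      by (subst distr_distr) (auto simp: comp_def scaleR_diff_right)
    also have "\<dots> = gauss (a\<^sup>2 * (t / a\<^sup>2 - s / a\<^sup>2))"
      using st a by (subst distr_increment) (auto intro!: distr_gauss_scale simp: divide_strict_right_mono)
    also have "a\<^sup>2 * (t / a\<^sup>2 - s / a\<^sup>2) = t - s" using a by (simp add: field_simps)
    finally show "distr M borel (\<lambda>\<omega>. a *\<^sub>R W (t / a\<^sup>2) \<omega> - a *\<^sub>R W (s / a\<^sup>2) \<omega>) = gauss (t - s)" .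
  qed
qed

lemma future_0: "x = 0 \<Longrightarrow> \<omega> \<in> space M \<Longrightarrow> rat_path (future W 0) \<omega> = rat_path W \<omega>"
  by (simp add: fun_eq_iff rat_path_def future_def start)

lemma distr_path_eq: "x = 0 \<Longrightarrow> distr M borel (rat_path (future W 0)) = distr M borel (rat_path W)"
  using future_0 by (intro distr_cong) auto

end

lemma distr_path_unique:
  assumes "planar_brownian M W 0" "planar_brownian M' W' 0"
  shows "distr M borel (rat_path W) = distr M' borel (rat_path W')"
  using distr_future_path_unique[OF assms, of 0 0]
    planar_brownian.distr_path_eq[OF assms(1)] planar_brownian.distr_path_eq[OF assms(2)] by simp

lemma indep_vars_distr:
  assumes f: "f \<in> M \<rightarrow>\<^sub>M N" and "prob_space M" and X: "\<And>i. i \<in> I \<Longrightarrow> X i \<in> N \<rightarrow>\<^sub>M M' i"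
    and ind: "prob_space.indep_vars M M' (\<lambda>i \<omega>. X i (f \<omega>)) I"
  shows "prob_space.indep_vars (distr M N f) M' X I"
proof -
  interpret prob_space M by fact
  interpret D: prob_space "distr M N f" by (rule prob_space_distr[OF f])
  show ?thesis
  proof (cases "I = {}")
    case True then show ?thesis by (simp add: D.indep_vars_def D.indep_sets_def)
  next
    case False
    have Xf: "random_variable (M' i) (\<lambda>\<omega>. X i (f \<omega>))" if "i \<in> I" for i
      using measurable_compose[OF f X[OF that]] .
    have "distr (distr M N f) (\<Pi>\<^sub>M i\<in>I. M' i) (\<lambda>x. \<lambda>i\<in>I. X i x) = distr M (\<Pi>\<^sub>M i\<in>I. M' i) (\<lambda>\<omega>. \<lambda>i\<in>I. X i (f \<omega>))"
      using f X by (subst distr_distr) (auto simp: comp_def intro!: measurable_restrict)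
    also have "\<dots> = (\<Pi>\<^sub>M i\<in>I. distr M (M' i) (\<lambda>\<omega>. X i (f \<omega>)))"
      using ind Xf by (subst indep_vars_iff_distr_eq_PiM'[OF False, symmetric]) auto
    also have "\<dots> = (\<Pi>\<^sub>M i\<in>I. distr (distr M N f) (M' i) (X i))"
      using f X by (intro PiM_cong refl) (simp add: distr_distr comp_def)
    finally show ?thesis using X by (subst D.indep_vars_iff_distr_eq_PiM'[OF False]) auto
  qed
qed

text \<open>
  The definition of \<open>Q\<close> takes its Brownian motions on sample points of type \<open>real \<Rightarrow> real \<times> real\<close>.
  The law of the whole path is one, carried by the product sigma-algebra. All sample points must
  have the right start and be continuous, whence the restriction to such functions, and the values
  at negative times have to be made measurable, whence \<open>max 0 t\<close>.
\<close>

lemma (in planar_brownian) path_space_version: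
  "\<exists>(P :: (real \<Rightarrow> real \<times> real) measure) V. planar_brownian P V x"
proof -
  let ?S = "{w :: real \<Rightarrow> real \<times> real. w 0 = x \<and> continuous_on {0..} w}"
  let ?N = "restrict_space (PiM UNIV (\<lambda>_. borel)) ?S"
  let ?f = "\<lambda>\<omega> t. W (max 0 t) \<omega>" and ?V = "\<lambda>t w. w t :: real \<times> real"
  have f: "?f \<in> M \<rightarrow>\<^sub>M ?N"
  proof (rule measurable_restrict_space2)
    show "?f \<in> space M \<rightarrow> ?S"
    proof
      fix \<omega> assume \<omega>: "\<omega> \<in> space M"
      have "continuous_on {0..} (?f \<omega>)"
        using continuous_paths[OF \<omega>] by (rule continuous_on_eq) simp
      then show "?f \<omega> \<in> ?S" using start[OF \<omega>] by simp
    qed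
    show "?f \<in> M \<rightarrow>\<^sub>M Pi\<^sub>M UNIV (\<lambda>_. borel)"
      using random_variable by (intro measurable_PiM_single') (auto simp: space_PiM)
  qed
  have V: "?V t \<in> borel_measurable ?N" for t
    by (intro measurable_restrict_space1 measurable_component_singleton) simp
  have spaceN: "space ?N \<subseteq> ?S" by (simp add: space_restrict_space)
  have "planar_brownian (distr M ?N ?f) ?V x"
  proof (intro planar_brownian.intro planar_brownian_axioms.intro prob_space_distr[OF f])
    show "?V t \<in> borel_measurable (distr M ?N ?f)" for t using V by simp
    show "?V 0 \<omega> = x" "continuous_on {0..} (\<lambda>t. ?V t \<omega>)" if "\<omega> \<in> space (distr M ?N ?f)" for \<omega>
      using that spaceN by auto
    have pos: "0 \<le> t i" if "0 \<le> t 0" "mono_on {..n} t" "i \<le> n" for n i and t :: "nat \<Rightarrow> real"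
      using that(1) mono_onD[OF that(2), of 0 i] that(3) by simp
    show "prob_space.indep_vars (distr M ?N ?f) (\<lambda>_. borel) (\<lambda>i \<omega>. ?V (t (Suc i)) \<omega> - ?V (t i) \<omega>) {..<n}"
      if t: "0 \<le> t 0" "mono_on {..n} t" for n and t :: "nat \<Rightarrow> real"
    proof (rule indep_vars_distr[OF f prob_space_axioms])
      have "indep_vars (\<lambda>_. borel) (\<lambda>i \<omega>. W (t (Suc i)) \<omega> - W (t i) \<omega>) {..<n}"
        by (rule independent_increments[OF t])
      then show "indep_vars (\<lambda>_. borel) (\<lambda>i \<omega>. ?V (t (Suc i)) (?f \<omega>) - ?V (t i) (?f \<omega>)) {..<n}"
        using pos[OF t] by (subst indep_vars_cong[OF refl _ refl]) (auto simp: max_def Suc_le_eq)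
    qed (intro borel_measurable_diff V)
    show "distributed (distr M ?N ?f) lborel (\<lambda>\<omega>. ?V t \<omega> - ?V s \<omega>)
      (\<lambda>y. ennreal (normal_density 0 (sqrt (t - s)) (fst y) * normal_density 0 (sqrt (t - s)) (snd y)))"
      if "0 \<le> s" "s < t" for s t
    proof (rule distributed_gaussI)
      show m: "(\<lambda>\<omega>. ?V t \<omega> - ?V s \<omega>) \<in> borel_measurable (distr M ?N ?f)"
        using V by simp
      have "distr (distr M ?N ?f) borel (\<lambda>\<omega>. ?V t \<omega> - ?V s \<omega>) = distr M borel (\<lambda>\<omega>. W t \<omega> - W s \<omega>)"
        using that m by (subst distr_distr[OF _ f]) (simp_all add: comp_def max_def)
      then show "distr (distr M ?N ?f) borel (\<lambda>\<omega>. ?V t \<omega> - ?V s \<omega>) = gauss (t - s)"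
        using distr_increment[OF that] by simp
    qed
  qed
  then show ?thesis by blast
qed

section \<open>A coordinate becomes negative at once and is unbounded below\<close>

text \<open>
  Statements about the first and the second coordinate are proved together.
\<close>

locale coordinate =
  fixes c :: "real \<times> real \<Rightarrow> real"
  assumes fst_or_snd: "c = fst \<or> c = snd"
begin

lemma coordinate_scaleR [simp]: "c (a *\<^sub>R z) = a * c z"
  and coordinate_diff [simp]: "c (z - w) = c z - c w"
  and coordinate_add [simp]: "c (z + w) = c z + c w"
  and coordinate_zero [simp]: "c 0 = 0"
  using fst_or_snd by auto

lemma continuous_coordinate: "continuous_on S c"
  using fst_or_snd by (auto intro!: continuous_intros)

lemma measurable_coordinate: "c \<in> borel_measurable borel"
  by (rule borel_measurable_continuous_onI[OF continuous_coordinate])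

lemma gauss_pos: "0 < emeasure (gauss v) {z. c z < 0}" if "0 < v"
proof (rule ccontr)
  let ?f = "\<lambda>y. ennreal (normal_density 0 (sqrt v) (fst y) * normal_density 0 (sqrt v) (snd y))"
  assume "\<not> 0 < emeasure (gauss v) {z. c z < 0}"
  then have zero: "emeasure (gauss v) {z. c z < 0} = 0" by simp
  have meas: "{z. c z < 0} \<in> sets lborel"
    using measurable_sets[OF measurable_coordinate, of "{..<0}"] by (simp add: vimage_def)
  have f_meas: "?f \<in> borel_measurable lborel"
    using measurable_normal_product[of "sqrt v"] unfolding measurable_lborel2 .
  have "(\<integral>\<^sup>+z. ?f z * indicator {z. c z < 0} z \<partial>lborel) = 0"
    using zero emeasure_density[OF f_meas meas] by simp
  then have "AE z in lborel. ?f z * indicator {z. c z < 0} z = 0"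
    using f_meas meas by (subst (asm) nn_integral_0_iff_AE) (auto intro: borel_measurable_times_ennreal borel_measurable_indicator)
  then have ae: "AE z in lborel. \<not> c z < 0"
    by eventually_elim (use \<open>0 < v\<close> normal_density_pos[of "sqrt v" 0] in \<open>auto simp: ennreal_eq_0_iff indicator_def mult_le_0_iff not_le[symmetric] split: if_splits\<close>)
  have sub: "box (-1, -1) (0, 0) \<subseteq> {z. c z < 0}"
    using fst_or_snd by (auto simp: box_def Basis_prod_def)
  have "AE z in lborel. z \<notin> box (-1 :: real, -1 :: real) (0, 0)"
    using ae by eventually_elim (use sub in blast)
  then have "emeasure lborel (box (-1 :: real, -1 :: real) (0, 0)) = 0"
    by (subst (asm) AE_iff_measurable[OF _ refl]) auto
  moreover have "emeasure lborel (box (-1 :: real, -1 :: real) (0, 0)) = 1"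
    by (subst emeasure_lborel_box) (auto simp: Basis_prod_def prod.union_disjoint prod.insert_if)
  ultimately show False by simp
qed

definition stays_above :: "real \<Rightarrow> (rat \<Rightarrow> real \<times> real) set" where
  "stays_above b = {p. \<forall>q. - b \<le> c (p q)}"

definition nonneg_on_unit :: "(rat \<Rightarrow> real \<times> real) set" where
  "nonneg_on_unit = {p. \<forall>q\<in>{0..1}. 0 \<le> c (p q)}"

lemma measurable_coordinate_at: "(\<lambda>p. c (p q)) \<in> borel_measurable borel"
  by (rule measurable_compose[OF measurable_product_coordinates measurable_coordinate])

lemma sets_stays_above: "stays_above b \<in> sets borel"
proof -
  have "stays_above b = (\<Inter>q. {p. - b \<le> c (p q)})" by (auto simp: stays_above_def)
  also have "\<dots> \<in> sets borel"
    using measurable_sets[OF measurable_coordinate_at, of "{- b..}"] by (intro sets.countable_INT) (auto simp: vimage_def)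
  finally show ?thesis .
qed

lemma sets_nonneg_on_unit: "nonneg_on_unit \<in> sets borel"
proof -
  have "nonneg_on_unit = (\<Inter>q\<in>{0..1}. {p. 0 \<le> c (p q)})" by (auto simp: nonneg_on_unit_def)
  also have "\<dots> \<in> sets borel"
    using measurable_sets[OF measurable_coordinate_at, of "{0..}"] by (intro sets.countable_INT') (auto simp: vimage_def)
  finally show ?thesis .
qed

end

locale brownian_coordinate = planar_brownian M B 0 + coordinate c
  for M :: "'w measure" and B and c
begin

lemma measurable_B_path: "rat_path B \<in> borel_measurable M"
  by (rule measurable_path) (rule random_variable)

lemma path_ge:
  assumes \<omega>: "\<omega> \<in> space M" and s: "0 \<le> s"
    and ge: "\<And>q::rat. 0 < q \<Longrightarrow> real_of_rat q < s + e \<Longrightarrow> b \<le> c (B (of_rat q) \<omega>)" and "0 < e"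
  shows "b \<le> c (B s \<omega>)"
proof (rule tendsto_lowerbound)
  have "\<forall>\<^sub>F n in sequentially. 0 \<le> real_of_rat (dyadic_after n s)"
    by (intro always_eventually allI) (rule order_trans[OF s less_imp_le[OF dyadic_after_bounds(1)[OF s]]])
  then have "(\<lambda>n. B (real_of_rat (dyadic_after n s)) \<omega>) \<longlonglongrightarrow> B s \<omega>"
    by (rule tendsto_path[of "\<lambda>t. B t \<omega>", OF continuous_paths[OF \<omega>] dyadic_after_tendsto[OF s] s])
  from continuous_on_tendsto_compose[OF continuous_coordinate[of UNIV] this]
  show "(\<lambda>n. c (B (real_of_rat (dyadic_after n s)) \<omega>)) \<longlonglongrightarrow> c (B s \<omega>)" by simp
  have "\<forall>\<^sub>F n in sequentially. real_of_rat (dyadic_after n s) < s + e"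
    using order_tendstoD(2)[OF dyadic_after_tendsto[OF s]] \<open>0 < e\<close> by simp
  then show "\<forall>\<^sub>F n in sequentially. b \<le> c (B (real_of_rat (dyadic_after n s)) \<omega>)"
  proof eventually_elim
    case (elim n)
    have "0 < dyadic_after n s"
      using order.strict_trans1[OF s dyadic_after_bounds(1)[OF s, of n]] zero_less_of_rat_iff by blast
    then show ?case using elim by (intro ge)
  qed
qed simp

lemma stays_above_iff:
  assumes "\<omega> \<in> space M"
  shows "rat_path B \<omega> \<in> stays_above b \<longleftrightarrow> (\<forall>t\<ge>0. - b \<le> c (B t \<omega>))"
proof
  assume a: "rat_path B \<omega> \<in> stays_above b"
  show "\<forall>t\<ge>0. - b \<le> c (B t \<omega>)"
  proof (intro allI impI)
    fix t :: real assume "0 \<le> t"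
    show "- b \<le> c (B t \<omega>)"
      by (rule path_ge[OF assms \<open>0 \<le> t\<close>, of 1])
         (use a in \<open>auto simp: stays_above_def rat_path_def max_def dest!: spec split: if_splits\<close>)
  qed
qed (auto simp: stays_above_def rat_path_def)

text \<open>
  Stretching space by \<open>a\<close> (and time by \<open>a\<^sup>2\<close>) turns paths above \<open>- b / a\<close> into paths above \<open>- b\<close>.
\<close>

lemma prob_stays_above_scale:
  assumes a: "0 < a"
  shows "prob (rat_path B -` stays_above b \<inter> space M) = prob (rat_path B -` stays_above (b / a) \<inter> space M)"
proof -
  interpret S: planar_brownian M "\<lambda>t \<omega>. a *\<^sub>R B (t / a\<^sup>2) \<omega>" 0 by (rule local.scale_brownian[OF a refl])
  interpret S: brownian_coordinate M "\<lambda>t \<omega>. a *\<^sub>R B (t / a\<^sup>2) \<omega>" c ..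
  have "prob (rat_path B -` stays_above b \<inter> space M) = measure (distr M borel (rat_path B)) (stays_above b)"
    using sets_stays_above measurable_B_path by (simp add: measure_distr)
  also have "\<dots> = measure (distr M borel (rat_path (\<lambda>t \<omega>. a *\<^sub>R B (t / a\<^sup>2) \<omega>))) (stays_above b)"
    using distr_path_unique[OF brownian S.brownian] by simp
  also have "\<dots> = prob (rat_path (\<lambda>t \<omega>. a *\<^sub>R B (t / a\<^sup>2) \<omega>) -` stays_above b \<inter> space M)"
    using sets_stays_above S.measurable_B_path by (simp add: measure_distr)
  also have "rat_path (\<lambda>t \<omega>. a *\<^sub>R B (t / a\<^sup>2) \<omega>) -` stays_above b \<inter> space M = rat_path B -` stays_above (b / a) \<inter> space M"
  proof -
    have "(\<forall>t\<ge>0. - b \<le> a * c (B (t / a\<^sup>2) \<omega>)) \<longleftrightarrow> (\<forall>t\<ge>0. - (b / a) \<le> c (B t \<omega>))" for \<omega>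
    proof (intro iffI allI impI)
      fix t :: real assume L: "\<forall>t\<ge>0. - b \<le> a * c (B (t / a\<^sup>2) \<omega>)" and "0 \<le> t"
      have "0 \<le> a\<^sup>2 * t" using \<open>0 \<le> t\<close> by simp
      with L have "- b \<le> a * c (B (a\<^sup>2 * t / a\<^sup>2) \<omega>)" by blast
      moreover have "a\<^sup>2 * t / a\<^sup>2 = t" using a by simp
      ultimately have "- b \<le> a * c (B t \<omega>)" by (simp only:)
      then show "- (b / a) \<le> c (B t \<omega>)" using a by (simp add: field_simps)
    next
      fix t :: real assume "\<forall>t\<ge>0. - (b / a) \<le> c (B t \<omega>)" "0 \<le> t"
      then have "- (b / a) \<le> c (B (t / a\<^sup>2) \<omega>)" by simp
      then show "- b \<le> a * c (B (t / a\<^sup>2) \<omega>)" using a by (simp add: field_simps)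
    qed
    then show ?thesis using stays_above_iff S.stays_above_iff by auto
  qed
  finally show ?thesis .
qed

text \<open>
  By scaling all \<open>b > 0\<close> have the same probability, and \<open>b = 0\<close> is their limit.
\<close>

lemma prob_stays_above_const:
  assumes "0 \<le> b"
  shows "prob (rat_path B -` stays_above b \<inter> space M) = prob (rat_path B -` stays_above 0 \<inter> space M)"
proof -
  have c: "prob (rat_path B -` stays_above b \<inter> space M) = prob (rat_path B -` stays_above 1 \<inter> space M)" if "0 < b" for b
    using prob_stays_above_scale[of b b] that by simp
  have "(\<lambda>n. prob (rat_path B -` stays_above (1 / Suc n) \<inter> space M)) \<longlonglongrightarrow> prob (\<Inter>n. rat_path B -` stays_above (1 / Suc n) \<inter> space M)"
  proof (rule finite_Lim_measure_decseq)
    show "range (\<lambda>n. rat_path B -` stays_above (1 / Suc n) \<inter> space M) \<subseteq> events"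
      using measurable_sets[OF measurable_B_path sets_stays_above] by auto
    show "decseq (\<lambda>n. rat_path B -` stays_above (1 / Suc n) \<inter> space M)"
    proof (rule decseq_SucI)
      fix n
      have "1 / real (Suc (Suc n)) \<le> 1 / real (Suc n)" by (simp add: frac_le)
      then show "rat_path B -` stays_above (1 / Suc (Suc n)) \<inter> space M \<subseteq> rat_path B -` stays_above (1 / Suc n) \<inter> space M"
        unfolding stays_above_def by (auto intro: order_trans[of _ "- (1 / real (Suc (Suc n)))"] simp del: of_nat_Suc)
    qed
  qed
  also have "(\<Inter>n. rat_path B -` stays_above (1 / Suc n) \<inter> space M) = rat_path B -` stays_above 0 \<inter> space M"
  proof -
    have "0 \<le> r" if "\<And>n. - (1 / real (Suc n)) \<le> r" for r :: real
    proof (rule ccontr)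
      assume "\<not> 0 \<le> r"
      then obtain n where "1 / real (Suc n) < - r" using nat_approx_posE[of "- r"] by auto
      then show False using that[of n] by simp
    qed
    moreover have "- (1 / real (Suc n)) \<le> r" if "0 \<le> r" for r n using that by (rule order_trans[rotated]) simp
    ultimately show ?thesis unfolding stays_above_def by (auto simp del: of_nat_Suc)
  qed
  finally have "prob (rat_path B -` stays_above 0 \<inter> space M) = prob (rat_path B -` stays_above 1 \<inter> space M)"
    using c[of "1 / Suc _"] by (simp add: LIMSEQ_const_iff)
  then show ?thesis using c[of b] assms by (cases "b = 0") auto
qed

text \<open>
  If the coordinate \<open>c\<close> of \<open>B\<close> never becomes negative, then either it exceeds \<open>n\<close> at time \<open>1\<close>, or it is
  nonnegative at time \<open>1\<close> and its increments after time \<open>1\<close> stay above \<open>- n\<close>. The events of the last case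
  are independent, and the second one has the probability \<open>\<pi>\<close> that is sought, whatever \<open>n\<close> is. In
  the limit \<open>n \<rightarrow> \<infinity>\<close> this gives \<open>\<pi> \<le> prob P * \<pi>\<close> for the event \<open>P\<close> of being nonnegative at time
  \<open>1\<close>, and \<open>prob P < 1\<close>.
\<close>

lemma prob_stays_above_zero: "prob (rat_path B -` stays_above 0 \<inter> space M) = 0"
proof -
  define \<pi> where "\<pi> = prob (rat_path B -` stays_above 0 \<inter> space M)"
  have B1[measurable]: "B 1 \<in> borel_measurable M" by (rule random_variable) simp
  have cB1[measurable]: "(\<lambda>\<omega>. c (B 1 \<omega>)) \<in> borel_measurable M" by (rule measurable_compose[OF B1 measurable_coordinate])
  define P where "P = {\<omega>\<in>space M. 0 \<le> c (B 1 \<omega>)}"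
  have P[measurable]: "P \<in> events" unfolding P_def by measurable
  have past: "P \<in> stopped_algebra M B (real_of_rat 1)"
    unfolding stopped_algebra_iff
  proof (intro bexI)
    show "P = rat_path (\<lambda>t. B (min (real_of_rat 1) t)) -` {p. 0 \<le> c (p 1)} \<inter> space M"
      by (auto simp: P_def rat_path_def)
    show "{p. 0 \<le> c (p 1)} \<in> sets borel"
      using measurable_sets[OF measurable_coordinate_at, of "{0..}" 1] by (simp add: vimage_def)
  qed
  define high where "high n = {\<omega>\<in>space M. real n < c (B 1 \<omega>)}" for n :: nat
  let ?low = "\<lambda>n :: nat. {\<omega>\<in>P. rat_path (future B 1) \<omega> \<in> stays_above n}"
  have high_ev: "high n \<in> events" for n unfolding high_def by measurable
  have bound: "\<pi> \<le> prob P * \<pi> + prob (high n)" for n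
  proof -
    have fut[measurable]: "rat_path (future B 1) \<in> borel_measurable M" by (rule measurable_future_path) simp
    have sub: "rat_path B -` stays_above 0 \<inter> space M \<subseteq> ?low n \<union> high n"
    proof
      fix \<omega> assume "\<omega> \<in> rat_path B -` stays_above 0 \<inter> space M"
      then have \<omega>: "\<omega> \<in> space M" and ge: "\<And>t. 0 \<le> t \<Longrightarrow> 0 \<le> c (B t \<omega>)" using stays_above_iff[of \<omega> 0] by auto
      show "\<omega> \<in> ?low n \<union> high n"
      proof (cases "real n < c (B 1 \<omega>)")
        case False
        then have "- real n \<le> c (B (1 + t) \<omega>) - c (B 1 \<omega>)" if "0 \<le> t" for t using ge[of "1 + t"] that by simp
        then show ?thesis using \<omega> ge[of 1] by (auto simp: P_def stays_above_def rat_path_def future_def)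
      qed (use \<omega> in \<open>simp add: high_def\<close>)
    qed
    have Pn: "?low n \<in> events"
    proof -
      have "?low n = P \<inter> (rat_path (future B 1) -` stays_above n \<inter> space M)"
        by (auto simp: P_def)
      then show ?thesis using measurable_sets[OF fut sets_stays_above] by auto
    qed
    have "emeasure M (?low n) = emeasure M P * emeasure (distr M borel (rat_path B)) (stays_above n)"
      using simple_markov[OF _ past sets_stays_above, of n] distr_path_eq by simp
    also have "emeasure (distr M borel (rat_path B)) (stays_above n) = ennreal \<pi>"
      using sets_stays_above measurable_B_path prob_stays_above_const[of n] by (simp add: emeasure_distr emeasure_eq_measure \<pi>_def)
    finally have eq: "prob (?low n) = prob P * \<pi>"
      by (simp add: emeasure_eq_measure ennreal_mult[symmetric] \<pi>_def)
    have "\<pi> \<le> prob (?low n \<union> high n)"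
      unfolding \<pi>_def using sub Pn high_ev by (intro finite_measure_mono) auto
    also have "\<dots> \<le> prob (?low n) + prob (high n)"
      using Pn high_ev by (intro measure_Un_le) auto
    finally show ?thesis unfolding eq .
  qed
  have "(\<lambda>n. prob (high n)) \<longlonglongrightarrow> prob (\<Inter>n. high n)"
    by (rule finite_Lim_measure_decseq) (use high_ev in \<open>auto simp: decseq_def high_def\<close>)
  moreover have "(\<Inter>n. high n) = {}"
  proof (rule ccontr)
    assume "(\<Inter>n. high n) \<noteq> {}"
    then obtain \<omega> where "\<And>n. real n < c (B 1 \<omega>)" by (auto simp: high_def)
    then show False using reals_Archimedean2[of "c (B 1 \<omega>)"] by (meson not_less_iff_gr_or_eq)
  qed
  ultimately have "(\<lambda>n. prob P * \<pi> + prob (high n)) \<longlonglongrightarrow> prob P * \<pi> + 0"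
    by (intro tendsto_add tendsto_const) simp
  then have "\<pi> \<le> prob P * \<pi> + 0"
    by (rule tendsto_lowerbound) (auto intro: always_eventually bound)
  moreover have "prob P < 1"
  proof -
    have "prob (space M - P) = measure (distr M borel (B 1)) {z. c z < 0}"
      using measurable_sets[OF measurable_coordinate, of "{..<0}"]
      by (subst measure_distr) (auto simp: vimage_def P_def intro!: arg_cong[where f=prob])
    also have "distr M borel (B 1) = distr M borel (\<lambda>\<omega>. B 1 \<omega> - B 0 \<omega>)"
      by (intro distr_cong) (auto simp: start)
    also have "\<dots> = gauss 1" using distr_increment[of 0 1] by simp
    finally have "ennreal (prob (space M - P)) = emeasure (gauss 1) {z. c z < 0}"
    proof -
      assume eq: "prob (space M - P) = Sigma_Algebra.measure (gauss 1) {z. c z < 0}"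
      have "gauss 1 = distr M borel (\<lambda>\<omega>. B 1 \<omega> - B 0 \<omega>)" using distr_increment[of 0 1] by simp
      then have "finite_measure (gauss 1)"
        using finite_measure_distr[OF measurable_increment[of 0 1]] by simp
      then show ?thesis using eq finite_measure.emeasure_eq_measure by metis
    qed
    then have "0 < prob (space M - P)" using gauss_pos[of 1] by (metis ennreal_less_zero_iff zero_less_one)
    then show ?thesis using prob_compl[OF P] by simp
  qed
  moreover have "0 \<le> \<pi>" by (simp add: \<pi>_def)
  ultimately have "\<pi> * (1 - prob P) \<le> 0" by (simp add: algebra_simps)
  then show ?thesis using \<open>prob P < 1\<close> \<open>0 \<le> \<pi>\<close> unfolding \<pi>_def[symmetric] by (simp add: mult_le_0_iff)
qed

lemma AE_below: "AE \<omega> in M. \<forall>b. \<exists>t>0. c (B t \<omega>) < b"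
proof -
  have "AE \<omega> in M. \<forall>n::nat. rat_path B \<omega> \<notin> stays_above n"
    unfolding AE_all_countable
  proof
    fix n :: nat
    have "prob (rat_path B -` stays_above n \<inter> space M) = 0"
      using prob_stays_above_const[of n] prob_stays_above_zero by simp
    then show "AE \<omega> in M. rat_path B \<omega> \<notin> stays_above n"
      by (intro AE_I[of _ _ "rat_path B -` stays_above n \<inter> space M"])
         (auto simp: emeasure_eq_measure measurable_sets[OF measurable_B_path sets_stays_above])
  qed
  then show ?thesis
  proof (rule AE_mp, intro AE_I2 impI allI)
    fix \<omega> b assume \<omega>: "\<omega> \<in> space M" and n: "\<forall>n::nat. rat_path B \<omega> \<notin> stays_above n"
    obtain n :: nat where "- b < real n" using reals_Archimedean2 by blast
    moreover obtain t where "0 \<le> t" "c (B t \<omega>) < - real n"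
      using n stays_above_iff[OF \<omega>, of n] by (auto simp: not_le)
    moreover have "t \<noteq> 0" using start[OF \<omega>] calculation by auto
    ultimately show "\<exists>t>0. c (B t \<omega>) < b" by (intro exI[of _ t]) auto
  qed
qed

text \<open>
  Brownian scaling that moves the time interval from \<open>0\<close> to \<open>s\<close> to the unit interval.
\<close>

definition zoom :: "real \<Rightarrow> real \<Rightarrow> 'w \<Rightarrow> real \<times> real" where
  "zoom s t \<omega> = (1 / sqrt s) *\<^sub>R B (s * t) \<omega>"

lemma brownian_zoom: "0 < s \<Longrightarrow> planar_brownian M (zoom s) 0"
proof -
  assume "0 < s"
  then have "(1 / sqrt s)\<^sup>2 = 1 / s" by (simp add: power_divide)
  then show ?thesis using scale_brownian[of "1 / sqrt s"] \<open>0 < s\<close> by (simp add: zoom_def[abs_def] mult.commute[of s])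
qed

lemma prob_zoom:
  assumes s: "0 < s" and A: "A \<in> sets borel"
  shows "prob (rat_path (zoom s) -` A \<inter> space M) = prob (rat_path B -` A \<inter> space M)"
proof -
  interpret S: planar_brownian M "zoom s" 0 by (rule brownian_zoom[OF s])
  interpret S: brownian_coordinate M "zoom s" c ..
  show ?thesis
    using distr_path_unique[OF brownian S.brownian] measure_distr[OF measurable_B_path A] measure_distr[OF S.measurable_B_path A]
    by simp
qed

lemma zoom_nonneg_on_unit_iff:
  assumes \<omega>: "\<omega> \<in> space M" and s: "0 < s"
  shows "rat_path (zoom s) \<omega> \<in> nonneg_on_unit \<longleftrightarrow> (\<forall>q\<in>{0..1::rat}. 0 \<le> c (B (s * of_rat q) \<omega>))"
  using s by (auto simp: nonneg_on_unit_def rat_path_def zoom_def zero_le_divide_iff max_def)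

text \<open>
  By scaling, being nonnegative on \<open>{0..s}\<close> has the same probability for every \<open>s\<close>, and for
  \<open>s \<rightarrow> \<infinity>\<close> these events decrease to being nonnegative forever.
\<close>

lemma prob_nonneg_on_unit: "prob (rat_path B -` nonneg_on_unit \<inter> space M) = 0"
proof -
  let ?A = "\<lambda>n. rat_path (zoom (real (Suc n))) -` nonneg_on_unit \<inter> space M"
  have A_iff: "\<omega> \<in> ?A n \<longleftrightarrow> \<omega> \<in> space M \<and> (\<forall>q. 0 \<le> q \<longrightarrow> q \<le> rat_of_nat (Suc n) \<longrightarrow> 0 \<le> c (B (of_rat q) \<omega>))" for n \<omega>
  proof -
    have "(\<forall>q\<in>{0..1::rat}. 0 \<le> c (B (real (Suc n) * of_rat q) \<omega>)) \<longleftrightarrow>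
      (\<forall>q. 0 \<le> q \<longrightarrow> q \<le> rat_of_nat (Suc n) \<longrightarrow> 0 \<le> c (B (of_rat q) \<omega>))" (is "?L \<longleftrightarrow> ?R")
    proof
      assume L: ?L
      show ?R
      proof (intro allI impI)
        fix q :: rat assume q: "0 \<le> q" "q \<le> rat_of_nat (Suc n)"
        then have "q / rat_of_nat (Suc n) \<in> {0..1}" by (simp add: divide_le_eq_1)
        with L have "0 \<le> c (B (real (Suc n) * of_rat (q / rat_of_nat (Suc n))) \<omega>)" by blast
        then show "0 \<le> c (B (of_rat q) \<omega>)" by (simp add: of_rat_divide del: of_nat_Suc)
      qed
    next
      assume R: ?R
      show ?L
      proof
        fix q :: rat assume q: "q \<in> {0..1}"
        then have "0 \<le> rat_of_nat (Suc n) * q" "rat_of_nat (Suc n) * q \<le> rat_of_nat (Suc n)"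
          by (auto simp: mult_le_cancel_left1 simp del: of_nat_Suc)
        with R have "0 \<le> c (B (of_rat (rat_of_nat (Suc n) * q)) \<omega>)" by blast
        then show "0 \<le> c (B (real (Suc n) * of_rat q) \<omega>)" by (simp add: of_rat_mult del: of_nat_Suc)
      qed
    qed
    then show ?thesis using zoom_nonneg_on_unit_iff[of \<omega> "real (Suc n)"] by auto
  qed
  have "(\<lambda>n. prob (?A n)) \<longlonglongrightarrow> prob (\<Inter>n. ?A n)"
  proof (rule finite_Lim_measure_decseq)
    show "range ?A \<subseteq> events"
    proof safe
      fix n
      interpret S: planar_brownian M "zoom (real (Suc n))" 0 by (rule brownian_zoom) simp
      show "?A n \<in> events" by (rule measurable_sets[OF measurable_path sets_nonneg_on_unit]) (rule S.random_variable)
    qed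
    show "decseq ?A"
      by (rule decseq_SucI, rule subsetI, unfold A_iff) (auto intro: order_trans)
  qed
  also have "(\<Inter>n. ?A n) \<subseteq> rat_path B -` stays_above 0 \<inter> space M"
  proof
    fix \<omega> assume "\<omega> \<in> (\<Inter>n. ?A n)"
    then have \<omega>: "\<omega> \<in> space M" and ge: "\<And>n q. 0 \<le> q \<Longrightarrow> q \<le> rat_of_nat (Suc n) \<Longrightarrow> 0 \<le> c (B (of_rat q) \<omega>)"
      unfolding INT_iff A_iff by blast+
    have "0 \<le> c (B (of_rat q) \<omega>)" if "0 \<le> q" for q :: rat
    proof -
      obtain n where "q < rat_of_nat n" using reals_Archimedean2 by blast
      then show ?thesis using ge[OF that, of n] by simp
    qed
    then have "rat_path B \<omega> \<in> stays_above 0"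
      using start[OF \<omega>] by (auto simp: stays_above_def rat_path_def max_def)
    then show "\<omega> \<in> rat_path B -` stays_above 0 \<inter> space M" using \<omega> by simp
  qed
  then have "prob (\<Inter>n. ?A n) = 0"
    using prob_stays_above_zero finite_measure_mono[OF _ measurable_sets[OF measurable_B_path sets_stays_above[of 0]]]
    by (metis measure_le_0_iff)
  finally show ?thesis
    using prob_zoom[OF _ sets_nonneg_on_unit] by (simp add: LIMSEQ_const_iff del: of_nat_Suc)
qed

lemma AE_immediately_negative: "AE \<omega> in M. \<forall>s>0. \<exists>t>0. t < s \<and> c (B t \<omega>) < 0"
proof -
  have "AE \<omega> in M. \<forall>n::nat. rat_path (zoom (1 / real (Suc n))) \<omega> \<notin> nonneg_on_unit"
    unfolding AE_all_countable
  proof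
    fix n
    interpret S: planar_brownian M "zoom (1 / real (Suc n))" 0 by (rule brownian_zoom) simp
    interpret S: brownian_coordinate M "zoom (1 / real (Suc n))" c ..
    have "prob (rat_path (zoom (1 / real (Suc n))) -` nonneg_on_unit \<inter> space M) = 0"
      using prob_zoom[OF _ sets_nonneg_on_unit, of "1 / real (Suc n)"] prob_nonneg_on_unit by simp
    then show "AE \<omega> in M. rat_path (zoom (1 / real (Suc n))) \<omega> \<notin> nonneg_on_unit"
      by (intro AE_I[of _ _ "rat_path (zoom (1 / real (Suc n))) -` nonneg_on_unit \<inter> space M"])
         (auto simp: emeasure_eq_measure measurable_sets[OF S.measurable_B_path sets_nonneg_on_unit] simp del: of_nat_Suc)
  qed
  then show ?thesis
  proof (rule AE_mp, intro AE_I2 impI allI)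
    fix \<omega> and s :: real assume \<omega>: "\<omega> \<in> space M" and n: "\<forall>n::nat. rat_path (zoom (1 / real (Suc n))) \<omega> \<notin> nonneg_on_unit" and "0 < s"
    obtain n where n': "1 / real (Suc n) < s" using nat_approx_posE[OF \<open>0 < s\<close>] by blast
    obtain q :: rat where q: "0 \<le> q" "q \<le> 1" "c (B (1 / real (Suc n) * of_rat q) \<omega>) < 0"
      using n zoom_nonneg_on_unit_iff[OF \<omega>, of "1 / real (Suc n)"] by (auto simp: not_le simp del: of_nat_Suc)
    let ?t = "1 / real (Suc n) * of_rat q"
    have "?t \<le> 1 / real (Suc n)" using q(2) by (simp add: divide_right_mono)
    moreover have "0 < ?t" using q start[OF \<omega>] by (cases "q = 0") auto
    ultimately show "\<exists>t>0. t < s \<and> c (B t \<omega>) < 0" using q(3) n' by (intro exI[of _ ?t]) auto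
  qed
qed

end

section \<open>Touching a level without crossing it\<close>

context coordinate begin

definition unit_minimum :: "(rat \<Rightarrow> real \<times> real) \<Rightarrow> ereal" where
  "unit_minimum p = (INF q\<in>{0..1}. ereal (c (p q)))"

lemma measurable_unit_minimum: "unit_minimum \<in> borel_measurable borel"
  unfolding unit_minimum_def[abs_def]
  by (intro borel_measurable_INF countableI_type borel_measurable_ereal measurable_coordinate_at)

end

context brownian_coordinate begin

lemma unit_minimum_zoom:
  assumes \<omega>: "\<omega> \<in> space M" and r: "0 < r" "r < s" and touch: "c (B r \<omega>) = - a"
    and ge: "\<And>t. 0 \<le> t \<Longrightarrow> t \<le> s \<Longrightarrow> - a \<le> c (B t \<omega>)"
  shows "unit_minimum (rat_path (zoom s) \<omega>) = ereal (- a / sqrt s)"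
proof (rule antisym)
  have s: "0 < s" using r by simp
  have in01: "0 \<le> q \<Longrightarrow> q \<le> 1 \<Longrightarrow> 0 \<le> s * real_of_rat q \<and> s * real_of_rat q \<le> s" for q
    using s by (simp add: mult_le_cancel_left1)
  show "ereal (- a / sqrt s) \<le> unit_minimum (rat_path (zoom s) \<omega>)"
    unfolding unit_minimum_def
  proof (rule INF_greatest)
    fix q :: rat assume q: "q \<in> {0..1}"
    then have "- a / sqrt s \<le> c (B (s * real_of_rat q) \<omega>) / sqrt s"
      using in01[of q] s by (intro divide_right_mono ge) auto
    then show "ereal (- a / sqrt s) \<le> ereal (c (rat_path (zoom s) \<omega> q))"
      using q by (simp add: rat_path_def zoom_def max_def)
  qed
  interpret S: planar_brownian M "zoom s" 0 by (rule brownian_zoom[OF s])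
  have rs: "0 \<le> r / s" "r / s < 1" using r s by auto
  show "unit_minimum (rat_path (zoom s) \<omega>) \<le> ereal (- a / sqrt s)"
  proof (rule tendsto_lowerbound)
    have "(\<lambda>n. rat_path (zoom s) \<omega> (dyadic_after n (r / s))) \<longlonglongrightarrow> zoom s (r / s) \<omega>"
      by (rule path_dyadic_after_tendsto[of "zoom s" \<omega>, OF S.continuous_paths[OF \<omega>] rs(1)])
    from continuous_on_tendsto_compose[OF continuous_coordinate[of UNIV] this]
    have "(\<lambda>n. c (rat_path (zoom s) \<omega> (dyadic_after n (r / s)))) \<longlonglongrightarrow> c (zoom s (r / s) \<omega>)" by simp
    also have "c (zoom s (r / s) \<omega>) = - a / sqrt s" using s touch by (simp add: zoom_def)
    finally show "(\<lambda>n. ereal (c (rat_path (zoom s) \<omega> (dyadic_after n (r / s))))) \<longlonglongrightarrow> ereal (- a / sqrt s)" by simp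
    have "\<forall>\<^sub>F n in sequentially. real_of_rat (dyadic_after n (r / s)) < 1"
      by (rule order_tendstoD(2)[OF dyadic_after_tendsto[OF rs(1)] rs(2)])
    then show "\<forall>\<^sub>F n in sequentially. unit_minimum (rat_path (zoom s) \<omega>) \<le> ereal (c (rat_path (zoom s) \<omega> (dyadic_after n (r / s))))"
    proof eventually_elim
      case (elim n)
      have "0 < real_of_rat (dyadic_after n (r / s))"
        using dyadic_after_bounds(1)[OF rs(1), of n] rs(1) by (rule order.strict_trans1[rotated])
      then have "dyadic_after n (r / s) \<in> {0..1}"
        using elim by (auto simp: less_imp_le)
      then show ?case unfolding unit_minimum_def by (rule INF_lower)
    qed
  qed simp
qed

text \<open>
  If \<open>- a\<close> is touched at time \<open>r\<close> and not crossed until \<open>s\<close>, then \<open>- a\<close> is the minimum over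
  \<open>{0..s'}\<close> for every \<open>s'\<close> between \<open>r\<close> and \<open>s\<close>. This minimum has the law of \<open>sqrt s'\<close> times the
  minimum over the unit interval, so it equals \<open>- a\<close> with positive probability only if
  \<open>- a / sqrt s'\<close> is one of the countably many atoms of the latter law. As \<open>a > 0\<close>, this excludes
  countably many \<open>s'\<close> only, and countably many of the others meet all intervals with rational ends.
\<close>

lemma AE_no_touch_pos:
  assumes a: "0 < a"
  shows "AE \<omega> in M. \<forall>r s. 0 < r \<longrightarrow> r < s \<longrightarrow> (\<forall>t. 0 \<le> t \<longrightarrow> t \<le> s \<longrightarrow> - a \<le> c (B t \<omega>)) \<longrightarrow> c (B r \<omega>) \<noteq> - a"
proof -
  let ?\<mu> = "distr (distr M borel (rat_path B)) borel unit_minimum"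
  interpret \<mu>: finite_measure ?\<mu>
    by (intro finite_measure.finite_measure_distr[OF finite_measure_distr] measurable_B_path)
       (simp add: measurable_unit_minimum)
  define bad where "bad = {s. 0 < s \<and> measure ?\<mu> {ereal (- a / sqrt s)} \<noteq> 0}"
  have "countable ((\<lambda>s. ereal (- a / sqrt s)) ` bad)"
    by (rule countable_subset[OF _ \<mu>.countable_support]) (auto simp: bad_def)
  moreover have "inj_on (\<lambda>s. ereal (- a / sqrt s)) bad"
    using a by (auto simp: inj_on_def bad_def)
  ultimately have bad: "countable bad" by (rule countable_image_inj_on)
  have "\<exists>s. u < s \<and> s < v \<and> s \<notin> bad" if "u < v" for u v :: real
  proof -
    have "uncountable ({u<..<v} - bad)"
      using bad that by (intro uncountable_minus_countable) (simp add: uncountable_open_interval)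
    then have "{u<..<v} - bad \<noteq> {}" using countable_empty by metis
    then show ?thesis by auto
  qed
  then obtain g where g: "\<And>u v :: real. u < v \<Longrightarrow> u < g u v \<and> g u v < v \<and> g u v \<notin> bad" by metis
  let ?off = "\<lambda>s \<omega>. 0 < s \<longrightarrow> s \<notin> bad \<longrightarrow> unit_minimum (rat_path (zoom s) \<omega>) \<noteq> ereal (- a / sqrt s)"
  have null: "AE \<omega> in M. ?off s \<omega>" for s
  proof (cases "0 < s \<and> s \<notin> bad")
    case True
    interpret S: planar_brownian M "zoom s" 0 using True by (intro brownian_zoom) simp
    interpret S: brownian_coordinate M "zoom s" c ..
    let ?A = "unit_minimum -` {ereal (- a / sqrt s)}"
    have A: "?A \<in> sets borel" using measurable_sets[OF measurable_unit_minimum, of "{ereal (- a / sqrt s)}"] by simp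
    have "prob (rat_path (zoom s) -` ?A \<inter> space M) = prob (rat_path B -` ?A \<inter> space M)"
      using True by (intro prob_zoom A) simp
    also have "\<dots> = measure (distr M borel (rat_path B)) ?A"
      by (rule measure_distr[OF measurable_B_path A, symmetric])
    also have "\<dots> = measure ?\<mu> {ereal (- a / sqrt s)}"
      by (subst (2) measure_distr) (auto simp: measurable_unit_minimum)
    also have "\<dots> = 0" using True by (auto simp: bad_def)
    finally have "prob (rat_path (zoom s) -` ?A \<inter> space M) = 0" .
    then show ?thesis
      by (intro AE_I[of _ _ "rat_path (zoom s) -` ?A \<inter> space M"])
         (use measurable_sets[OF S.measurable_B_path A] in \<open>auto simp: emeasure_eq_measure\<close>)
  qed auto
  have "AE \<omega> in M. \<forall>u v :: rat. ?off (g (of_rat u) (of_rat v)) \<omega>"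
    unfolding AE_all_countable using null by blast
  then show ?thesis
  proof (rule AE_mp, intro AE_I2 impI allI notI)
    fix \<omega> r s
    assume \<omega>: "\<omega> \<in> space M" and r: "0 < r" "r < s" and touch: "c (B r \<omega>) = - a"
      and ge: "\<forall>t. 0 \<le> t \<longrightarrow> t \<le> s \<longrightarrow> - a \<le> c (B t \<omega>)"
      and low: "\<forall>u v :: rat. ?off (g (of_rat u) (of_rat v)) \<omega>"
    obtain u :: rat where u: "r < of_rat u" "of_rat u < s" using of_rat_dense[OF r(2)] by blast
    obtain v :: rat where v: "real_of_rat u < of_rat v" "of_rat v < s" using of_rat_dense[OF u(2)] by blast
    let ?s = "g (of_rat u) (of_rat v)"
    have s': "r < ?s" "?s < s" "?s \<notin> bad" using g[OF v(1)] u v by auto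
    have "unit_minimum (rat_path (zoom ?s) \<omega>) = ereal (- a / sqrt ?s)"
      using s' ge by (intro unit_minimum_zoom[OF \<omega> r(1) _ touch]) auto
    moreover have "0 < ?s" using s'(1) r(1) by simp
    ultimately show False using low[rule_format, OF _ s'(3)] by blast
  qed
qed

text \<open>
  The level \<open>0\<close> is different, since scaling does not move it; there the path crosses at once.
\<close>

lemma AE_no_touch:
  assumes a: "0 \<le> a"
  shows "AE \<omega> in M. \<forall>r s. 0 < r \<longrightarrow> r < s \<longrightarrow> (\<forall>t. 0 \<le> t \<longrightarrow> t \<le> s \<longrightarrow> - a \<le> c (B t \<omega>)) \<longrightarrow> c (B r \<omega>) \<noteq> - a"
proof (cases "a = 0")
  case True
  show ?thesis
    using AE_immediately_negative
  proof eventually_elim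
    case (elim \<omega>)
    show ?case
    proof (intro allI impI)
      fix r s :: real assume "0 < r" "r < s" and ge: "\<forall>t. 0 \<le> t \<longrightarrow> t \<le> s \<longrightarrow> - a \<le> c (B t \<omega>)"
      then obtain t where "0 < t" "t < s" "c (B t \<omega>) < 0" using elim by (meson order.strict_trans)
      then have False using ge True by (force dest: spec[of _ t])
      then show "c (B r \<omega>) \<noteq> - a" ..
    qed
  qed
qed (use a AE_no_touch_pos in simp)

end

section \<open>The law of an exit position\<close>

locale standard_brownian = planar_brownian M B 0 for M :: "'w measure" and B
begin

sublocale fst: brownian_coordinate M B fst by unfold_locales simp
sublocale snd: brownian_coordinate M B snd by unfold_locales simp

lemma AE_exit_finite: "AE \<omega> in M. \<forall>y. exit_time B (quadrant_from (- y)) \<omega> < \<infinity>"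
  using fst.AE_below
proof eventually_elim
  case (elim \<omega>)
  show ?case
  proof
    fix y :: "real \<times> real"
    obtain t where "0 < t" "fst (B t \<omega>) < - fst y" using elim by blast
    then have "B t \<omega> \<notin> quadrant_from (- y)" unfolding in_quadrant_from_iff mem_quadrant by simp
    then have "exit_time B (quadrant_from (- y)) \<omega> \<le> ereal t" by (intro exit_time_le \<open>0 < t\<close>)
    then show "exit_time B (quadrant_from (- y)) \<omega> < \<infinity>" by (rule order.strict_trans1) simp
  qed
qed

text \<open>
  Between an exit from the open quadrant and a later one from the closed quadrant, a coordinate of
  the path would touch \<open>0\<close> without becoming negative.
\<close>

lemma AE_open_exit_eq_closed_exit:
  assumes y: "y \<in> quadrant"
  shows "AE \<omega> in M. exit_time (\<lambda>t \<omega>. B t \<omega> + y) open_quadrant \<omega> = exit_time B (quadrant_from (- y)) \<omega>"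
proof -
  have y0: "0 \<le> fst y" "0 \<le> snd y" using y mem_quadrant by auto
  show ?thesis
    using fst.AE_no_touch[OF y0(1)] snd.AE_no_touch[OF y0(2)] AE_space
  proof eventually_elim
    case (elim \<omega>)
    show ?case
    proof (rule antisym)
      show "exit_time (\<lambda>t \<omega>. B t \<omega> + y) open_quadrant \<omega> \<le> exit_time B (quadrant_from (- y)) \<omega>"
        unfolding exit_time_def in_quadrant_from_iff
        by (intro INF_superset_mono) (auto simp: mem_quadrant mem_open_quadrant simp del: mem_Times_iff)
      show "exit_time B (quadrant_from (- y)) \<omega> \<le> exit_time (\<lambda>t \<omega>. B t \<omega> + y) open_quadrant \<omega>"
      proof (rule ccontr)
        assume "\<not> exit_time B (quadrant_from (- y)) \<omega> \<le> exit_time (\<lambda>t \<omega>. B t \<omega> + y) open_quadrant \<omega>"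
        then obtain r where r: "0 < r" "ereal r < exit_time B (quadrant_from (- y)) \<omega>" "B r \<omega> + y \<notin> open_quadrant"
          unfolding not_le exit_time_less_iff by blast
        obtain d where d: "ereal r < d" "d < exit_time B (quadrant_from (- y)) \<omega>" using dense[OF r(2)] by blast
        then obtain s where s: "r < s" "ereal s < exit_time B (quadrant_from (- y)) \<omega>" by (cases d) auto
        have inside: "B t \<omega> + y \<in> quadrant" if "0 \<le> t" "t \<le> s" for t
        proof (cases "t = 0")
          case True then show ?thesis using start[OF elim(3)] y by simp
        next
          case False
          then have "B t \<omega> \<in> quadrant_from (- y)"
            using that s(2) by (intro inside_before_exit) (auto intro: order.strict_trans1[of _ "ereal s"])
          then show ?thesis by (simp only: in_quadrant_from_iff)
        qed
        have "0 \<le> fst (B t \<omega>) + fst y \<and> 0 \<le> snd (B t \<omega>) + snd y" if "0 \<le> t" "t \<le> s" for t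
          using inside[OF that] unfolding mem_quadrant by simp
        then have ge: "- fst y \<le> fst (B t \<omega>)" "- snd y \<le> snd (B t \<omega>)" if "0 \<le> t" "t \<le> s" for t
          using that by (force simp: algebra_simps)+
        then have "fst (B r \<omega>) \<noteq> - fst y" "snd (B r \<omega>) \<noteq> - snd y"
          using elim(1,2) r(1) s(1) by blast+
        then have "B r \<omega> + y \<in> open_quadrant"
          using ge[of r] r(1) s(1) unfolding mem_open_quadrant by simp
        then show False using r(3) by simp
      qed
    qed
  qed
qed

end

lemma sets_E: "E \<in> sets borel"
  unfolding E_def using closed_quadrant open_open_quadrant by (intro sets.Diff borel_closed borel_open)

lemma space_E_borel [simp]: "space E_borel = E"
  by (simp add: E_borel_def space_restrict_space)

lemma sets_E_borel_iff: "A \<in> sets E_borel \<longleftrightarrow> A \<subseteq> E \<and> A \<in> sets borel"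
  unfolding E_borel_def using sets_E by (subst sets_restrict_space_iff) auto

lemma measurable_E_borelI:
  "f \<in> borel_measurable N \<Longrightarrow> (\<And>\<omega>. \<omega> \<in> space N \<Longrightarrow> f \<omega> \<in> E) \<Longrightarrow> f \<in> N \<rightarrow>\<^sub>M E_borel"
  unfolding E_borel_def by (rule measurable_restrict_space2) auto

lemma measurable_from_E_borel:
  "f \<in> borel \<rightarrow>\<^sub>M N \<Longrightarrow> f \<in> E_borel \<rightarrow>\<^sub>M N"
  unfolding E_borel_def by (rule measurable_restrict_space1)

context standard_brownian begin

lemma D_eq_of_path: "\<omega> \<in> space M \<Longrightarrow> D B y \<omega> = D_of_path y (rat_path B \<omega>)"
  by (rule D_eq_D_of_path[of B \<omega>]) (rule continuous_paths)

lemma measurable_B_path: "rat_path B \<in> borel_measurable M"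
  by (rule fst.measurable_B_path)

lemma measurable_D: "D B y \<in> borel_measurable M"
proof -
  note measurable_B_path[measurable]
  have "(\<lambda>\<omega>. D_of_path y (rat_path B \<omega>)) \<in> borel_measurable M" by measurable
  then show ?thesis by (rule measurable_cong[THEN iffD2, rotated]) (rule D_eq_of_path)
qed

lemma D_in: "y \<in> quadrant \<Longrightarrow> \<omega> \<in> space M \<Longrightarrow> D B y \<omega> \<in> E"
  by (rule D_in_E[of B \<omega>]) (simp_all add: continuous_paths start)

lemma measurable_D_E: "y \<in> quadrant \<Longrightarrow> D B y \<in> M \<rightarrow>\<^sub>M E_borel"
  by (intro measurable_E_borelI measurable_D D_in)

lemma emeasure_distr_D:
  assumes "y \<in> quadrant" "A \<in> sets E_borel"
  shows "emeasure (distr M E_borel (D B y)) A = emeasure (distr M borel (rat_path B)) (D_of_path y -` A)"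
proof -
  have "D_of_path y \<in> borel_measurable borel" by measurable
  then have "D_of_path y -` A \<in> sets borel"
    using assms(2) measurable_sets[of "D_of_path y" borel borel A] by (simp add: sets_E_borel_iff)
  moreover have "D B y -` A \<inter> space M = rat_path B -` (D_of_path y -` A) \<inter> space M"
    by (auto simp only: D_eq_of_path vimage_eq Int_iff)
  ultimately show ?thesis
    using assms measurable_D_E measurable_B_path by (simp add: emeasure_distr)
qed

end

lemma distr_D_unique:
  assumes "standard_brownian M B" "standard_brownian M' B'" "y \<in> quadrant"
  shows "distr M E_borel (D B y) = distr M' E_borel (D B' y)"
proof (rule measure_eqI)
  interpret A: standard_brownian M B by fact
  interpret A': standard_brownian M' B' by fact
  fix A assume "A \<in> sets (distr M E_borel (D B y))"
  then show "emeasure (distr M E_borel (D B y)) A = emeasure (distr M' E_borel (D B' y)) A"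
    using assms(3) distr_path_unique[OF A.brownian A'.brownian]
    by (simp add: A.emeasure_distr_D A'.emeasure_distr_D)
qed simp

text \<open>
  By translation the Brownian motion \<open>V\<close> may be started at \<open>0\<close>; there the open and the closed exit
  agree almost surely, and the closed one is a function of the path, whose law is unique.
\<close>

lemma (in standard_brownian) distr_quadrant_exit:
  assumes P: "planar_brownian P V y" and y: "y \<in> quadrant"
  shows "distr P E_borel (quadrant_exit V) = distr M E_borel (D B y)"
proof -
  interpret P: planar_brownian P V y by fact
  let ?W = "\<lambda>t \<omega>. V t \<omega> + (- y)"
  interpret W: standard_brownian P ?W
    using P.translate_brownian[of "- y"] by (simp add: standard_brownian_def)
  have V: "(\<lambda>t \<omega>. ?W t \<omega> + y) = V" by (simp add: fun_eq_iff)
  have "distr P E_borel (quadrant_exit V) = distr P E_borel (D ?W y)"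
  proof (rule distr_cong_AE[OF refl refl])
    show "AE \<omega> in P. quadrant_exit V \<omega> = D ?W y \<omega>"
      using W.AE_open_exit_eq_closed_exit[OF y] unfolding V
      by eventually_elim (simp add: quadrant_exit_def D_def)
    show "quadrant_exit V \<in> P \<rightarrow>\<^sub>M E_borel"
      using y by (intro measurable_E_borelI measurable_quadrant_exit quadrant_exit_in_E)
         (auto simp: P.random_variable P.continuous_paths P.start simp del: mem_Times_iff)
    show "D ?W y \<in> P \<rightarrow>\<^sub>M E_borel" by (rule W.measurable_D_E[OF y])
  qed
  also have "\<dots> = distr M E_borel (D B y)"
    by (rule distr_D_unique[OF W.standard_brownian_axioms standard_brownian_axioms y])
  finally show ?thesis .
qed

lemma (in standard_brownian) Q_eq_distr_D:
  assumes y: "y \<in> quadrant"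
  shows "Q y = distr M E_borel (D B y)"
  unfolding Q_def
proof (rule the_equality)
  interpret T: planar_brownian M "\<lambda>t \<omega>. B t \<omega> + y" y
    using translate_brownian[of y] by simp
  obtain P :: "(real \<Rightarrow> real \<times> real) measure" and V where "planar_brownian P V y"
    using T.path_space_version by blast
  then show "\<exists>(P :: (real \<Rightarrow> real \<times> real) measure) W.
      planar_brownian P W y \<and> distr M E_borel (D B y) = distr P E_borel (quadrant_exit W)"
    using distr_quadrant_exit[OF \<open>planar_brownian P V y\<close> y] by (intro exI[of _ P] exI[of _ V]) simp
next
  fix \<mu> assume "\<exists>(P :: (real \<Rightarrow> real \<times> real) measure) W.
      planar_brownian P W y \<and> \<mu> = distr P E_borel (quadrant_exit W)"
  then obtain P :: "(real \<Rightarrow> real \<times> real) measure" and V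
    where "planar_brownian P V y" "\<mu> = distr P E_borel (quadrant_exit V)" by (elim exE conjE)
  then show "\<mu> = distr M E_borel (D B y)"
    using distr_quadrant_exit[of P V y] y by simp
qed

section \<open>The Markov property of the exit positions\<close>

context standard_brownian begin

abbreviation tau :: "real \<times> real \<Rightarrow> 'w \<Rightarrow> ereal" where
  "tau y \<equiv> exit_time B (quadrant_from (- y))"

lemma tau_eq: "\<omega> \<in> space M \<Longrightarrow> tau y \<omega> = rat_exit y (rat_path B \<omega>)"
  by (rule exit_time_eq_rat_exit[of B \<omega>]) (rule continuous_paths)

lemma measurable_tau: "tau y \<in> borel_measurable M"
proof -
  note measurable_B_path[measurable]
  have "(\<lambda>\<omega>. rat_exit y (rat_path B \<omega>)) \<in> borel_measurable M" by measurable
  then show ?thesis by (rule measurable_cong[THEN iffD2, rotated]) (rule tau_eq)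
qed

text \<open>
  The past of the exit time from \<open>[-y, \<infinity>)\<close>. The strict inequality makes it the sigma-algebra that
  includes the infinitesimal future of the exit time; only the part of an event with exit before
  \<open>u\<close> has to be determined by the path up to \<open>u\<close>.
\<close>

definition exit_past :: "real \<times> real \<Rightarrow> 'w set set" where
  "exit_past y = {F \<in> events. \<forall>u::rat. 0 < u \<longrightarrow>
      {\<omega>\<in>F. tau y \<omega> < ereal (of_rat u)} \<in> stopped_algebra M B (of_rat u)}"

lemma continuous_stopped: "\<omega> \<in> space M \<Longrightarrow> 0 \<le> u \<Longrightarrow> continuous_on {0..} (\<lambda>t. B (min u t) \<omega>)"
  by (intro continuous_on_compose2[OF continuous_paths] continuous_intros) auto

text \<open>
  The exit from \<open>[-y, \<infinity>)\<close> precedes the one from \<open>[-(y + v), \<infinity>)\<close>. If the latter is before \<open>u\<close>, the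
  path stopped at \<open>u\<close> shows both.
\<close>

lemma D_exit_past:
  assumes y: "y \<in> quadrant" and v: "v \<in> quadrant" and A: "A \<in> sets borel"
  shows "{\<omega>\<in>space M. D B y \<omega> \<in> A} \<in> exit_past (y + v)"
proof -
  have "{\<omega>\<in>space M. D B y \<omega> \<in> A} = D B y -` A \<inter> space M" by auto
  then have ev: "{\<omega>\<in>space M. D B y \<omega> \<in> A} \<in> events" using measurable_sets[OF measurable_D A] by simp
  have "{\<omega>\<in>{\<omega>\<in>space M. D B y \<omega> \<in> A}. tau (y + v) \<omega> < ereal (of_rat u)} \<in> stopped_algebra M B (of_rat u)"
    if u: "0 < u" for u :: rat
    unfolding stopped_algebra_iff
  proof (intro bexI)
    let ?u = "real_of_rat u" and ?B = "\<lambda>t. B (min (real_of_rat u) t)"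
    let ?A = "{p. rat_exit (y + v) p < ereal ?u \<and> D_of_path y p \<in> A}"
    have u': "0 < ?u" using u by simp
    show "{\<omega>\<in>{\<omega>\<in>space M. D B y \<omega> \<in> A}. tau (y + v) \<omega> < ereal ?u} = rat_path ?B -` ?A \<inter> space M"
    proof (rule set_eqI)
      fix \<omega>
      show "\<omega> \<in> {\<omega>\<in>{\<omega>\<in>space M. D B y \<omega> \<in> A}. tau (y + v) \<omega> < ereal ?u} \<longleftrightarrow> \<omega> \<in> rat_path ?B -` ?A \<inter> space M"
      proof (cases "\<omega> \<in> space M \<and> tau (y + v) \<omega> < ereal ?u")
        case True
        then have cont: "continuous_on {0..} (\<lambda>t. ?B t \<omega>)" using u' by (intro continuous_stopped) auto
        have "tau y \<omega> < ereal ?u" using exit_time_mono[OF v, of B y \<omega>] True by (auto intro: order.strict_trans1)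
        then have "D_of_path y (rat_path ?B \<omega>) = D B y \<omega>"
          using D_eq_D_of_path[of ?B \<omega> y, OF cont] stopped_D[of ?u B y \<omega>, OF u'] by simp
        moreover have "rat_exit (y + v) (rat_path ?B \<omega>) < ereal ?u"
          using exit_time_eq_rat_exit[of ?B \<omega> "y + v", OF cont] stopped_exit_time(1)[of ?u B "quadrant_from (- (y + v))" \<omega>, OF u'] True by (simp only:)
        ultimately show ?thesis using True by simp
      next
        case False
        have "\<not> rat_exit (y + v) (rat_path ?B \<omega>) < ereal ?u" if \<omega>: "\<omega> \<in> space M"
        proof -
          have cont: "continuous_on {0..} (\<lambda>t. ?B t \<omega>)" using u' \<omega> by (intro continuous_stopped) auto
          show ?thesis
            using exit_time_eq_rat_exit[of ?B \<omega> "y + v", OF cont] stopped_exit_time(1)[of ?u B "quadrant_from (- (y + v))" \<omega>, OF u'] False \<omega>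
            by (simp only: simp_thms)
        qed
        then show ?thesis using False by auto
      qed
    qed
    show "?A \<in> sets borel"
    proof -
      have [measurable]: "rat_exit (y + v) \<in> borel_measurable borel" "D_of_path y \<in> borel_measurable borel"
        by measurable
      have "?A = (rat_exit (y + v) -` {..<ereal ?u} \<inter> space borel) \<inter> (D_of_path y -` A \<inter> space borel)" by auto
      also have "\<dots> \<in> sets borel" using A by (intro sets.Int measurable_sets[of _ borel borel]) auto
      finally show ?thesis .
    qed
  qed
  then show ?thesis using ev by (simp add: exit_past_def)
qed

lemma space_exit_past: "y \<in> quadrant \<Longrightarrow> space M \<in> exit_past y"
  using D_exit_past[of y 0 UNIV] by (simp add: mem_quadrant del: mem_Times_iff)

lemma sigma_algebra_exit_past:
  assumes y: "y \<in> quadrant"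
  shows "sigma_algebra (space M) (exit_past y)"
  unfolding sigma_algebra_iff2
proof (intro conjI ballI allI impI)
  have sub: "F \<subseteq> space M" if "F \<in> exit_past y" for F
    using that sets.sets_into_space unfolding exit_past_def by blast
  show "exit_past y \<subseteq> Pow (space M)" using sub by blast
  show "{} \<in> exit_past y" by (simp add: exit_past_def)
  fix F assume F: "F \<in> exit_past y"
  have "{\<omega>\<in>space M - F. tau y \<omega> < ereal (of_rat u)} =
     {\<omega>\<in>space M. tau y \<omega> < ereal (of_rat u)} - {\<omega>\<in>F. tau y \<omega> < ereal (of_rat u)}" for u by auto
  then show "space M - F \<in> exit_past y"
    using F space_exit_past[OF y] unfolding exit_past_def by (auto intro!: sets.Diff)
next
  fix F :: "nat \<Rightarrow> 'w set" assume F: "range F \<subseteq> exit_past y"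
  have "{\<omega>\<in>(\<Union>i. F i). tau y \<omega> < ereal (of_rat u)} = (\<Union>i. {\<omega>\<in>F i. tau y \<omega> < ereal (of_rat u)})" for u by auto
  then show "(\<Union>i. F i) \<in> exit_past y"
    using F unfolding exit_past_def by (auto intro!: sets.countable_UN)
qed

lemma exit_past_Int:
  assumes "y \<in> quadrant" "F \<in> exit_past y" "G \<in> exit_past y"
  shows "F \<inter> G \<in> exit_past y"
proof -
  interpret E: sigma_algebra "space M" "exit_past y" by (rule sigma_algebra_exit_past[OF assms(1)])
  show ?thesis by (rule E.Int[OF assms(2,3)])
qed

lemma Q_scaled_eq:
  assumes "y \<in> quadrant" "0 < a"
  shows "Q (a *\<^sub>R y) = distr M E_borel (\<lambda>\<omega>. a *\<^sub>R D B y \<omega>)"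
proof -
  interpret S: standard_brownian M "\<lambda>t \<omega>. a *\<^sub>R B (t / a\<^sup>2) \<omega>"
    using scale_brownian[OF assms(2) refl] by (simp add: standard_brownian_def)
  have "Q (a *\<^sub>R y) = distr M E_borel (D (\<lambda>t \<omega>. a *\<^sub>R B (t / a\<^sup>2) \<omega>) (a *\<^sub>R y))"
    using assms by (intro S.Q_eq_distr_D) (simp add: scale_quadrant del: mem_Times_iff)
  also have "D (\<lambda>t \<omega>. a *\<^sub>R B (t / a\<^sup>2) \<omega>) (a *\<^sub>R y) = (\<lambda>\<omega>. a *\<^sub>R D B y \<omega>)"
    by (rule ext) (rule D_scale[OF assms(2)])
  finally show ?thesis .
qed

lemma measurable_scaled_D:
  "y \<in> quadrant \<Longrightarrow> 0 < a \<Longrightarrow> (\<lambda>\<omega>. a *\<^sub>R D B y \<omega>) \<in> M \<rightarrow>\<^sub>M E_borel"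
  using measurable_D by (intro measurable_E_borelI borel_measurable_scaleR) (auto simp: scale_E D_in simp del: mem_Times_iff)

lemma emeasure_Q_scaled:
  assumes "y \<in> quadrant" "0 < a" "A \<in> sets E_borel"
  shows "emeasure (Q (a *\<^sub>R y)) A = emeasure (distr M borel (rat_path B)) {p. a *\<^sub>R D_of_path y p \<in> A}"
proof -
  have A: "A \<in> sets borel" using assms(3) by (simp add: sets_E_borel_iff)
  have "(\<lambda>p. a *\<^sub>R D_of_path y p) \<in> borel_measurable borel" by measurable
  then have m: "{p. a *\<^sub>R D_of_path y p \<in> A} \<in> sets borel"
    using measurable_sets[of "\<lambda>p. a *\<^sub>R D_of_path y p" borel borel A] A by (simp add: vimage_def)
  have "emeasure (Q (a *\<^sub>R y)) A = emeasure M ((\<lambda>\<omega>. a *\<^sub>R D B y \<omega>) -` A \<inter> space M)"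
    using assms measurable_scaled_D by (simp add: Q_scaled_eq emeasure_distr)
  also have "(\<lambda>\<omega>. a *\<^sub>R D B y \<omega>) -` A \<inter> space M = rat_path B -` {p. a *\<^sub>R D_of_path y p \<in> A} \<inter> space M"
    by (auto simp: D_eq_of_path[of _ y])
  also have "emeasure M \<dots> = emeasure (distr M borel (rat_path B)) {p. a *\<^sub>R D_of_path y p \<in> A}"
    using m measurable_B_path by (simp add: emeasure_distr)
  finally show ?thesis .
qed

lemma prob_space_Q:
  assumes "y \<in> quadrant"
  shows "prob_space (Q y)" "sets (Q y) = sets E_borel"
  unfolding Q_eq_distr_D[OF assms] using measurable_D_E[OF assms] by (auto intro: prob_space_distr)

lemma measurable_Q_affine:
  assumes a: "0 < a" and w: "w \<in> quadrant"
  shows "(\<lambda>z. Q (a *\<^sub>R z + w)) \<in> E_borel \<rightarrow>\<^sub>M prob_algebra E_borel"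
proof -
  have in_quadrant: "a *\<^sub>R z + w \<in> quadrant" if "z \<in> E" for z
    using a w E_subset_quadrant[OF that] by (intro add_quadrant) (auto simp: scale_quadrant simp del: mem_Times_iff)
  have "(\<lambda>(z, \<omega>). D B (a *\<^sub>R z + w) \<omega>) \<in> E_borel \<Otimes>\<^sub>M M \<rightarrow>\<^sub>M E_borel"
  proof (rule measurable_E_borelI)
    have [measurable]: "(\<lambda>p. rat_path B (snd p)) \<in> borel_measurable (E_borel \<Otimes>\<^sub>M M)"
      by (rule measurable_compose[OF measurable_snd measurable_B_path])
    have [measurable]: "(\<lambda>p. a *\<^sub>R fst p + w) \<in> borel_measurable (E_borel \<Otimes>\<^sub>M M)"
      by (rule measurable_compose[OF measurable_fst]) (rule measurable_from_E_borel, measurable)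
    have "(\<lambda>p. D_of_path (a *\<^sub>R fst p + w) (rat_path B (snd p))) \<in> borel_measurable (E_borel \<Otimes>\<^sub>M M)"
      by measurable
    then show "(\<lambda>(z, \<omega>). D B (a *\<^sub>R z + w) \<omega>) \<in> borel_measurable (E_borel \<Otimes>\<^sub>M M)"
      by (rule measurable_cong[THEN iffD2, rotated]) (auto simp: space_pair_measure D_eq_of_path)
    fix p assume "p \<in> space (E_borel \<Otimes>\<^sub>M M)"
    then obtain z \<omega> where p: "p = (z, \<omega>)" "z \<in> E" "\<omega> \<in> space M" by (cases p) (simp add: space_pair_measure)
    show "(case p of (z, \<omega>) \<Rightarrow> D B (a *\<^sub>R z + w) \<omega>) \<in> E"
      unfolding p(1) prod.case by (rule D_in[OF in_quadrant[OF p(2)] p(3)])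
  qed
  moreover have "(\<lambda>z. M) \<in> E_borel \<rightarrow>\<^sub>M prob_algebra M"
    by (rule measurable_const) (simp add: space_prob_algebra prob_space_axioms)
  ultimately have "(\<lambda>z. distr M E_borel (D B (a *\<^sub>R z + w))) \<in> E_borel \<rightarrow>\<^sub>M prob_algebra E_borel"
    by (intro measurable_distr_prob_space2[where f="\<lambda>z. D B (a *\<^sub>R z + w)"]) auto
  then show ?thesis
    by (rule measurable_cong[THEN iffD2, rotated]) (simp add: Q_eq_distr_D in_quadrant del: mem_Times_iff)
qed

lemma measurable_Q_shift:
  assumes a: "0 < a" and v: "v \<in> quadrant"
  shows "(\<lambda>z. Q (a *\<^sub>R (z + v))) \<in> E_borel \<rightarrow>\<^sub>M prob_algebra E_borel"
  using measurable_Q_affine[OF a, of "a *\<^sub>R v"] a v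
  by (simp add: scaleR_add_right scale_quadrant del: mem_Times_iff)

text \<open>
  Let \<open>\<phi>\<close> be the path of increments after the exit from \<open>[-y, \<infinity>)\<close>. Under \<open>M\<close> restricted to \<open>F\<close>, the
  pair of \<open>D B y\<close> and \<open>\<phi>\<close> has a product law by the strong Markov property, applied to the
  intersections of \<open>F\<close> with events of \<open>D B y\<close>. As \<open>D B (y + v)\<close> is a function of this pair, Fubini's
  theorem gives the claim.
\<close>

lemma strong_markov_D:
  assumes y: "y \<in> quadrant" and v: "v \<in> quadrant" and a: "0 < a" and F: "F \<in> exit_past y"
    and A: "A \<in> sets E_borel"
  shows "emeasure M {\<omega>\<in>F. a *\<^sub>R D B (y + v) \<omega> \<in> A} =
    (\<integral>\<^sup>+\<omega>. indicator F \<omega> * emeasure (Q (a *\<^sub>R (D B y \<omega> + v))) A \<partial>M)"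
proof -
  let ?L = "distr M borel (rat_path B)"
  interpret L: prob_space ?L by (rule prob_space_distr[OF measurable_B_path])
  have F_ev: "F \<in> events" using F by (simp add: exit_past_def)
  have A': "A \<in> sets borel" using A by (simp add: sets_E_borel_iff)
  define s where "s \<omega> = real_of_ereal (tau y \<omega>)" for \<omega>
  have s: "s \<in> borel_measurable M" unfolding s_def using measurable_tau by measurable
  have s0: "0 \<le> s \<omega>" for \<omega> by (simp add: s_def real_of_ereal_pos exit_time_nonneg)
  define \<phi> where "\<phi> \<omega> = rat_path (future B (s \<omega>)) \<omega>" for \<omega>
  have \<phi>: "\<phi> \<in> borel_measurable M"
  proof (rule measurable_coordinatewise_then_product)
    have B_at: "(\<lambda>\<omega>. B (f \<omega>) \<omega>) \<in> borel_measurable M"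
      if "f \<in> borel_measurable M" "\<And>\<omega>. 0 \<le> f \<omega>" for f
      by (rule measurable_at_random_time[of B M f]) (simp_all add: random_variable continuous_paths that)
    fix q
    show "(\<lambda>\<omega>. \<phi> \<omega> q) \<in> borel_measurable M"
      unfolding \<phi>_def rat_path_def future_def
    proof (rule borel_measurable_diff)
      show "(\<lambda>\<omega>. B (s \<omega> + max 0 (real_of_rat q)) \<omega>) \<in> borel_measurable M"
        by (rule B_at) (use s s0 in \<open>auto intro: add_nonneg_nonneg\<close>)
      show "(\<lambda>\<omega>. B (s \<omega>) \<omega>) \<in> borel_measurable M" by (rule B_at[OF s s0])
    qed
  qed
  define \<mu> where "\<mu> = density M (indicator F)"
  have \<mu>_em: "emeasure \<mu> X = emeasure M (F \<inter> X)" if "X \<in> events" for X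
    using that unfolding \<mu>_def by (rule emeasure_restricted[OF F_ev])
  interpret \<mu>: finite_measure \<mu>
    by (rule finite_measureI) (use \<mu>_em[of "space M"] in \<open>simp add: \<mu>_def\<close>)
  have D\<mu>: "D B y \<in> borel_measurable \<mu>" using measurable_D by (simp add: \<mu>_def)
  have \<phi>\<mu>: "\<phi> \<in> borel_measurable \<mu>" using \<phi> by (simp add: \<mu>_def)
  let ?X = "distr \<mu> borel (D B y)"
  interpret X: finite_measure ?X by (rule \<mu>.finite_measure_distr[OF D\<mu>])
  interpret XL: pair_sigma_finite ?X ?L ..
  let ?J = "distr \<mu> (borel \<Otimes>\<^sub>M borel) (\<lambda>\<omega>. (D B y \<omega>, \<phi> \<omega>))"
  have joint: "?X \<Otimes>\<^sub>M ?L = ?J"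
  proof (rule pair_measure_eqI)
    show "sets (?X \<Otimes>\<^sub>M ?L) = sets ?J"
      by (simp cong: sets_pair_measure_cong)
    fix S T assume "S \<in> sets ?X" "T \<in> sets ?L"
    then have S: "S \<in> sets borel" and T: "T \<in> sets borel" by auto
    let ?DS = "{\<omega>\<in>space M. D B y \<omega> \<in> S}"
    have FS: "F \<inter> ?DS \<in> exit_past y"
      using D_exit_past[OF y, of 0 S] S F by (intro exit_past_Int[OF y]) (auto simp: mem_quadrant simp del: mem_Times_iff)
    have DS: "?DS \<in> events"
      using D_exit_past[OF y, of 0 S] S by (simp add: mem_quadrant exit_past_def del: mem_Times_iff)
    have \<phi>T: "\<phi> -` T \<inter> space M \<in> events" by (rule measurable_sets[OF \<phi> T])
    have "emeasure ?J (S \<times> T) =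
      emeasure \<mu> (?DS \<inter> (\<phi> -` T \<inter> space M))"
      using S T D\<mu> \<phi>\<mu> by (subst emeasure_distr) (auto simp: \<mu>_def intro!: arg_cong[where f="emeasure _"])
    also have "\<dots> = emeasure M (F \<inter> (?DS \<inter> (\<phi> -` T \<inter> space M)))"
      using DS \<phi>T by (intro \<mu>_em) auto
    also have "F \<inter> (?DS \<inter> (\<phi> -` T \<inter> space M)) =
      {\<omega> \<in> F \<inter> ?DS. rat_path (future B (real_of_ereal (tau y \<omega>))) \<omega> \<in> T}"
      by (auto simp: \<phi>_def s_def)
    also have "emeasure M \<dots> = emeasure M (F \<inter> ?DS) * emeasure (distr M borel (rat_path (future B 0))) T"
    proof (rule strong_markov[OF measurable_tau exit_time_nonneg _ _ _ T])
      show "AE \<omega> in M. tau y \<omega> < \<infinity>" using AE_exit_finite by eventually_elim blast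
      show "F \<inter> ?DS \<in> events"
        "\<And>u. 0 < u \<Longrightarrow> {\<omega>\<in>F \<inter> ?DS. tau y \<omega> < ereal (real_of_rat u)} \<in> stopped_algebra M B (real_of_rat u)"
        using FS unfolding exit_past_def by blast+
    qed
    also have "distr M borel (rat_path (future B 0)) = ?L" by (rule distr_path_eq[OF refl])
    also have "emeasure M (F \<inter> ?DS) = emeasure ?X S"
      using \<mu>_em[OF DS] S D\<mu> by (simp add: emeasure_distr \<mu>_def vimage_def Int_def conj_commute)
    finally show "emeasure ?X S * emeasure ?L T = emeasure ?J (S \<times> T)" ..
  qed (unfold_locales)
  define G where "G = {(z, p). a *\<^sub>R D_of_path (z + v) p \<in> A}"
  have G: "G \<in> sets (borel \<Otimes>\<^sub>M borel)"
  proof -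
    have "(\<lambda>x. a *\<^sub>R D_of_path (fst x + v) (snd x)) \<in> borel_measurable (borel \<Otimes>\<^sub>M borel)" by measurable
    from measurable_sets[OF this A'] show ?thesis by (simp add: G_def vimage_def space_pair_measure case_prod_beta')
  qed
  have meas_event: "{\<omega>\<in>F. a *\<^sub>R D B (y + v) \<omega> \<in> A} \<in> events"
  proof -
    have "(\<lambda>\<omega>. a *\<^sub>R D B (y + v) \<omega>) \<in> borel_measurable M" using measurable_D by measurable
    from sets.Int[OF F_ev measurable_sets[OF this A']]
    have "F \<inter> ((\<lambda>\<omega>. a *\<^sub>R D B (y + v) \<omega>) -` A \<inter> space M) \<in> events" .
    also have "F \<inter> ((\<lambda>\<omega>. a *\<^sub>R D B (y + v) \<omega>) -` A \<inter> space M) = {\<omega>\<in>F. a *\<^sub>R D B (y + v) \<omega> \<in> A}"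
      using sets.sets_into_space[OF F_ev] by (intro set_eqI) (simp add: subset_eq, blast)
    finally show ?thesis .
  qed
  have pair_meas: "(\<lambda>\<omega>. (D B y \<omega>, \<phi> \<omega>)) \<in> \<mu> \<rightarrow>\<^sub>M borel \<Otimes>\<^sub>M borel"
    using D\<mu> \<phi>\<mu> by (rule measurable_Pair)
  let ?G = "(\<lambda>\<omega>. (D B y \<omega>, \<phi> \<omega>)) -` G \<inter> space M"
  have G_pre: "?G \<in> events"
    using measurable_sets[OF pair_meas G] by (simp add: \<mu>_def)
  have "emeasure M {\<omega>\<in>F. a *\<^sub>R D B (y + v) \<omega> \<in> A} = emeasure M (F \<inter> ?G)"
  proof (rule emeasure_eq_AE[OF _ meas_event sets.Int[OF F_ev G_pre]])
    show "AE \<omega> in M. \<omega> \<in> {\<omega>\<in>F. a *\<^sub>R D B (y + v) \<omega> \<in> A} \<longleftrightarrow> \<omega> \<in> F \<inter> ?G"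
      using AE_exit_finite AE_space
    proof eventually_elim
      case (elim \<omega>)
      have fin: "tau y \<omega> = ereal (s \<omega>)"
        using elim(1)[rule_format, of y] exit_time_nonneg[of B "quadrant_from (- y)" \<omega>] unfolding s_def by (cases "tau y \<omega>") auto
      have "D B (y + v) \<omega> = D (future B (s \<omega>)) (D B y \<omega> + v) \<omega>"
        using D_after_exit[of B \<omega> y v, OF continuous_paths[OF elim(2)] start[OF elim(2)] y v fin]
        by (simp add: future_def[abs_def])
      also have "\<dots> = D_of_path (D B y \<omega> + v) (\<phi> \<omega>)"
        unfolding \<phi>_def
      proof (rule D_eq_D_of_path)
        show "continuous_on {0..} (\<lambda>t. future B (s \<omega>) t \<omega>)"
          unfolding future_def using s0[of \<omega>]
          by (intro continuous_intros continuous_on_compose2[OF continuous_paths[OF elim(2)]]) auto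
      qed
      finally show ?case using elim(2) by (simp add: G_def)
    qed
  qed
  also have "\<dots> = emeasure \<mu> ?G"
    by (rule \<mu>_em[OF G_pre, symmetric])
  also have "\<dots> = emeasure (?X \<Otimes>\<^sub>M ?L) G"
    unfolding joint using G pair_meas by (simp add: emeasure_distr \<mu>_def)
  also have "\<dots> = (\<integral>\<^sup>+z. emeasure ?L (Pair z -` G) \<partial>?X)"
    using G by (intro L.emeasure_pair_measure_alt) (simp cong: sets_pair_measure_cong)
  also have "\<dots> = (\<integral>\<^sup>+\<omega>. emeasure ?L (Pair (D B y \<omega>) -` G) \<partial>\<mu>)"
  proof (rule nn_integral_distr[OF D\<mu>])
    show "(\<lambda>z. emeasure ?L (Pair z -` G)) \<in> borel_measurable ?X"
      using L.measurable_emeasure_Pair[of G ?X] G by (simp cong: sets_pair_measure_cong)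
  qed
  also have "\<dots> = (\<integral>\<^sup>+\<omega>. emeasure (Q (a *\<^sub>R (D B y \<omega> + v))) A \<partial>\<mu>)"
  proof (rule nn_integral_cong)
    fix \<omega> assume "\<omega> \<in> space \<mu>"
    then have \<omega>: "\<omega> \<in> space M" by (simp add: \<mu>_def)
    have "D B y \<omega> + v \<in> quadrant" by (rule add_quadrant[OF E_subset_quadrant[OF D_in[OF y \<omega>]] v])
    then show "emeasure ?L (Pair (D B y \<omega>) -` G) = emeasure (Q (a *\<^sub>R (D B y \<omega> + v))) A"
      using emeasure_Q_scaled[OF _ a A] by (simp add: G_def vimage_def del: mem_Times_iff)
  qed
  also have "\<dots> = (\<integral>\<^sup>+\<omega>. indicator F \<omega> * emeasure (Q (a *\<^sub>R (D B y \<omega> + v))) A \<partial>M)"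
    unfolding \<mu>_def
  proof (rule nn_integral_density)
    have "(\<lambda>z. emeasure (Q (a *\<^sub>R (z + v))) A) \<in> borel_measurable E_borel"
      using measurable_compose[OF measurable_prob_algebraD[OF measurable_Q_shift[OF a v]] measurable_emeasure_subprob_algebra[OF A]] .
    from measurable_compose[OF measurable_D_E[OF y] this]
    show "(\<lambda>\<omega>. emeasure (Q (a *\<^sub>R (D B y \<omega> + v))) A) \<in> borel_measurable M" .
  qed (use F_ev in simp)
  finally show ?thesis .
qed

text \<open>
  The expectation of the Markov property above, for the event that consists of all sample points.
\<close>

lemma Q_chapman_kolmogorov:
  assumes y: "y \<in> quadrant" and v: "v \<in> quadrant" and a: "0 < a"
  shows "Q y \<bind> (\<lambda>z. Q (a *\<^sub>R (z + v))) = Q (a *\<^sub>R (y + v))"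
proof -
  have yv: "y + v \<in> quadrant" using y v by (rule add_quadrant)
  have ayv: "a *\<^sub>R (y + v) \<in> quadrant" using yv a by (simp only: scale_quadrant)
  have Qy: "Q y \<in> space (prob_algebra E_borel)" using prob_space_Q[OF y] by (simp add: space_prob_algebra)
  note kernel = measurable_Q_shift[OF a v]
  show ?thesis
  proof (rule measure_eqI)
    show sets_eq: "sets (Q y \<bind> (\<lambda>z. Q (a *\<^sub>R (z + v)))) = sets (Q (a *\<^sub>R (y + v)))"
      using sets_bind'[OF Qy kernel] prob_space_Q(2)[OF ayv] by simp
    fix A assume "A \<in> sets (Q y \<bind> (\<lambda>z. Q (a *\<^sub>R (z + v))))"
    then have A: "A \<in> sets E_borel" using sets_bind'[OF Qy kernel] by simp
    have meas: "(\<lambda>z. emeasure (Q (a *\<^sub>R (z + v))) A) \<in> borel_measurable E_borel"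
      using measurable_compose[OF measurable_prob_algebraD[OF kernel] measurable_emeasure_subprob_algebra[OF A]] .
    have "emeasure (Q y \<bind> (\<lambda>z. Q (a *\<^sub>R (z + v)))) A = (\<integral>\<^sup>+z. emeasure (Q (a *\<^sub>R (z + v))) A \<partial>Q y)"
      by (rule emeasure_bind_prob_algebra[OF Qy kernel A])
    also have "\<dots> = (\<integral>\<^sup>+\<omega>. emeasure (Q (a *\<^sub>R (D B y \<omega> + v))) A \<partial>M)"
      unfolding Q_eq_distr_D[OF y] by (rule nn_integral_distr[OF measurable_D_E[OF y]]) (use meas in simp)
    also have "\<dots> = (\<integral>\<^sup>+\<omega>. indicator (space M) \<omega> * emeasure (Q (a *\<^sub>R (D B y \<omega> + v))) A \<partial>M)"
      by (intro nn_integral_cong) simp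
    also have "\<dots> = emeasure M {\<omega>\<in>space M. a *\<^sub>R D B (y + v) \<omega> \<in> A}"
      by (rule strong_markov_D[OF y v a space_exit_past[OF y] A, symmetric])
    also have "\<dots> = emeasure (Q (a *\<^sub>R (y + v))) A"
      unfolding Q_scaled_eq[OF yv a] using measurable_scaled_D[OF yv a] A
      by (simp add: emeasure_distr vimage_def Int_def conj_commute)
    finally show "emeasure (Q y \<bind> (\<lambda>z. Q (a *\<^sub>R (z + v)))) A = emeasure (Q (a *\<^sub>R (y + v))) A" .
  qed
qed

end

context standard_brownian begin

text \<open>
  The state \<open>z\<close> at time \<open>s\<close> means that \<open>D\<close> at \<open>y s\<close> is \<open>z / \<alpha> s\<close>, so at time \<open>t\<close> the law is \<open>Q\<close> at
  \<open>\<alpha> t\<close> times \<open>z / \<alpha> s + (y t - y s)\<close>. The process generates a smaller filtration than the pasts of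
  the exits, and their conditional law depends on the present state only, so the Markov property
  passes to it.
\<close>

lemma markov_process_D:
  fixes \<alpha> :: "real \<Rightarrow> real" and y :: "real \<Rightarrow> real \<times> real"
  assumes \<alpha>: "\<And>t. 0 \<le> t \<Longrightarrow> 0 < \<alpha> t"
    and y: "\<And>t. 0 \<le> t \<Longrightarrow> y t \<in> quadrant"
    and incr: "\<And>s t. 0 \<le> s \<Longrightarrow> s < t \<Longrightarrow> y t - y s \<in> quadrant"
    and X: "\<And>t \<omega>. 0 \<le> t \<Longrightarrow> \<omega> \<in> space M \<Longrightarrow> X t \<omega> = \<alpha> t *\<^sub>R D B (y t) \<omega>"
    and p: "\<And>s t z. 0 \<le> s \<Longrightarrow> s < t \<Longrightarrow> z \<in> E \<Longrightarrow> p s t z = Q ((\<alpha> t / \<alpha> s) *\<^sub>R z + \<alpha> t *\<^sub>R (y t - y s))"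
  shows "markov_process M E_borel p X"
  unfolding markov_process_def
proof (intro conjI allI impI ballI)
  show "prob_space M" by (rule prob_space_axioms)
  have ratio: "0 < \<alpha> t / \<alpha> s" if "0 \<le> s" "s < t" for s t using \<alpha>[of s] \<alpha>[of t] that by simp
  have shift: "\<alpha> t *\<^sub>R (y t - y s) \<in> quadrant" if "0 \<le> s" "s < t" for s t
    using incr[OF that] \<alpha>[of t] that by (simp only: scale_quadrant)
  show X_meas: "X t \<in> M \<rightarrow>\<^sub>M E_borel" if "0 \<le> t" for t
    using measurable_scaled_D[OF y[OF that] \<alpha>[OF that]]
    by (rule measurable_cong[THEN iffD2, rotated]) (rule X[OF that])
  have kernel: "p s t \<in> E_borel \<rightarrow>\<^sub>M prob_algebra E_borel" if st: "0 \<le> s" "s < t" for s t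
    using measurable_Q_affine[OF ratio[OF st] shift[OF st]]
    by (rule measurable_cong[THEN iffD2, rotated]) (simp add: p[OF st])
  show "transition_function E_borel p"
    unfolding transition_function_def
  proof (intro conjI allI impI ballI)
    fix s t :: real assume "0 \<le> s \<and> s < t"
    then show "p s t \<in> E_borel \<rightarrow>\<^sub>M prob_algebra E_borel" using kernel by blast
  next
    fix s t u :: real and z assume "0 \<le> s \<and> s < t \<and> t < u" and "z \<in> space E_borel"
    then have s: "0 \<le> s" "s < t" and t: "0 \<le> t" "t < u" and su: "s < u" and z: "z \<in> E" by auto
    let ?y = "(\<alpha> t / \<alpha> s) *\<^sub>R z + \<alpha> t *\<^sub>R (y t - y s)" and ?v = "\<alpha> t *\<^sub>R (y u - y t)" and ?a = "\<alpha> u / \<alpha> t"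
    have \<alpha>t: "0 < \<alpha> t" "0 < \<alpha> s" using \<alpha> s t by auto
    have "(\<alpha> t / \<alpha> s) *\<^sub>R z \<in> quadrant" using E_subset_quadrant[OF z] ratio[OF s] by (simp only: scale_quadrant)
    then have y': "?y \<in> quadrant" using shift[OF s] by (rule add_quadrant)
    have v': "?v \<in> quadrant" using incr[OF t] \<alpha>t(1) by (simp only: scale_quadrant)
    have Qy: "Q ?y \<in> space (prob_algebra E_borel)" using prob_space_Q[OF y'] by (simp add: space_prob_algebra)
    have "p s t z \<bind> p t u = Q ?y \<bind> p t u" by (simp add: p[OF s z])
    also have "\<dots> = Q ?y \<bind> (\<lambda>z. Q (?a *\<^sub>R (z + ?v)))"
    proof (rule bind_cong[OF refl])
      fix z' assume "z' \<in> space (Q ?y)"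
      then have "z' \<in> E" using prob_space_Q(2)[OF y', THEN sets_eq_imp_space_eq] by simp
      then show "p t u z' = Q (?a *\<^sub>R (z' + ?v))" using \<alpha>t by (simp add: p[OF t] scaleR_add_right)
    qed
    also have "\<dots> = Q (?a *\<^sub>R (?y + ?v))" by (rule Q_chapman_kolmogorov[OF y' v' ratio[OF t]])
    also have "?a *\<^sub>R (?y + ?v) = (\<alpha> u / \<alpha> s) *\<^sub>R z + \<alpha> u *\<^sub>R (y u - y s)"
      using \<alpha>t by (simp add: scaleR_add_right scaleR_diff_right)
    also have "Q \<dots> = p s u z" by (rule p[OF s(1) su z, symmetric])
    finally show "p s t z \<bind> p t u = p s u z" .
  qed
  fix s t :: real and A assume "0 \<le> s \<and> s < t" and A: "A \<in> sets E_borel"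
  then have s: "0 \<le> s" "s < t" and t0: "0 \<le> t" by auto
  let ?F = "natural_filtration M E_borel X s"
  let ?gen = "{X r -` S \<inter> space M | r S. 0 \<le> r \<and> r \<le> s \<and> S \<in> sets E_borel}"
  have sets_F: "sets ?F = sigma_sets (space M) ?gen" and space_F: "space ?F = space M"
    unfolding natural_filtration_def by (auto intro!: sets_measure_of space_measure_of)
  have gen_past: "?gen \<subseteq> exit_past (y s)"
  proof safe
    fix r S assume r: "0 \<le> r" "r \<le> s" and S: "S \<in> sets E_borel"
    let ?S = "(\<lambda>z. \<alpha> r *\<^sub>R z) -` S"
    have S': "?S \<in> sets borel"
      using measurable_sets[of "\<lambda>z. \<alpha> r *\<^sub>R z" borel borel S] S by (simp add: sets_E_borel_iff)
    have v: "y s - y r \<in> quadrant"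
      using incr[of r s] r by (cases "r = s") (auto simp: mem_quadrant simp del: mem_Times_iff)
    have "X r -` S \<inter> space M = {\<omega>\<in>space M. D B (y r) \<omega> \<in> ?S}" using X[OF r(1)] by auto
    then show "X r -` S \<inter> space M \<in> exit_past (y s)"
      using D_exit_past[OF y[OF r(1)] v S'] by simp
  qed
  have F_past: "G \<in> exit_past (y s)" if "G \<in> sets ?F" for G
    using sigma_algebra.sigma_sets_subset[OF sigma_algebra_exit_past[OF y[OF s(1)]] gen_past] that sets_F by auto
  have sub: "subalgebra M ?F"
    unfolding subalgebra_def space_F using F_past by (auto simp: exit_past_def)
  interpret finite_measure_subalgebra M ?F by unfold_locales (rule sub)
  define f where "f = indicat_real (X t -` A \<inter> space M)"
  define g where "g \<omega> = measure (p s t (X s \<omega>)) A" for \<omega>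
  have XtA: "X t -` A \<inter> space M \<in> events" by (rule measurable_sets[OF X_meas[OF t0] A])
  have Xs: "X s \<in> ?F \<rightarrow>\<^sub>M E_borel"
  proof (rule measurableI)
    show "X s \<omega> \<in> space E_borel" if "\<omega> \<in> space ?F" for \<omega>
      using measurable_space[OF X_meas[OF s(1)]] that by (simp add: space_F)
    show "X s -` S \<inter> space ?F \<in> sets ?F" if "S \<in> sets E_borel" for S
      unfolding sets_F space_F using s(1) that by (intro sigma_sets.Basic) blast
  qed
  have g_meas: "g \<in> borel_measurable ?F"
    unfolding g_def
    by (rule measurable_compose[OF Xs measurable_compose[OF kernel[OF s] measurable_measure_prob_algebra[OF A]]])
  have g_meas': "g \<in> borel_measurable M" by (rule measurable_from_subalg[OF sub g_meas])
  have XE: "X s \<omega> \<in> E" if "\<omega> \<in> space M" for \<omega>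
    using measurable_space[OF X_meas[OF s(1)] that] by simp
  have p_prob: "prob_space (p s t z)" if "z \<in> E" for z
    using measurable_space[OF kernel[OF s]] that by (auto simp: space_prob_algebra)
  have g_bound: "0 \<le> g \<omega>" "g \<omega> \<le> 1" if "\<omega> \<in> space M" for \<omega>
    unfolding g_def using prob_space.prob_le_1[OF p_prob[OF XE[OF that]]] by auto
  have f_int: "integrable M f"
    unfolding f_def using XtA by (simp add: emeasure_eq_measure)
  have g_int: "integrable M g"
    by (rule integrable_const_bound[where B=1]) (use g_meas' g_bound in auto)
  show "AE \<omega> in M. real_cond_exp M ?F (indicat_real (X t -` A \<inter> space M)) \<omega> = measure (p s t (X s \<omega>)) A"
    unfolding f_def[symmetric] g_def[symmetric]
  proof (rule real_cond_exp_charact[OF _ f_int g_int g_meas])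
    fix G assume G: "G \<in> sets ?F"
    have G_past: "G \<in> exit_past (y s)" by (rule F_past[OF G])
    then have G_ev: "G \<in> events" by (simp add: exit_past_def)
    have "ennreal (\<integral>\<omega>\<in>G. f \<omega> \<partial>M) = emeasure M (G \<inter> (X t -` A \<inter> space M))"
    proof -
      have "(\<integral>\<omega>\<in>G. f \<omega> \<partial>M) = (\<integral>\<omega>. indicator (G \<inter> (X t -` A \<inter> space M)) \<omega> \<partial>M)"
        unfolding set_lebesgue_integral_def f_def by (intro Bochner_Integration.integral_cong) (auto simp: indicator_def)
      also have "\<dots> = prob (G \<inter> (X t -` A \<inter> space M))" using G_ev XtA by simp
      finally show ?thesis by (simp add: emeasure_eq_measure)
    qed
    also have "G \<inter> (X t -` A \<inter> space M) = {\<omega>\<in>G. \<alpha> t *\<^sub>R D B (y s + (y t - y s)) \<omega> \<in> A}"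
      using sets.sets_into_space[OF G_ev] X[OF t0] by auto
    also have "emeasure M \<dots> = (\<integral>\<^sup>+\<omega>. indicator G \<omega> * emeasure (Q (\<alpha> t *\<^sub>R (D B (y s) \<omega> + (y t - y s)))) A \<partial>M)"
      by (rule strong_markov_D[OF y[OF s(1)] incr[OF s] \<alpha>[OF t0] G_past A])
    also have "\<dots> = (\<integral>\<^sup>+\<omega>. ennreal (indicator G \<omega> * g \<omega>) \<partial>M)"
    proof (rule nn_integral_cong)
      fix \<omega> assume \<omega>: "\<omega> \<in> space M"
      have "\<alpha> s \<noteq> 0" using \<alpha>[OF s(1)] by simp
      then have "\<alpha> t *\<^sub>R (D B (y s) \<omega> + (y t - y s)) = (\<alpha> t / \<alpha> s) *\<^sub>R X s \<omega> + \<alpha> t *\<^sub>R (y t - y s)"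
        by (simp add: X[OF s(1) \<omega>] scaleR_add_right)
      then have "Q (\<alpha> t *\<^sub>R (D B (y s) \<omega> + (y t - y s))) = p s t (X s \<omega>)" by (simp add: p[OF s XE[OF \<omega>]])
      moreover have "emeasure (p s t (X s \<omega>)) A = ennreal (g \<omega>)"
        unfolding g_def
        by (rule finite_measure.emeasure_eq_measure[OF prob_space.finite_measure[OF p_prob[OF XE[OF \<omega>]]]])
      ultimately show "indicator G \<omega> * emeasure (Q (\<alpha> t *\<^sub>R (D B (y s) \<omega> + (y t - y s)))) A = ennreal (indicator G \<omega> * g \<omega>)"
        using g_bound[OF \<omega>] by (auto simp: indicator_def)
    qed
    also have "\<dots> = ennreal (\<integral>\<omega>\<in>G. g \<omega> \<partial>M)"
    proof -
      have "integrable M (\<lambda>\<omega>. indicator G \<omega> * g \<omega>)"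
        using integrable_mult_indicator[OF G_ev g_int] by simp
      then show ?thesis
        unfolding set_lebesgue_integral_def real_scaleR_def
        by (intro nn_integral_eq_integral) (auto intro!: AE_I2 mult_nonneg_nonneg g_bound)
    qed
    finally have "ennreal (\<integral>\<omega>\<in>G. f \<omega> \<partial>M) = ennreal (\<integral>\<omega>\<in>G. g \<omega> \<partial>M)" .
    moreover have "0 \<le> (\<integral>\<omega>\<in>G. f \<omega> \<partial>M)" "0 \<le> (\<integral>\<omega>\<in>G. g \<omega> \<partial>M)"
      unfolding set_lebesgue_integral_def f_def
      by (auto intro!: Bochner_Integration.integral_nonneg_AE AE_I2 mult_nonneg_nonneg g_bound)
    ultimately show "(\<integral>\<omega>\<in>G. f \<omega> \<partial>M) = (\<integral>\<omega>\<in>G. g \<omega> \<partial>M)" by simp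
  qed
qed

text \<open>
  Along the curve the exit times \<open>T\<close> are nondecreasing, hence have left limits. They are
  right-continuous: a position outside the closed quadrant \<open>[-y t, \<infinity>)\<close> shortly after \<open>T t\<close> is also
  outside \<open>[-y s, \<infinity>)\<close> for \<open>s\<close> close to \<open>t\<close>. Composing with the continuous Brownian path keeps both
  properties.
\<close>

lemma cadlag_D:
  fixes \<alpha> :: "real \<Rightarrow> real" and y :: "real \<Rightarrow> real \<times> real"
  assumes \<alpha>: "continuous_on {0..} \<alpha>" and y: "continuous_on {0..} y"
    and incr: "\<And>s t. 0 \<le> s \<Longrightarrow> s < t \<Longrightarrow> y t - y s \<in> quadrant"
    and X: "\<And>t \<omega>. 0 \<le> t \<Longrightarrow> \<omega> \<in> space M \<Longrightarrow> X t \<omega> = \<alpha> t *\<^sub>R D B (y t) \<omega>"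
  shows "AE \<omega> in M. cadlag (\<lambda>t. X t \<omega>)"
  using AE_exit_finite AE_space
proof eventually_elim
  case (elim \<omega>)
  define T where "T t = real_of_ereal (tau (y t) \<omega>)" for t
  have fin: "tau (y t) \<omega> = ereal (T t)" for t
    using elim(1)[rule_format, of "y t"] exit_time_nonneg[of B "quadrant_from (- y t)" \<omega>] unfolding T_def
    by (cases "tau (y t) \<omega>") auto
  have T0: "0 \<le> T t" for t by (simp add: T_def real_of_ereal_pos exit_time_nonneg)
  have T_mono: "T s \<le> T t" if "0 \<le> s" "s \<le> t" for s t
  proof (cases "s = t")
    case False
    then show ?thesis
      using exit_time_mono[OF incr[of s t], of B "y s" \<omega>] that fin by simp
  qed simp
  have X_eq: "X t \<omega> = \<alpha> t *\<^sub>R (B (T t) \<omega> + y t)" if "0 \<le> t" for t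
    using X[OF that elim(2)] D_eq[OF fin] by simp
  have X_lim: "((\<lambda>s. X s \<omega>) \<longlongrightarrow> \<alpha> t *\<^sub>R (B L \<omega> + y t)) F"
    if T_lim: "(T \<longlongrightarrow> L) F" and L: "0 \<le> L" and t: "0 \<le> t" and F: "((\<lambda>s. s) \<longlongrightarrow> t) F" "\<forall>\<^sub>F s in F. 0 \<le> s" for t L F
  proof -
    have "((\<lambda>s. \<alpha> s *\<^sub>R (B (T s) \<omega> + y s)) \<longlongrightarrow> \<alpha> t *\<^sub>R (B L \<omega> + y t)) F"
      by (intro tendsto_scaleR tendsto_add tendsto_path[OF \<alpha> F(1) t F(2)] tendsto_path[OF y F(1) t F(2)]
          tendsto_path[of "\<lambda>t. B t \<omega>", OF continuous_paths[OF elim(2)] T_lim L]) (simp add: T0)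
    then show ?thesis
      by (rule Lim_transform_eventually) (use F(2) in \<open>eventually_elim, simp add: X_eq\<close>)
  qed
  show ?case
    unfolding cadlag_def
  proof (intro conjI allI impI)
    fix t :: real assume t: "0 \<le> t"
    have right: "\<forall>\<^sub>F s in at_right t. t < s" by (simp add: eventually_at_right_less)
    have "(T \<longlongrightarrow> T t) (at_right t)"
    proof (rule order_tendstoI)
      fix a assume a: "a < T t"
      show "\<forall>\<^sub>F s in at_right t. a < T s"
        using right by eventually_elim (use T_mono[OF t] a in \<open>auto intro: less_le_trans\<close>)
    next
      fix b assume "T t < b"
      then obtain r where r: "0 < r" "r < b" "B r \<omega> + y t \<in> - quadrant"
        using outside_after_exit[OF fin[of t], of "b - T t"] by (auto simp only: in_quadrant_from_iff Compl_iff) (metis add.commute diff_add_cancel diff_gt_0_iff_gt)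
      have "((\<lambda>s. B r \<omega> + y s) \<longlongrightarrow> B r \<omega> + y t) (at_right t)"
        using right t by (intro tendsto_add tendsto_const tendsto_path[OF y tendsto_ident_at]) (auto elim: eventually_mono)
      from topological_tendstoD[OF this _ r(3)]
      have "\<forall>\<^sub>F s in at_right t. B r \<omega> + y s \<in> - quadrant"
        using closed_quadrant by (simp only: open_Compl)
      then show "\<forall>\<^sub>F s in at_right t. T s < b"
      proof eventually_elim
        case (elim s)
        then have "tau (y s) \<omega> \<le> ereal r"
          using r(1) by (intro exit_time_le) (simp_all only: in_quadrant_from_iff Compl_iff not_False_eq_True)
        then show ?case using r(2) fin[of s] by simp
      qed
    qed
    then have "((\<lambda>s. X s \<omega>) \<longlongrightarrow> \<alpha> t *\<^sub>R (B (T t) \<omega> + y t)) (at_right t)"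
      using right t by (intro X_lim T0 tendsto_ident_at) (auto elim: eventually_mono)
    then show "continuous (at_right t) (\<lambda>t. X t \<omega>)"
      using X_eq[OF t] by (simp add: continuous_within)
  next
    fix t :: real assume t: "0 < t"
    have left: "\<forall>\<^sub>F s in at_left t. s \<in> {0<..<t}" using t by (rule eventually_at_leftI[rotated]) simp
    define L where "L = (SUP s\<in>{0..<t}. T s)"
    have bdd: "bdd_above (T ` {0..<t})" by (intro bdd_aboveI[of _ "T t"]) (auto intro: T_mono)
    have le_L: "T s \<le> L" if "0 \<le> s" "s < t" for s unfolding L_def using that by (intro cSUP_upper bdd) simp
    have "(T \<longlongrightarrow> L) (at_left t)"
    proof (rule order_tendstoI)
      fix a assume "a < L"
      then obtain s0 where s0: "0 \<le> s0" "s0 < t" "a < T s0"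
        unfolding L_def using t by (subst (asm) less_cSUP_iff[OF _ bdd]) auto
      have "\<forall>\<^sub>F s in at_left t. s \<in> {s0<..<t}" using s0(2) by (rule eventually_at_leftI[rotated]) simp
      then show "\<forall>\<^sub>F s in at_left t. a < T s"
        by eventually_elim (use T_mono[OF s0(1)] s0(3) in \<open>auto intro: less_le_trans\<close>)
    next
      fix b assume "L < b"
      then show "\<forall>\<^sub>F s in at_left t. T s < b"
        using left by (auto elim!: eventually_mono intro: le_less_trans[OF le_L])
    qed
    moreover have "0 \<le> L" using le_L[of 0] T0[of 0] t by simp
    ultimately have "((\<lambda>s. X s \<omega>) \<longlongrightarrow> \<alpha> t *\<^sub>R (B L \<omega> + y t)) (at_left t)"
      using left t by (intro X_lim tendsto_ident_at) (auto elim: eventually_mono)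
    then show "\<exists>l. ((\<lambda>t. X t \<omega>) \<longlongrightarrow> l) (at_left t)" by blast
  qed
qed

end

text \<open>
  On the boundary a coordinate is \<open>0\<close> and becomes negative at once, so the exit time is \<open>0\<close>.
\<close>

lemma (in standard_brownian) AE_D_boundary:
  assumes z: "z \<in> E"
  shows "AE \<omega> in M. D B z \<omega> = z"
proof -
  have "fst z = 0 \<or> snd z = 0"
    using z E_subset_quadrant[OF z] unfolding E_def Diff_iff mem_open_quadrant mem_quadrant by auto
  then obtain c where c: "c = fst \<or> c = snd" "c z = 0" by blast
  interpret c: brownian_coordinate M B c by unfold_locales (rule c(1))
  show ?thesis
    using c.AE_immediately_negative AE_space
  proof eventually_elim
    case (elim \<omega>)
    have below: "tau z \<omega> < ereal s" if "0 < s" for s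
    proof -
      obtain t where t: "0 < t" "t < s" "c (B t \<omega>) < 0" using elim(1) \<open>0 < s\<close> by blast
      then have "c (B t \<omega> + z) < 0" using c(2) by simp
      then have "B t \<omega> \<notin> quadrant_from (- z)"
        unfolding in_quadrant_from_iff mem_quadrant using c(1) by auto
      then show ?thesis unfolding exit_time_less_iff using t by (intro exI[of _ t]) simp
    qed
    have "tau z \<omega> = ereal 0"
    proof (cases rule: exit_time_real_cases[of B "quadrant_from (- z)" \<omega>])
      case inf then show ?thesis using below[of 1] by simp
    next
      case (fin r) then show ?thesis using below[of r] by (cases "r = 0") auto
    qed
    then show "D B z \<omega> = z" using D_eq[of B z \<omega> 0] start[OF elim(2)] by simp
  qed
qed

lemma (in standard_brownian) Q_boundary:
  assumes z: "z \<in> E"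
  shows "Q z = return E_borel z"
proof -
  note zq = E_subset_quadrant[OF z]
  have "Q z = distr M E_borel (D B z)" by (rule Q_eq_distr_D[OF zq])
  also have "\<dots> = distr M E_borel (\<lambda>_. z)"
    by (rule distr_cong_AE[OF refl refl AE_D_boundary[OF z] measurable_D_E[OF zq]]) (simp add: z)
  also have "\<dots> = return E_borel z" using z by (intro distr_const) simp
  finally show ?thesis .
qed

section \<open>The rates and the time change\<close>

lemma continuous_on_indefinite_LINT:
  fixes f :: "real \<Rightarrow> 'a::euclidean_space"
  assumes "\<And>t. 0 \<le> t \<Longrightarrow> set_integrable lborel {0..t} f"
  shows "continuous_on {0..} (\<lambda>t. LINT r:{0..t}|lborel. f r)"
proof -
  have "continuous (at t within {0..}) (\<lambda>t. LINT r:{0..t}|lborel. f r)" if t: "0 \<le> t" for t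
  proof -
    have eq: "(LINT r:{0..s}|lborel. f r) = integral {0..s} f" if "0 \<le> s" for s
      by (rule set_borel_integral_eq_integral(2)[OF assms[OF that]])
    have "continuous_on {0..t+1} (\<lambda>t. integral {0..t} f)"
      by (rule indefinite_integral_continuous_1, rule set_borel_integral_eq_integral(1), rule assms) (use t in simp)
    then have "continuous_on {0..t+1} (\<lambda>t. LINT r:{0..t}|lborel. f r)"
      by (rule continuous_on_eq) (simp add: eq)
    then have "continuous (at t within {0..t+1}) (\<lambda>t. LINT r:{0..t}|lborel. f r)"
      using t by (simp add: continuous_on_eq_continuous_within)
    moreover have "at t within {0..t+1} = at t within {0..}"
      by (rule at_within_nhd[of t "{t-1<..<t+1}"]) auto
    ultimately show ?thesis by simp
  qed
  then show ?thesis by (simp add: continuous_on_eq_continuous_within)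
qed

lemma LINT_combine:
  fixes f :: "real \<Rightarrow> 'a::euclidean_space"
  assumes "0 \<le> s" "s \<le> t" "set_integrable lborel {0..t} f"
  shows "(LINT r:{0..t}|lborel. f r) = (LINT r:{0..s}|lborel. f r) + (LINT r:{s..t}|lborel. f r)"
proof -
  have "set_integrable lborel {0..s} f" "set_integrable lborel {s..t} f"
    using assms by (auto intro: set_integrable_subset[OF assms(3)])
  then show ?thesis
    using Henstock_Kurzweil_Integration.integral_combine[OF assms(1,2) set_borel_integral_eq_integral(1)[OF assms(3)]] assms(3) by (simp add: set_borel_integral_eq_integral)
qed

text \<open>
  With \<open>h = 1 / C(0, -)\<close> this makes the integrand of \<open>\<Xi>\<close> integrable.
\<close>

lemma set_integrable_continuous_scaleR:
  fixes f :: "real \<Rightarrow> 'a::euclidean_space"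
  assumes h: "continuous_on {a..b} h" and f: "set_integrable lborel {a..b} f"
  shows "set_integrable lborel {a..b} (\<lambda>r. h r *\<^sub>R f r)"
proof -
  have "bounded (h ` {a..b})" by (intro compact_imp_bounded compact_continuous_image h compact_Icc)
  then obtain K where K: "\<And>r. r \<in> {a..b} \<Longrightarrow> norm (h r) \<le> K" unfolding bounded_iff by (metis imageI)
  have f': "integrable lborel (\<lambda>r. indicator {a..b} r *\<^sub>R f r)" using f by (simp add: set_integrable_def)
  have eq: "indicator {a..b} r *\<^sub>R h r *\<^sub>R f r = (indicator {a..b} r *\<^sub>R h r) *\<^sub>R (indicator {a..b} r *\<^sub>R f r)" for r
    by (simp add: indicator_def)
  show ?thesis
    unfolding set_integrable_def
  proof (rule Bochner_Integration.integrable_bound[OF integrable_scaleR_right[OF f', of K]])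
    have "(\<lambda>r. indicator {a..b} r *\<^sub>R h r) \<in> borel_measurable lborel"
      using borel_measurable_continuous_on_indicator[OF _ h] by simp
    then show "(\<lambda>r. indicator {a..b} r *\<^sub>R h r *\<^sub>R f r) \<in> borel_measurable lborel"
      unfolding eq using borel_measurable_integrable[OF f'] by (rule borel_measurable_scaleR)
    show "AE r in lborel. norm (indicator {a..b} r *\<^sub>R h r *\<^sub>R f r) \<le> norm (K *\<^sub>R indicator {a..b} r *\<^sub>R f r)"
    proof (rule AE_I2)
      fix r :: real
      show "norm (indicator {a..b} r *\<^sub>R h r *\<^sub>R f r) \<le> norm (K *\<^sub>R indicator {a..b} r *\<^sub>R f r)"
        using K[of r] by (cases "r \<in> {a..b}") (auto intro!: mult_right_mono)
    qed
  qed
qed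

locale rates =
  fixes c :: "real \<Rightarrow> real" and \<theta> :: "real \<Rightarrow> real \<times> real"
  assumes c_integrable: "locally_integrable c" and \<theta>_integrable: "locally_integrable \<theta>"
    and \<theta>_quadrant: "\<And>r. 0 \<le> r \<Longrightarrow> \<theta> r \<in> quadrant"
begin

lemma C_pos: "0 < C c s t"
  by (simp add: C_def)

lemma C_continuous: "continuous_on {0..} (C c 0)"
proof -
  have "continuous_on {0..} (\<lambda>t. LINT r:{0..t}|lborel. c r)"
    by (rule continuous_on_indefinite_LINT) (use c_integrable in \<open>simp add: locally_integrable_def\<close>)
  then have "continuous_on {0..} (\<lambda>t. exp (- (LINT r:{0..t}|lborel. c r)))"
    by (intro continuous_on_exp continuous_on_minus)
  then show ?thesis unfolding C_def[abs_def] .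
qed

lemma C_ratio:
  assumes "0 \<le> s" "s \<le> t"
  shows "C c s t = C c 0 t / C c 0 s"
proof -
  have "set_integrable lborel {0..t} c" using c_integrable assms by (simp add: locally_integrable_def)
  from LINT_combine[OF assms this] show ?thesis unfolding C_def exp_diff[symmetric] by simp
qed

lemma Xi_integrable:
  assumes "0 \<le> t"
  shows "set_integrable lborel {0..t} (\<lambda>r. \<theta> r /\<^sub>R C c 0 r)"
proof (rule set_integrable_continuous_scaleR)
  show "continuous_on {0..t} (\<lambda>r. inverse (C c 0 r))"
    using C_pos by (intro continuous_on_inverse continuous_on_subset[OF C_continuous]) (auto simp: less_imp_neq[symmetric])
  show "set_integrable lborel {0..t} \<theta>" using \<theta>_integrable assms by (simp add: locally_integrable_def)
qed

lemma Xi_continuous: "continuous_on {0..} (Xi c \<theta> 0)"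
  unfolding Xi_def[abs_def] by (intro continuous_on_indefinite_LINT Xi_integrable)

lemma Xi_combine: "0 \<le> s \<Longrightarrow> s \<le> t \<Longrightarrow> Xi c \<theta> 0 t = Xi c \<theta> 0 s + Xi c \<theta> s t"
  unfolding Xi_def by (intro LINT_combine Xi_integrable) auto

lemma Xi_quadrant:
  assumes "0 \<le> s" "s \<le> t"
  shows "Xi c \<theta> s t \<in> quadrant"
proof -
  let ?f = "\<lambda>r. indicator {s..t} r *\<^sub>R (\<theta> r /\<^sub>R C c 0 r)"
  have int: "integrable lborel ?f"
    using set_integrable_subset[OF Xi_integrable, of t "{s..t}"] assms by (simp add: set_integrable_def)
  have f: "0 \<le> fst (?f r)" "0 \<le> snd (?f r)" for r
    using \<theta>_quadrant[of r] assms C_pos[of 0 r] unfolding mem_quadrant by (auto simp: indicator_def less_imp_le)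
  have "0 \<le> fst (Xi c \<theta> s t)" "0 \<le> snd (Xi c \<theta> s t)"
    unfolding Xi_def set_lebesgue_integral_def
    by (subst integral_bounded_linear[symmetric, OF bounded_linear_fst int] integral_bounded_linear[symmetric, OF bounded_linear_snd int],
        rule Bochner_Integration.integral_nonneg, rule f)+
  then show ?thesis unfolding mem_quadrant by simp
qed

end

lemma C_const: "0 \<le> t \<Longrightarrow> C (\<lambda>_. c) 0 t = exp (- c * t)"
  by (simp add: C_def set_lebesgue_integral_def mult.commute)

lemma Xi_const:
  assumes "0 \<le> t"
  shows "Xi (\<lambda>_. c) (\<lambda>_. c *\<^sub>R \<theta>) 0 t = (exp (c * t) - 1) *\<^sub>R \<theta>"
proof -
  have "Xi (\<lambda>_. c) (\<lambda>_. c *\<^sub>R \<theta>) 0 t = (\<integral>r. indicator {0..t} r *\<^sub>R (c * exp (c * r)) *\<^sub>R \<theta> \<partial>lborel)"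
    unfolding Xi_def set_lebesgue_integral_def
    by (intro Bochner_Integration.integral_cong refl) (auto simp: indicator_def C_const exp_minus mult.commute)
  also have "\<dots> = exp (c * t) *\<^sub>R \<theta> - exp (c * 0) *\<^sub>R \<theta>"
  proof (rule integral_FTC_atLeastAtMost[OF assms])
    show "((\<lambda>r. exp (c * r) *\<^sub>R \<theta>) has_vector_derivative (c * exp (c * r)) *\<^sub>R \<theta>) (at r within {0..t})" for r
      by (auto intro!: derivative_eq_intros simp: mult.commute)
    show "continuous_on {0..t} (\<lambda>r. (c * exp (c * r)) *\<^sub>R \<theta>)" by (intro continuous_intros)
  qed
  finally show ?thesis by (simp add: scaleR_diff_left)
qed

text \<open>
  With \<open>\<alpha> t = exp (- c * t)\<close> and \<open>y t = x + (exp (c * t) - 1) *\<^sub>R \<theta>\<close> the kernel of the general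
  Markov process from \<open>s\<close> to \<open>t\<close> depends on \<open>t - s\<close> only.
\<close>

lemma (in standard_brownian) imub_D:
  assumes x: "x \<in> E" and \<theta>: "\<theta> \<in> quadrant" and c: "0 < c"
  shows "imub M c \<theta> (\<lambda>t \<omega>. exp (- c * t) *\<^sub>R D B (x + (exp (c * t) - 1) *\<^sub>R \<theta>) \<omega>)"
proof -
  let ?\<alpha> = "\<lambda>t. exp (- c * t)" and ?y = "\<lambda>t. x + (exp (c * t) - 1) *\<^sub>R \<theta>"
  have scale: "a *\<^sub>R \<theta> \<in> quadrant" if "0 \<le> a" for a
    using \<theta> that unfolding mem_quadrant by simp
  have incr: "?y t - ?y s \<in> quadrant" if "0 \<le> s" "s < t" for s t
  proof -
    have "?y t - ?y s = (exp (c * t) - exp (c * s)) *\<^sub>R \<theta>" by (simp add: scaleR_diff_left)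
    then show ?thesis using scale[of "exp (c * t) - exp (c * s)"] that c by simp
  qed
  have y: "?y t \<in> quadrant" if "0 \<le> t" for t
    using E_subset_quadrant[OF x] scale[of "exp (c * t) - 1"] that c by (intro add_quadrant) simp_all
  have kernel: "Q (exp (- c * (t - s)) *\<^sub>R z + (1 - exp (- c * (t - s))) *\<^sub>R \<theta>) =
      Q ((?\<alpha> t / ?\<alpha> s) *\<^sub>R z + ?\<alpha> t *\<^sub>R (?y t - ?y s))" for s t z
  proof -
    have ratio: "?\<alpha> t / ?\<alpha> s = exp (- c * (t - s))" by (simp add: exp_diff[symmetric] algebra_simps)
    have "?y t - ?y s = (exp (c * t) - exp (c * s)) *\<^sub>R \<theta>" by (simp add: scaleR_diff_left)
    then have "?\<alpha> t *\<^sub>R (?y t - ?y s) = (exp (- c * t) * (exp (c * t) - exp (c * s))) *\<^sub>R \<theta>"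
      by (simp only: scaleR_scaleR)
    also have "exp (- c * t) * (exp (c * t) - exp (c * s)) = 1 - exp (- c * (t - s))"
      by (simp add: right_diff_distrib exp_add[symmetric] algebra_simps)
    finally show ?thesis unfolding ratio by simp
  qed
  have "markov_process M E_borel (\<lambda>s t z. Q (exp (- c * (t - s)) *\<^sub>R z + (1 - exp (- c * (t - s))) *\<^sub>R \<theta>))
      (\<lambda>t \<omega>. ?\<alpha> t *\<^sub>R D B (?y t) \<omega>)"
    by (rule markov_process_D[of ?\<alpha> ?y]) (use y incr kernel in auto)
  moreover have "AE \<omega> in M. cadlag (\<lambda>t. ?\<alpha> t *\<^sub>R D B (?y t) \<omega>)"
    by (rule cadlag_D[of ?\<alpha> ?y]) (use incr in \<open>auto intro!: continuous_intros\<close>)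
  ultimately show ?thesis
    unfolding imub_def homogeneous_markov_process_def using Q_boundary by auto
qed

theorem theorem1p6:
  fixes M :: "'w measure" and B :: "real \<Rightarrow> 'w \<Rightarrow> real \<times> real"
    and cbar :: "real \<Rightarrow> real" and \<theta>bar :: "real \<Rightarrow> real \<times> real" and x :: "real \<times> real"
  assumes "planar_brownian M B 0"
    and "\<theta>bar \<in> borel_measurable (restrict_space borel {0..})"
    and "\<And>r. 0 \<le> r \<Longrightarrow> \<theta>bar r \<in> quadrant"
    and "locally_integrable \<theta>bar"
    and "cbar \<in> borel_measurable (restrict_space borel {0..})"
    and "\<And>r. 0 \<le> r \<Longrightarrow> 0 \<le> cbar r"
    and "locally_integrable cbar"
    and "x \<in> E"
  shows "markov_process M E_borel
           (\<lambda>s t z. Q (C cbar s t *\<^sub>R z + C cbar 0 t *\<^sub>R Xi cbar \<theta>bar s t))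
           (X_process B x cbar \<theta>bar) \<and>
         (AE \<omega> in M. cadlag (\<lambda>t. X_process B x cbar \<theta>bar t \<omega>)) \<and>
         (\<forall>\<theta>\<in>quadrant. \<forall>c>0.
           (\<forall>t\<ge>0. \<forall>\<omega>\<in>space M. X_process B x (\<lambda>_. c) (\<lambda>_. c *\<^sub>R \<theta>) t \<omega> =
              exp (- c * t) *\<^sub>R D B (x + (exp (c * t) - 1) *\<^sub>R \<theta>) \<omega>) \<and>
           imub M c \<theta> (\<lambda>t \<omega>. exp (- c * t) *\<^sub>R D B (x + (exp (c * t) - 1) *\<^sub>R \<theta>) \<omega>))"
proof (intro conjI ballI allI impI)
  interpret standard_brownian M B using assms(1) by (simp add: standard_brownian_def)
  interpret rates cbar \<theta>bar by (rule rates.intro[OF assms(7,4,3)])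
  let ?\<alpha> = "C cbar 0" and ?y = "\<lambda>t. x + Xi cbar \<theta>bar 0 t"
  have incr: "?y t - ?y s = Xi cbar \<theta>bar s t" if "0 \<le> s" "s \<le> t" for s t
    using Xi_combine[OF that] by simp
  have incr_quadrant: "?y t - ?y s \<in> quadrant" if "0 \<le> s" "s < t" for s t
    unfolding incr[OF that(1) less_imp_le[OF that(2)]] by (rule Xi_quadrant) (use that in auto)
  show "markov_process M E_borel
           (\<lambda>s t z. Q (C cbar s t *\<^sub>R z + C cbar 0 t *\<^sub>R Xi cbar \<theta>bar s t))
           (X_process B x cbar \<theta>bar)"
  proof (rule markov_process_D[of ?\<alpha> ?y])
    show "?y t \<in> quadrant" if "0 \<le> t" for t
      by (rule add_quadrant[OF E_subset_quadrant[OF assms(8)] Xi_quadrant]) (use that in auto)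
    show "Q (C cbar s t *\<^sub>R z + C cbar 0 t *\<^sub>R Xi cbar \<theta>bar s t) =
      Q ((?\<alpha> t / ?\<alpha> s) *\<^sub>R z + ?\<alpha> t *\<^sub>R (?y t - ?y s))" if "0 \<le> s" "s < t" for s t z
      unfolding incr[OF that(1) less_imp_le[OF that(2)]] C_ratio[OF that(1) less_imp_le[OF that(2)]] ..
  qed (simp_all only: X_process_def C_pos incr_quadrant)
  show "AE \<omega> in M. cadlag (\<lambda>t. X_process B x cbar \<theta>bar t \<omega>)"
  proof (rule cadlag_D[of ?\<alpha> ?y, OF C_continuous _ incr_quadrant])
    show "continuous_on {0..} ?y" by (rule continuous_on_add[OF continuous_on_const Xi_continuous])
  qed (simp_all only: X_process_def)
  fix \<theta> and c :: real assume "\<theta> \<in> quadrant" "0 < c"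
  then show "imub M c \<theta> (\<lambda>t \<omega>. exp (- c * t) *\<^sub>R D B (x + (exp (c * t) - 1) *\<^sub>R \<theta>) \<omega>)"
    by (intro imub_D assms(8))
next
  fix \<theta> and c t :: real and \<omega> assume "0 \<le> t"
  then show "X_process B x (\<lambda>_. c) (\<lambda>_. c *\<^sub>R \<theta>) t \<omega> = exp (- c * t) *\<^sub>R D B (x + (exp (c * t) - 1) *\<^sub>R \<theta>) \<omega>"
    by (simp add: X_process_def C_const Xi_const)
qed

end
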